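(* Let $K\in\mathbb{N}=\{1,2,\dots\}$ be fixed. For the number $X_n$ of key comparisons used by optimal $K$-pivot QuickSort there is a constant $\beta_K\in\mathbb{R}$ such that $$\mathbb{E}[X_n]=\alpha_K\, n\ln n+\beta_K\, n+o(n)\qquad(n\to\infty),$$ where $\alpha_K=\gamma_K/(H_{K+1}-1)$. In the case $K\le 4$, the error term $o(n)$ can be replaced by $\mathrm{O}(\log n)$.
   Context: Notation: $H_n=\sum_{i=1}^n \frac1i$. Probabilistic model. Fix $K\in\mathbb{N}$. Let $V_1,\dots,V_K,a_1,a_2,\dots$ be independent random variables, uniformly distributed on $[0,1]$. For $n>K$ the list to be sorted is $a_1,\dots,a_{n-K},V_1,\dots,V_K$; the last $K$ items are the pivots, and $p_1<\dots<p_K$ denote the sorted pivots. The spacings are $D_0=p_1$, $D_i=p_{i+1}-p_i$ for $1\le i\le K-1$, $D_K=1-p_K$, and $D=(D_0,\dots,D_K)$. The sublists $S_0,\dots,S_K$ consist of the non-pivot elements of the list lying in $(0,p_1),(p_1,p_2),\dots,(p_K,1)$, respectively, and $I_i^{(n)}=|S_i|$. Classification trees. $\mathcal{T}$ is the (finite) set of all binary search trees with internal nodes $p_1,\dots,p_K$ and external nodes (leaves) $S_0,\dots,S_K$ from left to right. For $t\in\mathcal{T}$, $h_t(i)$ is the depth of the leaf $S_i$ in $t$ (the number of comparisons needed to classify an element into $S_i$ using $t$), and $l_t(x_0,\dots,x_K)=\sum_{i=0}^K x_i h_t(i)$. Put $l_{\mathrm{opt}}(D)=\min_{t\in\mathcal{T}}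 l_t(D)$ and $\gamma_K=\mathbb{E}[l_{\mathrm{opt}}(D)]$. Optimal partition strategy. The elements $a_1,\dots,a_{n-K}$ are classified one after another. Let $C^{(k)}_i$ be the number of elements among $a_1,\dots,a_{k-1}$ classified into $S_i$. The element $a_k$ is classified using the tree $t\in\mathcal{T}$ minimizing $l_t(C^{(k)}_0+1,\dots,C^{(k)}_K+1)$; ties are resolved by choosing the smallest minimizing tree with respect to an arbitrary but fixed total order on $\mathcal{T}$. With $G_{t,k}$ the event that $a_k$ is classified using $t$, the number of comparisons in the partitioning stage is $$P_n=\sum_{k=1}^{n-K}\sum_{t\in\mathcal{T}}\sum_{i=0}^K \mathbf{1}_{G_{t,k}}\mathbf{1}_{\{a_k\in S_i\}}h_t(i)+R_K,$$ where $R_K\le K^2$ is the number of comparisons used to sort the $K$ pivots by a fixed elementary sorting algorithm. Number of key comparisons. For $0\le n\le K$, $X_n$ is the number of comparisons a fixed elementary sorting algorithm uses on $n$ elements in uniformly random order (at most $K^2$). For $n>K$ the distribution of $X_n$ is given recursively by $$X_n\stackrel{d}{=}\sum_{i=0}^K X^{(i)}_{I_i^{(n)}}+P_n,$$ where the $X^{(i)}_m$ are distributed as $X_m$, and the sequences $(X^{(i)}_m)_{m\ge0}$, $i=0,\dots,K$, are independent of each other and of $(I_0^{(n)},\dots,I_K^{(n)},P_n)$. *)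

theory Defs
  imports
    "HOL-Probability.Probability"
    "HOL-Combinatorics.Permutations"
    "HOL-Library.Tree"
    "HOL-Library.Landau_Symbols"
begin

(* Deterministic comparison sorts for inputs of a fixed length, as decision trees.
   The elements x 0, ..., x (n - 1) are only accessed through key comparisons; the
   output lists the indices in increasing order of their keys. *)
datatype comparison_sort =
    Output "nat list"
  | Compare nat nat comparison_sort comparison_sort

primrec sort_output :: "(nat \<Rightarrow> real) \<Rightarrow> comparison_sort \<Rightarrow> nat list" where
  "sort_output x (Output is) = is"
| "sort_output x (Compare i j A B) =
     (if x i \<le> x j then sort_output x A else sort_output x B)"

primrec comparisons :: "(nat \<Rightarrow> real) \<Rightarrow> comparison_sort \<Rightarrow> nat" where
  "comparisons x (Output is) = 0"
| "comparisons x (Compare i j A B) =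
     Suc (if x i \<le> x j then comparisons x A else comparisons x B)"

primrec accesses_below :: "nat \<Rightarrow> comparison_sort \<Rightarrow> bool" where
  "accesses_below n (Output is) \<longleftrightarrow> True"
| "accesses_below n (Compare i j A B) \<longleftrightarrow>
     i < n \<and> j < n \<and> accesses_below n A \<and> accesses_below n B"

definition sorts :: "nat \<Rightarrow> comparison_sort \<Rightarrow> bool" where
  "sorts n A \<longleftrightarrow> accesses_below n A \<and>
     (\<forall>x. inj_on x {..<n} \<longrightarrow>
        distinct (sort_output x A) \<and> set (sort_output x A) = {..<n} \<and>
        sorted (map x (sort_output x A)))"

definition cost_at_most :: "nat \<Rightarrow> comparison_sort \<Rightarrow> nat \<Rightarrow> bool" where
  "cost_at_most n A c \<longleftrightarrow> (\<forall>x. inj_on x {..<n} \<longrightarrow> comparisons x A \<le> c)"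

(* The pivots are v 1, ..., v K.  With the conventions p_0 = 0 and p_{K+1} = 1 all
   spacings and segments have the same form. *)
definition sorted_pivot :: "nat \<Rightarrow> (nat \<Rightarrow> real) \<Rightarrow> nat \<Rightarrow> real" where
  "sorted_pivot K v i = (0 # sort (map v [1..<Suc K]) @ [1]) ! i"

definition spacing :: "nat \<Rightarrow> (nat \<Rightarrow> real) \<Rightarrow> nat \<Rightarrow> real" where
  "spacing K v i = sorted_pivot K v (Suc i) - sorted_pivot K v i"

definition segment :: "nat \<Rightarrow> (nat \<Rightarrow> real) \<Rightarrow> nat \<Rightarrow> real set" where
  "segment K v i = {sorted_pivot K v i <..< sorted_pivot K v (Suc i)}"

definition sublist_size ::
  "nat \<Rightarrow> (nat \<Rightarrow> real) \<Rightarrow> (nat \<Rightarrow> real) \<Rightarrow> nat \<Rightarrow> nat \<Rightarrow> nat" where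
  "sublist_size K v x n i = card {k \<in> {1..n - K}. x k \<in> segment K v i}"

(* Node label j stands for the sorted pivot p_j; the leaves, read from left to right,
   stand for S_0, ..., S_K. *)
definition classification_trees :: "nat \<Rightarrow> nat tree set" where
  "classification_trees K = {t. inorder t = [1..<Suc K]}"

primrec leaf_depths :: "'a tree \<Rightarrow> nat list" where
  "leaf_depths Leaf = [0]"
| "leaf_depths (Node l b r) = map Suc (leaf_depths l @ leaf_depths r)"

definition leaf_depth :: "nat tree \<Rightarrow> nat \<Rightarrow> nat" where
  "leaf_depth t i = leaf_depths t ! i"

definition tree_cost :: "nat \<Rightarrow> nat tree \<Rightarrow> (nat \<Rightarrow> real) \<Rightarrow> real" where
  "tree_cost K t x = (\<Sum>i\<le>K. x i * real (leaf_depth t i))"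

definition opt_cost :: "nat \<Rightarrow> (nat \<Rightarrow> real) \<Rightarrow> real" where
  "opt_cost K x = Min ((\<lambda>t. tree_cost K t x) ` classification_trees K)"

definition minimizing_tree :: "nat \<Rightarrow> (nat \<Rightarrow> real) \<Rightarrow> nat tree \<Rightarrow> bool" where
  "minimizing_tree K x = is_arg_min (\<lambda>t. tree_cost K t x) (\<lambda>t. t \<in> classification_trees K)"

definition chosen_tree ::
  "nat \<Rightarrow> (nat tree \<times> nat tree) set \<Rightarrow> (nat \<Rightarrow> real) \<Rightarrow> nat tree" where
  "chosen_tree K r x =
     (THE t. minimizing_tree K x t \<and> (\<forall>t'. minimizing_tree K x t' \<longrightarrow> (t, t') \<in> r))"

definition classified_before ::
  "nat \<Rightarrow> (nat \<Rightarrow> real) \<Rightarrow> (nat \<Rightarrow> real) \<Rightarrow> nat \<Rightarrow> nat \<Rightarrow> nat" where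
  "classified_before K v x k i = card {j \<in> {1..<k}. x j \<in> segment K v i}"

definition classified_using ::
  "nat \<Rightarrow> (nat tree \<times> nat tree) set \<Rightarrow> (nat \<Rightarrow> real) \<Rightarrow> (nat \<Rightarrow> real) \<Rightarrow> nat tree \<Rightarrow> nat \<Rightarrow> bool"
  where
  "classified_using K r v x t k \<longleftrightarrow>
     t = chosen_tree K r (\<lambda>i. real (classified_before K v x k i) + 1)"

definition partition_comparisons ::
  "nat \<Rightarrow> (nat tree \<times> nat tree) set \<Rightarrow> comparison_sort \<Rightarrow>
     (nat \<Rightarrow> real) \<Rightarrow> (nat \<Rightarrow> real) \<Rightarrow> nat \<Rightarrow> nat" where
  "partition_comparisons K r R v x n =
     (\<Sum>k = 1..n - K. \<Sum>t \<in> classification_trees K. \<Sum>i\<le>K.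
        of_bool (classified_using K r v x t k) * of_bool (x k \<in> segment K v i) * leaf_depth t i)
     + comparisons (\<lambda>i. v (Suc i)) R"

definition mean_opt_cost :: "'a measure \<Rightarrow> nat \<Rightarrow> (nat \<Rightarrow> 'a \<Rightarrow> real) \<Rightarrow> real" where
  "mean_opt_cost M K V = (\<integral>\<omega>. opt_cost K (spacing K (\<lambda>j. V j \<omega>)) \<partial>M)"

(* r is the tie-breaking order, R sorts the K pivots, and A n sorts a list of length n
   for n \<le> K.  The variables Y i m are the copies X^(i)_m of the recursion.  Only the
   laws of the X n matter: nothing is assumed about their joint distribution.
   Y_indep_partition says that the whole family Y is independent of the pair consisting of
   the vector of sublist sizes and P_n; indep_var would need both to have the same type. *)
locale optimal_quicksort = prob_space M
  for M :: "'a measure" +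
  fixes K :: nat
    and V a :: "nat \<Rightarrow> 'a \<Rightarrow> real"
    and r :: "(nat tree \<times> nat tree) set"
    and R :: comparison_sort
    and A :: "nat \<Rightarrow> comparison_sort"
    and X :: "nat \<Rightarrow> 'a \<Rightarrow> nat"
    and Y :: "nat \<Rightarrow> nat \<Rightarrow> 'a \<Rightarrow> nat"
  assumes K_pos: "1 \<le> K"
    and indep_input:
      "indep_vars (\<lambda>_. borel) (case_sum V a) (Inl ` {1..K} \<union> Inr ` {1..})"
    and uniform_V: "\<And>i. i \<in> {1..K} \<Longrightarrow> distr M borel (V i) = uniform_measure lborel {0..1}"
    and uniform_a: "\<And>k. 1 \<le> k \<Longrightarrow> distr M borel (a k) = uniform_measure lborel {0..1}"
    and tie_order: "linear_order_on (classification_trees K) r"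
    and pivot_sort: "sorts K R" "cost_at_most K R (K\<^sup>2)"
    and small_sort: "\<And>n. n \<le> K \<Longrightarrow> sorts n (A n)"
      "\<And>n. n \<le> K \<Longrightarrow> cost_at_most n (A n) (K\<^sup>2)"
    and X_measurable: "\<And>n. random_variable (count_space UNIV) (X n)"
    and X_small: "\<And>n. n \<le> K \<Longrightarrow>
      distr M (count_space UNIV) (X n) =
      measure_pmf (map_pmf (\<lambda>\<pi>. comparisons (\<lambda>i. real (\<pi> i)) (A n))
        (pmf_of_set {\<pi>. \<pi> permutes {..<n}}))"
    and Y_copies: "\<And>i m. i \<le> K \<Longrightarrow>
      distr M (count_space UNIV) (Y i m) = distr M (count_space UNIV) (X m)"
    and Y_indep:
      "indep_vars (\<lambda>_. \<Pi>\<^sub>M m\<in>UNIV. count_space UNIV) (\<lambda>i \<omega> m. Y i m \<omega>) {..K}"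
    and Y_indep_partition: "\<And>n. K < n \<Longrightarrow>
      indep_set
        (sets (vimage_algebra (space M)
          (\<lambda>\<omega>. \<lambda>i\<in>{..K}. \<lambda>m. Y i m \<omega>)
          (\<Pi>\<^sub>M i\<in>{..K}. \<Pi>\<^sub>M m\<in>UNIV. count_space UNIV)))
        (sets (vimage_algebra (space M)
          (\<lambda>\<omega>. (\<lambda>i\<in>{..K}. sublist_size K (\<lambda>j. V j \<omega>) (\<lambda>k. a k \<omega>) n i,
                partition_comparisons K r R (\<lambda>j. V j \<omega>) (\<lambda>k. a k \<omega>) n))
          ((\<Pi>\<^sub>M i\<in>{..K}. count_space UNIV) \<Otimes>\<^sub>M count_space UNIV)))"
    and X_recursion: "\<And>n. K < n \<Longrightarrow>
      distr M (count_space UNIV) (X n) =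
      distr M (count_space UNIV) (\<lambda>\<omega>.
        (\<Sum>i\<le>K. Y i (sublist_size K (\<lambda>j. V j \<omega>) (\<lambda>k. a k \<omega>) n i) \<omega>)
        + partition_comparisons K r R (\<lambda>j. V j \<omega>) (\<lambda>k. a k \<omega>) n)"

end

theory Submission
  imports
    Defs
    "HOL-Computational_Algebra.Formal_Power_Series"
    "HOL-Computational_Algebra.Fundamental_Theorem_Algebra"
    "HOL-Real_Asymp.Real_Asymp"
begin

text \<open>By exchangeability the vector of sublist sizes is uniformly distributed on the weak compositions
  of \<open>n - K\<close> into \<open>K + 1\<close> parts, and given the counts \<open>c\<close> of the elements classified so far the next
  element falls into segment \<open>i\<close> with probability proportional to \<open>c ! i + 1\<close>. Hence the expected cost
  of classifying the \<open>k\<close>-th element is exactly the average of the optimal cost over all \<open>K\<close>-subsets of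
  the grid \<open>{1/N, \<dots>, (N - 1)/N}\<close> with \<open>N = K + k\<close>. Rounding the pivots to this grid shows that it differs
  from \<open>\<gamma>\<close> by \<open>O(1/k)\<close>, so the expected partitioning cost is \<open>\<gamma> n + O(log n)\<close>.

  The recurrence for the expectations becomes a polynomial equation in the operator
  \<open>\<theta> = (1 - z) d/dz\<close> on generating functions, with characteristic polynomial
  \<open>z (z + 1) \<dots> (z + K - 1) - (K + 1)!\<close>. Its root \<open>2\<close> is simple and resonates with the linear part of the
  partitioning cost, which yields \<open>\<alpha> n ln n + \<beta> n\<close>. All other roots have real part below \<open>2\<close>,
  and below \<open>1\<close> if \<open>K \<le> 4\<close>; peeling them off one at a time by first-order recurrences bounds the rest.\<close>

section \<open>First-order recurrences\<close>

text \<open>The unknown of the operator equation is the series of \<open>x n - p n\<close>, not of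
  \<open>x n\<close>. The toll then enters the right-hand side undifferentiated, so knowing it up to
  O(log n), with no control of its differences, suffices. \<open>(1 - z)^(-c)\<close> is an
  eigenvector of the operator for the eigenvalue \<open>c\<close>, with coefficients of order at
  most \<open>n^(Re c - 1)\<close>; this is why real part 2 is the border of linear growth. The
  denominator of \<open>\<alpha>\<close> is the derivative of the characteristic polynomial at 2, up
  to the factor (K + 1)!: the operator maps the generalised eigenvector with coefficients
  \<open>(n + 1) * harm (n + 1)\<close> to this derivative times \<open>(1 - z)^(-2)\<close>.

  On the probabilistic side no conditional laws or Dirichlet integrals occur. Pivots and elements
  are merged into one sequence with permutation-invariant law, and probabilities are found by
  averaging over the choice of the pivots or of the last element. Ties would spoil this counting, so
  the identities hold almost everywhere, where all inputs are distinct and interior to the unit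
  interval.\<close>

lemma norm_of_nat_add_le:
  fixes \<rho> :: complex
  assumes "Re \<rho> < c"
  shows "eventually (\<lambda>n. norm (of_nat n + \<rho>) \<le> real n + c \<and> 0 \<le> real n + c) at_top"
proof -
  \<comment> \<open>This is the squared claim: the slack \<open>c - Re \<rho>\<close> times a term
    linear in \<open>n\<close> eventually beats the fixed contribution of the imaginary
    part.\<close>
  have "eventually (\<lambda>n. (Im \<rho>)\<^sup>2 \<le> (c - Re \<rho>) * (2 * real n + c + Re \<rho>)) at_top"
    using assms by real_asymp
  moreover have "eventually (\<lambda>n. 0 \<le> real n + c) at_top" by real_asymp
  ultimately show ?thesis
  proof eventually_elim
    case (elim n)
    have "(norm (of_nat n + \<rho>))\<^sup>2 = (real n + Re \<rho>)\<^sup>2 + (Im \<rho>)\<^sup>2"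
      by (simp add: cmod_power2)
    also have "\<dots> \<le> (real n + c)\<^sup>2"
      using elim(1) by (simp add: power2_eq_square algebra_simps)
    finally show ?case using elim(2) by (auto intro: power2_le_imp_le)
  qed
qed

text \<open>A discrete Gronwall argument: once \<open>e n < \<delta> * \<epsilon> / 2\<close>, the
  shifted value \<open>u n - \<epsilon> / 2\<close> is damped by
  \<open>1 - \<delta> / (n + 2)\<close> in each step, and the product of these factors tends to 0
  because the harmonic series diverges.\<close>

lemma damped_eventually_le:
  fixes u e :: "nat \<Rightarrow> real"
  assumes "\<delta> > 0" "e \<longlonglongrightarrow> 0" "\<epsilon> > 0"
    and step: "eventually (\<lambda>n. u (Suc n) \<le> (1 - \<delta> / (real n + 2)) * u n + e n / (real n + 2)) at_top"
  shows "eventually (\<lambda>n. u n \<le> \<epsilon>) at_top"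
proof -
  have "eventually (\<lambda>n. e n < \<delta> * \<epsilon> / 2) at_top"
    using assms by (intro order_tendstoD) auto
  moreover have "eventually (\<lambda>n. 0 \<le> 1 - \<delta> / (real n + 2)) at_top"
    by real_asymp
  ultimately have "eventually (\<lambda>n. 0 \<le> 1 - \<delta> / (real n + 2) \<and>
      u (Suc n) - \<epsilon> / 2 \<le> (1 - \<delta> / (real n + 2)) * (u n - \<epsilon> / 2)) at_top"
    using step
  proof eventually_elim
    case (elim n)
    have "e n / (real n + 2) \<le> (\<delta> * \<epsilon> / 2) / (real n + 2)"
      using elim(1) by (intro divide_right_mono) auto
    moreover have "(1 - \<delta> / a) * (b - \<epsilon> / 2) = (1 - \<delta> / a) * b - \<epsilon> / 2 + (\<delta> * \<epsilon> / 2) / a" for a b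
      by (simp add: algebra_simps diff_divide_distrib)
    note this[of "real n + 2" "u n"]
    ultimately show ?case using elim by linarith
  qed
  then obtain N where N: "\<And>n. n \<ge> N \<Longrightarrow> 0 \<le> 1 - \<delta> / (real n + 2)"
      "\<And>n. n \<ge> N \<Longrightarrow> u (Suc n) - \<epsilon> / 2 \<le> (1 - \<delta> / (real n + 2)) * (u n - \<epsilon> / 2)"
    unfolding eventually_at_top_linorder by blast
  \<comment> \<open>The exponential normalises the bound at \<open>n = N\<close>; the absolute value
    makes \<open>C\<close> nonnegative, so that the damping factor may be replaced by a larger
    exponential.\<close>
  define C where "C = \<bar>u N - \<epsilon> / 2\<bar> * exp (\<delta> * harm (N + 1))"
  have bound: "u n - \<epsilon> / 2 \<le> C * exp (- \<delta> * harm (n + 1))" if "n \<ge> N" for n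
    using that
  proof (induction n rule: dec_induct)
    case base
    show ?case by (simp add: C_def mult.assoc mult_exp_exp)
  next
    case (step n)
    have "u (Suc n) - \<epsilon> / 2 \<le> (1 - \<delta> / (real n + 2)) * (u n - \<epsilon> / 2)"
      using N step by auto
    also have "\<dots> \<le> (1 - \<delta> / (real n + 2)) * (C * exp (- \<delta> * harm (n + 1)))"
      using N step by (intro mult_left_mono) auto
    also have "\<dots> \<le> exp (- \<delta> / (real n + 2)) * (C * exp (- \<delta> * harm (n + 1)))"
      using exp_ge_add_one_self[of "- \<delta> / (real n + 2)"]
      by (intro mult_right_mono) (auto simp: C_def)
    also have "\<dots> = C * exp (- \<delta> * harm (Suc n + 1))"
      by (simp add: harm_Suc exp_add [symmetric] field_simps)
    finally show ?case .
  qed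
  have "filterlim (\<lambda>n. harm (n + 1) :: real) at_top at_top"
  proof (rule filterlim_at_top_mono)
    show "filterlim (\<lambda>n. ln (real n + 1)) at_top at_top" by real_asymp
    show "eventually (\<lambda>n. ln (real n + 1) \<le> harm (n + 1)) at_top"
      using ln_le_harm by (intro always_eventually allI order_trans[OF ln_le_harm]) (simp add: harm_Suc)
  qed
  hence "filterlim (\<lambda>n. - \<delta> * harm (n + 1)) at_bot at_top"
    using \<open>\<delta> > 0\<close> by (intro filterlim_tendsto_neg_mult_at_bot[OF tendsto_const]) auto
  hence "(\<lambda>n. C * exp (- \<delta> * harm (n + 1))) \<longlonglongrightarrow> C * 0"
    by (intro tendsto_mult tendsto_const filterlim_compose[OF exp_at_bot])
  hence "eventually (\<lambda>n. C * exp (- \<delta> * harm (n + 1)) < \<epsilon> / 2) at_top"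
    using \<open>\<epsilon> > 0\<close> by (intro order_tendstoD) auto
  then show ?thesis
    using eventually_ge_at_top[of N]
  proof eventually_elim
    case (elim n)
    then show ?case using bound[of n] by linarith
  qed
qed

lemma first_order_norm_le:
  fixes g h :: "nat \<Rightarrow> complex"
  assumes "of_nat (n + 1) * g (n + 1) = (of_nat n + \<rho>) * g n + h n"
  shows "(real n + 1) * norm (g (Suc n)) \<le> norm (of_nat n + \<rho>) * norm (g n) + norm (h n)"
proof -
  have "(real n + 1) * norm (g (Suc n)) = norm (of_nat (n + 1) * g (n + 1))"
    unfolding norm_mult norm_of_nat by simp
  also have "\<dots> \<le> norm (of_nat n + \<rho>) * norm (g n) + norm (h n)"
    unfolding assms by (metis norm_mult norm_triangle_ineq)
  finally show ?thesis .
qed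

text \<open>Homogeneous solutions have order at most \<open>n^(Re \<rho> - 1)\<close>. After
  division by \<open>n + 1\<close> the gap between \<open>Re \<rho>\<close> and 2 becomes a damping
  factor \<open>1 - (2 - c) / (n + 2)\<close>.\<close>

lemma first_order_smallo:
  fixes g h :: "nat \<Rightarrow> complex"
  assumes rec: "\<And>n. of_nat (n + 1) * g (n + 1) = (of_nat n + \<rho>) * g n + h n"
    and "Re \<rho> < 2" and h: "h \<in> o(\<lambda>n. of_nat n)"
  shows "g \<in> o(\<lambda>n. of_nat n)"
proof -
  obtain c where c: "Re \<rho> < c" "c < 2" using \<open>Re \<rho> < 2\<close> dense by blast
  define u where "u = (\<lambda>n. norm (g n) / (real n + 1))"
  define e where "e = (\<lambda>n. norm (h n) / (real n + 1))"
  have "h \<in> o(\<lambda>n. of_real (real n + 1) :: complex)"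
  proof (rule landau_o.small_big_trans[OF h])
    show "(\<lambda>n. complex_of_nat n) \<in> O(\<lambda>n. of_real (real n + 1))"
      by (intro bigoI[of _ 1] always_eventually allI) (auto simp del: of_real_add)
  qed
  hence "(\<lambda>n. norm (h n / of_real (real n + 1))) \<longlonglongrightarrow> 0"
    by (intro tendsto_norm_zero smalloD_tendsto)
  hence e: "e \<longlonglongrightarrow> 0"
    unfolding e_def norm_divide norm_of_real by simp
  have step: "eventually (\<lambda>n. u (Suc n) \<le> (1 - (2 - c) / (real n + 2)) * u n + e n / (real n + 2)) at_top"
    using norm_of_nat_add_le[OF c(1)]
  proof eventually_elim
    case (elim n)
    have "(real n + 1) * norm (g (Suc n)) \<le> norm (of_nat n + \<rho>) * norm (g n) + norm (h n)"
      by (rule first_order_norm_le[OF rec])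
    also have "\<dots> \<le> (real n + c) * norm (g n) + norm (h n)"
      using elim by (intro add_right_mono mult_right_mono) auto
    finally have *: "(real n + 1) * norm (g (Suc n)) \<le> (real n + c) * norm (g n) + norm (h n)" .
    have "u (Suc n) = ((real n + 1) * norm (g (Suc n))) / ((real n + 1) * (real n + 2))"
      by (simp add: u_def divide_simps)
    also have "\<dots> \<le> ((real n + c) * norm (g n) + norm (h n)) / ((real n + 1) * (real n + 2))"
      using * by (intro divide_right_mono) auto
    also have "\<dots> = (1 - (2 - c) / (real n + 2)) * u n + e n / (real n + 2)"
      by (simp add: u_def e_def divide_simps)
    finally show ?case .
  qed
  show ?thesis
  proof (rule landau_o.smallI)
    fix \<epsilon> :: real assume "\<epsilon> > 0"
    hence "eventually (\<lambda>n. u n \<le> \<epsilon> / 2) at_top"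
      using damped_eventually_le[OF _ e _ step, of "\<epsilon> / 2"] c by auto
    then show "eventually (\<lambda>n. norm (g n) \<le> \<epsilon> * norm (of_nat n :: complex)) at_top"
      using eventually_ge_at_top[of 1]
    proof eventually_elim
      case (elim n)
      have "norm (g n) \<le> \<epsilon> / 2 * (real n + 1)"
        using elim(1) by (simp add: u_def divide_simps mult_ac)
      also have "\<dots> \<le> \<epsilon> / 2 * (real n + real n)"
        using elim(2) \<open>\<epsilon> > 0\<close> by (intro mult_left_mono) auto
      finally show ?case by simp
    qed
  qed
qed

abbreviation (input) bigo_ln :: "(nat \<Rightarrow> complex) set" where
  "bigo_ln \<equiv> O(\<lambda>n. of_real (ln (real n)))"

text \<open>Shifting the argument by 3 keeps the logarithm positive at every index, so the finitely
  many exceptional indices can be absorbed into the constant.\<close>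

lemma bigo_ln_obtains:
  fixes h :: "nat \<Rightarrow> complex"
  assumes "h \<in> bigo_ln"
  obtains C where "C > 0" "\<And>n. norm (h n) \<le> C * ln (real n + 3)"
proof -
  from assms obtain c where "eventually (\<lambda>n. norm (h n) \<le> c * norm (complex_of_real (ln (real n)))) at_top" "c > 0"
    by (elim landau_o.bigE) auto
  then obtain N where N: "\<And>n. n \<ge> N \<Longrightarrow> norm (h n) \<le> c * \<bar>ln (real n)\<bar>"
    unfolding eventually_at_top_linorder by auto
  define C where "C = Max (insert c ((\<lambda>n. norm (h n) / ln (real n + 3)) ` {..<N}))"
  have C: "c \<le> C" "\<And>n. n < N \<Longrightarrow> norm (h n) / ln (real n + 3) \<le> C"
    unfolding C_def by (auto intro!: Max_ge)
  have "norm (h n) \<le> C * ln (real n + 3)" for n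
  proof (cases "n < N")
    case True
    have "ln (real n + 3) > 0" by simp
    with C(2)[OF True] show ?thesis by (simp add: pos_divide_le_eq)
  next
    case False
    have "\<bar>ln (real n)\<bar> \<le> ln (real n + 3)" by (cases "n = 0") auto
    with C N[of n] False \<open>c > 0\<close> show ?thesis
      by (meson mult_mono not_less abs_ge_zero order_trans less_imp_le)
  qed
  moreover have "C > 0" using C \<open>c > 0\<close> by linarith
  ultimately show ?thesis using that by blast
qed

lemma ln_plus_3_bigo: "(\<lambda>n. ln (real n + 3)) \<in> O(\<lambda>n. ln (real n))"
  by real_asymp

lemma bigo_lnI:
  fixes g :: "nat \<Rightarrow> complex"
  assumes "eventually (\<lambda>n. norm (g n) \<le> A * ln (real n + 3)) at_top"
  shows "g \<in> bigo_ln"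
proof -
  have "g \<in> O(\<lambda>n. of_real (ln (real n + 3)) :: complex)"
    using assms by (intro bigoI[of _ A]) (simp del: of_real_add)
  also have "(\<lambda>n. of_real (ln (real n + 3)) :: complex) \<in> bigo_ln"
    using ln_plus_3_bigo by (simp only: landau_o.big.of_real_iff)
  finally show ?thesis .
qed

text \<open>For large \<open>A\<close> the sequence \<open>A * ln (n + 3)\<close> is a
  supersolution: the gap \<open>A * (1 - c)\<close> pays for the inhomogeneity \<open>C\<close>. The
  second entry in the maximum defining \<open>A\<close> starts the induction.\<close>

lemma first_order_bigo_ln:
  fixes g h :: "nat \<Rightarrow> complex"
  assumes rec: "\<And>n. of_nat (n + 1) * g (n + 1) = (of_nat n + \<rho>) * g n + h n"
    and "Re \<rho> < 1" and h: "h \<in> bigo_ln"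
  shows "g \<in> bigo_ln"
proof -
  obtain c where c: "Re \<rho> < c" "c < 1" using \<open>Re \<rho> < 1\<close> dense by blast
  obtain C where C: "C > 0" "\<And>n. norm (h n) \<le> C * ln (real n + 3)"
    using bigo_ln_obtains[OF h] by blast
  obtain N where N: "\<And>n. n \<ge> N \<Longrightarrow> norm (of_nat n + \<rho>) \<le> real n + c \<and> 0 \<le> real n + c"
    using norm_of_nat_add_le[OF c(1)] unfolding eventually_at_top_linorder by blast
  define A where "A = max (C / (1 - c)) (norm (g N) / ln (real N + 3))"
  have "A \<ge> C / (1 - c)" by (simp add: A_def)
  hence A: "C \<le> A * (1 - c)" using c by (simp add: pos_divide_le_eq)
  have "A \<ge> 0" using C c by (simp add: A_def le_max_iff_disj)
  have "norm (g n) \<le> A * ln (real n + 3)" if "n \<ge> N" for n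
    using that
  proof (induction n rule: dec_induct)
    case base
    have "norm (g N) / ln (real N + 3) \<le> A" by (simp add: A_def)
    moreover have "ln (real N + 3) > 0" by simp
    ultimately show ?case by (simp add: pos_divide_le_eq)
  next
    case (step n)
    have "(real n + 1) * norm (g (Suc n)) \<le> norm (of_nat n + \<rho>) * norm (g n) + norm (h n)"
      by (rule first_order_norm_le[OF rec])
    also have "\<dots> \<le> (real n + c) * (A * ln (real n + 3)) + C * ln (real n + 3)"
      using N[of n] step C by (intro add_mono mult_mono) auto
    also have "\<dots> = (A * (real n + c) + C) * ln (real n + 3)"
      by (simp add: algebra_simps)
    also have "\<dots> \<le> (A * (real n + 1)) * ln (real n + 3)"
      using A by (intro mult_right_mono) (auto simp: algebra_simps)
    also have "\<dots> \<le> (A * (real n + 1)) * ln (real (Suc n) + 3)"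
      using \<open>A \<ge> 0\<close> by (intro mult_left_mono) auto
    finally have "(real n + 1) * norm (g (Suc n)) \<le> (real n + 1) * (A * ln (real (Suc n) + 3))"
      by (simp add: mult_ac)
    thus ?case by (subst (asm) mult_le_cancel_left_pos) auto
  qed
  thus ?thesis
    by (intro bigo_lnI[of _ A]) (auto simp: eventually_at_top_linorder)
qed

text \<open>Here \<open>n + 1\<close> itself solves the homogeneous equation. Hence
  \<open>g n / (n + 1)\<close> has the summable increments \<open>h n / ((n + 1) * (n + 2))\<close>;
  \<open>b\<close> is its limit, and \<open>n + 1\<close> times the tail of the series is
  logarithmic.\<close>

lemma first_order_resonant:
  fixes g h :: "nat \<Rightarrow> complex"
  assumes rec: "\<And>n. of_nat (n + 1) * g (n + 1) = (of_nat n + 2) * g n + h n"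
    and h: "h \<in> bigo_ln"
  obtains b where "(\<lambda>n. g n - b * of_nat (n + 1)) \<in> bigo_ln"
proof -
  obtain C where C: "C > 0" "\<And>n. norm (h n) \<le> C * ln (real n + 3)"
    using bigo_ln_obtains[OF h] by blast
  define w where "w = (\<lambda>n. g n / of_nat (n + 1))"
  \<comment> \<open>An explicit majorant for the tails of the sum of
    \<open>ln (n + 3) / ((n + 1) * (n + 2))\<close>; the summand 1 pays for the growth of the
    logarithm from \<open>n\<close> to \<open>n + 1\<close>.\<close>
  define \<tau> where "\<tau> = (\<lambda>n. (ln (real n + 3) + 1) / (real n + 1))"
  have \<tau>: "ln (real n + 3) / ((real n + 1) * (real n + 2)) \<le> \<tau> n - \<tau> (Suc n)" for n
  proof -
    have "ln (real n + 4) = ln ((1 + 1 / (real n + 3)) * (real n + 3))"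
      by (simp add: divide_simps)
    also have "\<dots> = ln (1 + 1 / (real n + 3)) + ln (real n + 3)"
      by (intro ln_mult_pos) (auto simp: add_pos_nonneg)
    finally have "ln (real n + 4) - ln (real n + 3) = ln (1 + 1 / (real n + 3))" by simp
    also have "\<dots> \<le> 1 / (real n + 3)" by (rule ln_add_one_self_le_self) auto
    also have "\<dots> \<le> 1 / (real n + 1)" by (simp add: frac_le)
    finally have *: "(ln (real n + 4) - ln (real n + 3)) / (real n + 2) \<le> 1 / (real n + 1) / (real n + 2)"
      by (intro divide_right_mono) auto
    have "\<tau> n - \<tau> (Suc n) = ln (real n + 3) / ((real n + 1) * (real n + 2)) +
        (1 / (real n + 1) / (real n + 2) - (ln (real n + 4) - ln (real n + 3)) / (real n + 2))"
      by (simp add: \<tau>_def divide_simps) (simp add: algebra_simps)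
    with * show ?thesis by linarith
  qed
  have w_Suc: "w (Suc n) - w n = h n / (of_nat (n + 1) * of_nat (n + 2))" for n
  proof -
    have "w (Suc n) = (of_nat (n + 1) * g (n + 1)) / (of_nat (n + 1) * of_nat (n + 2))"
      by (simp add: w_def del: of_nat_add of_nat_Suc)
    also have "\<dots> = (of_nat (n + 2) * g n + h n) / (of_nat (n + 1) * of_nat (n + 2))"
      unfolding rec by simp
    also have "\<dots> = w n + h n / (of_nat (n + 1) * of_nat (n + 2))"
      by (simp add: w_def add_divide_distrib del: of_nat_add of_nat_Suc)
    finally show ?thesis by simp
  qed
  have w_diff: "norm (w (Suc n) - w n) \<le> C * (\<tau> n - \<tau> (Suc n))" for n
  proof -
    have "norm (w (Suc n) - w n) = norm (h n) / ((real n + 1) * (real n + 2))"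
      unfolding w_Suc norm_divide norm_mult norm_of_nat by (simp add: add_ac)
    also have "\<dots> \<le> C * ln (real n + 3) / ((real n + 1) * (real n + 2))"
      using C by (intro divide_right_mono) auto
    also have "\<dots> = C * (ln (real n + 3) / ((real n + 1) * (real n + 2)))" by simp
    also have "\<dots> \<le> C * (\<tau> n - \<tau> (Suc n))"
      using C \<tau> by (intro mult_left_mono) auto
    finally show ?thesis .
  qed
  have tau0: "\<tau> \<longlonglongrightarrow> 0" unfolding \<tau>_def by real_asymp
  have dist: "norm (w n - w m) \<le> C * (\<tau> m - \<tau> n)" if "m \<le> n" for m n
    using that
  proof (induction n rule: dec_induct)
    case (step n)
    have "norm (w (Suc n) - w m) \<le> norm (w (Suc n) - w n) + norm (w n - w m)"
      by (metis norm_triangle_ineq add.commute diff_add_cancel add_diff_eq)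
    also have "\<dots> \<le> C * (\<tau> n - \<tau> (Suc n)) + C * (\<tau> m - \<tau> n)"
      using step w_diff by (intro add_mono) auto
    finally show ?case by (simp add: algebra_simps)
  qed auto
  have "summable (\<lambda>n. w (Suc n) - w n)"
  proof (rule summable_comparison_test)
    show "\<exists>N. \<forall>n\<ge>N. norm (w (Suc n) - w n) \<le> C * (\<tau> n - \<tau> (Suc n))" using w_diff by blast
    show "summable (\<lambda>n. C * (\<tau> n - \<tau> (Suc n)))"
      by (intro summable_mult telescope_summable'[OF tau0])
  qed
  hence "convergent (\<lambda>n. \<Sum>m<n. w (Suc m) - w m)" by (simp add: summable_iff_convergent)
  hence "convergent (\<lambda>n. w n - w 0)" by (subst (asm) sum_lessThan_telescope)
  then obtain b0 where "(\<lambda>n. w n - w 0) \<longlonglongrightarrow> b0" by (auto simp: convergent_def)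
  from tendsto_add[OF this tendsto_const[of "w 0"]] have b: "w \<longlonglongrightarrow> b0 + w 0" by simp
  define b where "b = b0 + w 0"
  have "norm (b - w m) \<le> C * \<tau> m" for m
  proof (rule tendsto_upperbound)
    show "(\<lambda>n. norm (w n - w m)) \<longlonglongrightarrow> norm (b - w m)"
      unfolding b_def by (intro tendsto_intros b)
    show "\<forall>\<^sub>F n in sequentially. norm (w n - w m) \<le> C * \<tau> m"
      using eventually_ge_at_top[of m]
    proof eventually_elim
      case (elim n)
      have "\<tau> n \<ge> 0" by (simp add: \<tau>_def)
      hence "C * (\<tau> m - \<tau> n) \<le> C * \<tau> m" using C by (simp add: algebra_simps)
      with dist[OF elim] show ?case by linarith
    qed
  qed auto
  hence bd: "norm (g m - b * of_nat (m + 1)) \<le> (2 * C) * ln (real m + 3)" for m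
  proof -
    assume *: "\<And>m. norm (b - w m) \<le> C * \<tau> m"
    have "norm (g m - b * of_nat (m + 1)) = norm ((w m - b) * of_nat (m + 1))"
      unfolding w_def by (simp add: left_diff_distrib del: of_nat_Suc of_nat_add)
    also have "\<dots> = norm (b - w m) * (real m + 1)" unfolding norm_mult norm_of_nat by (simp add: norm_minus_commute)
    also have "\<dots> \<le> C * \<tau> m * (real m + 1)" using * by (intro mult_right_mono) auto
    also have "\<dots> = C * (ln (real m + 3) + 1)" by (simp add: \<tau>_def)
    also have "1 \<le> ln (real m + 3)"
    proof -
      have "1 = ln (exp (1::real))" by simp
      also have "\<dots> \<le> ln (real m + 3)" using exp_le by (subst ln_le_cancel_iff) auto
      finally show ?thesis .
    qed
    finally show ?thesis using C by (simp add: algebra_simps)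
  qed
  show ?thesis
    by (rule that[of b], rule bigo_lnI[of _ "2 * C"]) (use bd in auto)
qed

section \<open>The Euler operator on generating functions\<close>

text \<open>The factor \<open>1 - z\<close> makes the powers \<open>(1 - z)^(-c)\<close>
  eigenvectors with eigenvalue \<open>c\<close>, and it keeps the coefficient recurrence
  first-order.\<close>

definition euler_deriv :: "complex fps \<Rightarrow> complex fps" where
  "euler_deriv F = (1 - fps_X) * fps_deriv F"

text \<open>Horner's scheme for the polynomial \<open>p\<close> evaluated at the operator
  \<open>euler_deriv\<close> and applied to \<open>F\<close>.\<close>

definition euler_op :: "complex poly \<Rightarrow> complex fps \<Rightarrow> complex fps" where
  "euler_op p F = fold_coeffs (\<lambda>a G. fps_const a * F + euler_deriv G) p 0"

lemma euler_deriv_nth: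
  "fps_nth (euler_deriv F) n = of_nat (n + 1) * fps_nth F (n + 1) - of_nat n * fps_nth F n"
  by (simp add: euler_deriv_def left_diff_distrib)

lemma euler_deriv_add: "euler_deriv (F + G) = euler_deriv F + euler_deriv G"
  and euler_deriv_diff: "euler_deriv (F - G) = euler_deriv F - euler_deriv G"
  and euler_deriv_cmult: "euler_deriv (fps_const c * F) = fps_const c * euler_deriv F"
  and euler_deriv_0 [simp]: "euler_deriv 0 = 0"
  by (simp_all add: euler_deriv_def algebra_simps)

lemma euler_op_0 [simp]: "euler_op 0 F = 0"
  by (simp add: euler_op_def)

lemma euler_op_pCons [simp]: "euler_op (pCons a p) F = fps_const a * F + euler_deriv (euler_op p F)"
  by (cases "a = 0 \<and> p = 0") (auto simp: euler_op_def)

lemma euler_op_add: "euler_op (p + q) F = euler_op p F + euler_op q F"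
  by (induction p q rule: poly_induct2) (simp_all add: euler_deriv_add algebra_simps flip: fps_const_add)

lemma euler_op_smult: "euler_op (smult c p) F = fps_const c * euler_op p F"
  by (induction p) (simp_all add: euler_deriv_cmult algebra_simps flip: fps_const_mult)

lemma euler_op_diff: "euler_op (p - q) F = euler_op p F - euler_op q F"
  using euler_op_add[of "p - q" q F] by simp

lemma euler_op_linear_mult:
  "euler_op ([:c, 1:] * q) F = euler_deriv (euler_op q F) + fps_const c * euler_op q F"
  by (simp add: euler_op_add euler_op_smult)

lemma euler_op_diff_right: "euler_op p (F - G) = euler_op p F - euler_op p G"
  by (induction p) (simp_all add: euler_deriv_diff right_diff_distrib)

lemma euler_op_cmult_right: "euler_op p (fps_const c * F) = fps_const c * euler_op p F"
  by (induction p) (simp_all add: euler_deriv_cmult algebra_simps)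

lemma euler_op_deriv_commute: "euler_op p (euler_deriv F) = euler_deriv (euler_op p F)"
  by (induction p) (simp_all add: euler_deriv_cmult euler_deriv_add)

lemma euler_op_eigenvector:
  assumes "euler_deriv F = fps_const c * F"
  shows "euler_op p F = fps_const (poly p c) * F"
proof (induction p)
  case (pCons a p)
  have "euler_op (pCons a p) F = fps_const a * F + fps_const (poly p c) * (fps_const c * F)"
    by (simp add: pCons.IH euler_deriv_cmult assms)
  also have "\<dots> = fps_const (poly (pCons a p) c) * F"
    by (simp add: algebra_simps flip: fps_const_mult fps_const_add)
  finally show ?case .
qed simp

text \<open>The roots are peeled off by induction on the degree: if \<open>Q\<close> is
  \<open>[:- \<rho>, 1:] * R\<close>, then \<open>euler_op R G\<close> solves a first-order equation
  with right-hand side \<open>euler_op Q G\<close>, so \<open>step\<close> applies to it. Leaving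
  the growth class \<open>S\<close> abstract lets one induction serve both o(n) and O(log
  n).\<close>

lemma euler_op_solution_closed:
  assumes "Q \<noteq> 0" and "\<And>\<rho>. poly Q \<rho> = 0 \<Longrightarrow> Re \<rho> < c"
    and step: "\<And>\<rho> G. Re \<rho> < c \<Longrightarrow> S (euler_deriv G - fps_const \<rho> * G) \<Longrightarrow> S G"
    and scale: "\<And>a G. S G \<Longrightarrow> S (fps_const a * G)"
    and "S (euler_op Q G)"
  shows "S G"
  using assms(1,2,5)
proof (induction "degree Q" arbitrary: Q rule: less_induct)
  case less
  show ?case
  proof (cases "degree Q = 0")
    case True
    then obtain a where a: "Q = [:a:]" "a \<noteq> 0" using less.prems(1) by (auto elim: degree_eq_zeroE)
    have "S (fps_const (inverse a) * (fps_const a * G))"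
      using less.prems(3) a by (intro scale[of "fps_const a * G"]) auto
    moreover have "fps_const (inverse a) * (fps_const a * G) = G"
      using a by (simp add: mult.assoc [symmetric])
    ultimately show ?thesis by simp
  next
    case False
    then obtain \<rho> where \<rho>: "poly Q \<rho> = 0"
      using fundamental_theorem_of_algebra[of Q] by (auto simp: constant_degree)
    then obtain R where R: "Q = [:- \<rho>, 1:] * R" by (auto simp: poly_eq_0_iff_dvd dvd_def)
    have "R \<noteq> 0" using R less.prems(1) by auto
    hence deg: "degree R < degree Q" unfolding R by (subst degree_mult_eq) auto
    have "S (euler_deriv (euler_op R G) - fps_const \<rho> * euler_op R G)"
      using less.prems(3) unfolding R euler_op_linear_mult by (simp flip: fps_const_neg)
    hence "S (euler_op R G)"
      using less.prems(2)[OF \<rho>] step by blast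
    moreover have "Re \<sigma> < c" if "poly R \<sigma> = 0" for \<sigma>
      using less.prems(2)[of \<sigma>] that R by simp
    ultimately show ?thesis using less.hyps[OF deg \<open>R \<noteq> 0\<close>] by blast
  qed
qed

text \<open>Differentiating \<open>(1 - z)^k\<close> produces \<open>- k (1 - z)^k\<close> after
  multiplication by \<open>1 - z\<close>; the next factor, operator plus \<open>k\<close>, cancels
  exactly this term.\<close>

lemma euler_op_pochhammer:
  "euler_op (pochhammer [:0, 1:] k) F = (1 - fps_X) ^ k * (fps_deriv ^^ k) F"
proof (induction k)
  case (Suc k)
  have "pochhammer [:0, 1 :: complex:] (Suc k) = [:of_nat k, 1:] * pochhammer [:0, 1:] k"
    by (simp add: pochhammer_Suc of_nat_poly)
  hence "euler_op (pochhammer [:0, 1:] (Suc k)) F =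
    euler_deriv ((1 - fps_X) ^ k * (fps_deriv ^^ k) F) + of_nat k * ((1 - fps_X) ^ k * (fps_deriv ^^ k) F)"
    by (simp only: euler_op_linear_mult Suc.IH fps_of_nat)
  also have "\<dots> = (1 - fps_X) ^ Suc k * (fps_deriv ^^ Suc k) F"
  proof -
    have *: "(1 - fps_X) * fps_deriv ((1 - fps_X) ^ k) = - (of_nat k * (1 - fps_X :: complex fps) ^ k)"
    proof (cases k)
      case (Suc j)
      have "fps_deriv ((1 - fps_X :: complex fps) ^ k) = - (of_nat k * (1 - fps_X) ^ j)"
        unfolding fps_deriv_power Suc by (simp flip: fps_of_nat fps_const_neg)
      thus ?thesis unfolding Suc power_Suc by (simp only: mult_minus_right mult.left_commute)
    qed simp
    have "euler_deriv ((1 - fps_X) ^ k * (fps_deriv ^^ k) F) =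
        (1 - fps_X) * fps_deriv ((1 - fps_X) ^ k) * (fps_deriv ^^ k) F + (1 - fps_X) ^ Suc k * (fps_deriv ^^ Suc k) F"
      by (simp add: euler_deriv_def algebra_simps)
    thus ?thesis unfolding * by (simp add: algebra_simps)
  qed
  finally show ?case .
qed (simp add: one_pCons)

lemma higher_fps_deriv_nth:
  "fps_nth ((fps_deriv ^^ k) F) n = fact k * of_nat ((n + k) choose k) * fps_nth (F :: complex fps) (n + k)"
proof (induction k arbitrary: n)
  case (Suc k)
  have "fact k * (n + 1) * ((n + 1 + k) choose k) = fact (Suc k) * ((n + Suc k) choose Suc k)"
    using Suc_times_binomial_add[of k n] by (simp add: add_ac del: binomial_Suc_Suc mult_Suc mult_Suc_right)
  hence "of_nat (fact k * (n + 1) * ((n + 1 + k) choose k)) =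
         (of_nat (fact (Suc k) * ((n + Suc k) choose Suc k)) :: complex)" by (rule arg_cong)
  hence eq: "fact k * of_nat (n + 1) * of_nat ((n + 1 + k) choose k) =
      fact (Suc k) * (of_nat ((n + Suc k) choose Suc k) :: complex)"
    by (simp only: of_nat_mult of_nat_fact)
  have "fps_nth ((fps_deriv ^^ Suc k) F) n = of_nat (n + 1) * fps_nth ((fps_deriv ^^ k) F) (n + 1)"
    by simp
  also have "\<dots> = (fact k * of_nat (n + 1) * of_nat ((n + 1 + k) choose k)) * fps_nth F (n + Suc k)"
    unfolding Suc.IH by (simp only: mult_ac add_ac Suc_eq_plus1)
  finally show ?case unfolding eq .
qed simp

section \<open>The characteristic polynomial and the location of its roots\<close>

lemma poly_pochhammer_X: "poly (pochhammer [:0, 1:] k) (z :: complex) = pochhammer z k"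
  by (induction k) (simp_all add: pochhammer_Suc of_nat_poly algebra_simps)

definition char_poly :: "nat \<Rightarrow> complex poly" where
  "char_poly K = pochhammer [:0, 1:] K - [:fact (K + 1):]"

lemma pochhammer_2: "pochhammer (2 :: 'a :: field_char_0) k = fact (k + 1)"
  by (induction k) (simp_all add: pochhammer_Suc algebra_simps)

lemma poly_char_poly: "poly (char_poly K) z = pochhammer z K - fact (K + 1)"
  by (simp add: char_poly_def poly_pochhammer_X)

text \<open>The logarithmic derivative of \<open>z (z + 1) ... (z + K - 1)\<close> at 2 is 1/2 + ...
  + 1/(K + 1). This is where the denominator of \<open>\<alpha>\<close> originates.\<close>

lemma poly_pderiv_char_poly_2:
  "poly (pderiv (char_poly K)) 2 = fact (K + 1) * (harm (Suc K) - 1)"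
proof -
  have "poly (pderiv (pochhammer [:0, 1:] K)) (2 :: complex) = fact (K + 1) * (harm (Suc K) - 1)"
  proof (induction K)
    case (Suc k)
    have eq: "pochhammer [:0, 1 :: complex:] (Suc k) = pochhammer [:0, 1:] k * [:of_nat k, 1:]"
      by (simp add: pochhammer_Suc of_nat_poly)
    have "poly (pderiv (pochhammer [:0, 1 :: complex:] (Suc k))) 2 =
        fact (k + 1) + fact (k + 1) * (harm (Suc k) - 1) * (of_nat k + 2)"
      unfolding eq pderiv_mult poly_add poly_mult Suc.IH poly_pochhammer_X pochhammer_2
      by (simp add: pderiv_pCons algebra_simps)
    also have "\<dots> = fact (Suc k + 1) * (harm (Suc (Suc k)) - 1)"
    proof -
      have "(of_nat k + 2 :: complex) \<noteq> 0"
        by (metis of_nat_add of_nat_numeral of_nat_eq_0_iff add_is_0 zero_neq_numeral)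
      moreover have fact: "fact (Suc k + 1) = (of_nat k + 2) * (fact (k + 1) :: complex)" by (simp add: algebra_simps)
      moreover have harm: "harm (Suc (Suc k)) = harm (Suc k) + inverse (of_nat k + 2 :: complex)"
        by (simp add: harm_Suc add_ac)
      ultimately show ?thesis unfolding fact harm by (simp del: fact_Suc add: field_simps)
    qed
    finally show ?case .
  qed (simp add: harm_expand)
  thus ?thesis by (simp add: char_poly_def pderiv_diff pderiv_pCons)
qed

text \<open>Each factor satisfies \<open>norm (z + of_nat j) \<ge> j + 2\<close>, and the first
  inequality is strict since \<open>z = 2\<close> is the only point of modulus at most 2 in this
  half-plane.\<close>

lemma norm_pochhammer_gt:
  assumes "Re z \<ge> 2" "z \<noteq> 2" "k \<ge> 1"
  shows "norm (pochhammer z k) > fact (k + 1)"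
  using \<open>k \<ge> 1\<close>
proof (induction k rule: dec_induct)
  case base
  have "norm z > 2"
  proof (rule ccontr)
    assume "\<not> norm z > 2"
    with assms(1) complex_Re_le_cmod[of z] have "Re z = 2" "norm z = 2" by auto
    hence "Im z = 0" using cmod_power2[of z] by simp
    with \<open>Re z = 2\<close> assms(2) show False by (simp add: complex_eq_iff)
  qed
  thus ?case by simp
next
  case (step k)
  have "real k + 2 \<le> norm (z + of_nat k)"
    using complex_Re_le_cmod[of "z + of_nat k"] assms(1) by simp
  hence "fact (k + 1) * (real k + 2) < norm (pochhammer z k) * norm (z + of_nat k)"
    using step.IH by (intro mult_less_le_imp_less) auto
  moreover have "fact (Suc k + 1) = (fact (k + 1) * (real k + 2) :: real)" by (simp add: algebra_simps)
  ultimately show ?case unfolding pochhammer_Suc norm_mult by (simp only:)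
qed

lemma char_poly_root_Re_less_2:
  assumes "K \<ge> 1" "poly (char_poly K) z = 0" "z \<noteq> 2"
  shows "Re z < 2"
proof (rule ccontr)
  assume "\<not> Re z < 2"
  hence "norm (pochhammer z K) > fact (K + 1)" using assms by (intro norm_pochhammer_gt) auto
  moreover have "pochhammer z K = fact (K + 1)" using assms(2) by (simp add: poly_char_poly)
  ultimately show False by (simp del: fact_Suc)
qed

text \<open>The bound comes from explicit factorisations: division by \<open>z - 2\<close> leaves 1,
  \<open>z + 3\<close>, \<open>z^2 + 5 z + 12\<close> and \<open>(z + 5) (z^2 + 3 z + 12)\<close>
  for K = 1, 2, 3, 4.\<close>

lemma char_poly_root_Re_less_1:
  assumes "K \<in> {1..4}" "poly (char_poly K) z = 0" "z \<noteq> 2"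
  shows "Re z < 1"
proof -
  \<comment> \<open>If \<open>Re z\<close> were at least 1, the vanishing imaginary part
    \<open>Im z * (2 * Re z + b)\<close> would make \<open>z\<close> real, and then the left side
    would be positive.\<close>
  have quad: "Re z < 1" if "z\<^sup>2 + of_nat b * z + 12 = 0" "b > 0" for b
  proof (rule ccontr)
    assume 1: "\<not> Re z < 1"
    have "Im (z\<^sup>2 + of_nat b * z + 12) = Im z * (2 * Re z + real b)"
      by (simp add: power2_eq_square algebra_simps)
    with that 1 have "Im z = 0" by auto
    hence "Re (z\<^sup>2 + of_nat b * z + 12) = (Re z)\<^sup>2 + real b * Re z + 12"
      by (simp add: power2_eq_square)
    moreover have "(Re z)\<^sup>2 + real b * Re z + 12 > 0" using 1 by (intro add_nonneg_pos add_nonneg_nonneg) auto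
    ultimately show False using that by simp
  qed
  have root: "pochhammer z K = fact (K + 1)" using assms(2) by (simp add: poly_char_poly)
  from assms(1) consider "K = 1" | "K = 2" | "K = 3" | "K = 4" by fastforce
  thus ?thesis
  proof cases
    case 1
    with root assms(3) show ?thesis by simp
  next
    case 2
    with root have "z * (z + 1) = 6" by (simp add: eval_nat_numeral pochhammer_Suc)
    moreover have "(z - 2) * (z + 3) = z * (z + 1) - 6" by (simp add: algebra_simps)
    ultimately have "(z - 2) * (z + 3) = 0" by simp
    hence "z = -3" using assms(3) by (auto simp: add_eq_0_iff2)
    thus ?thesis by simp
  next
    case 3
    with root have "z * (z + 1) * (z + 2) = 24" by (simp add: eval_nat_numeral pochhammer_Suc)
    moreover have "(z - 2) * (z\<^sup>2 + 5 * z + 12) = z * (z + 1) * (z + 2) - 24"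
      by (simp add: algebra_simps power2_eq_square)
    ultimately have "(z - 2) * (z\<^sup>2 + 5 * z + 12) = 0" by simp
    thus ?thesis using quad[of 5] assms(3) by simp
  next
    case 4
    with root have "z * (z + 1) * (z + 2) * (z + 3) = 120" by (simp add: eval_nat_numeral pochhammer_Suc)
    moreover have "(z - 2) * ((z + 5) * (z\<^sup>2 + 3 * z + 12)) = z * (z + 1) * (z + 2) * (z + 3) - 120"
      by (simp add: algebra_simps power2_eq_square)
    ultimately have "(z - 2) * ((z + 5) * (z\<^sup>2 + 3 * z + 12)) = 0" by simp
    hence "z = -5 \<or> z\<^sup>2 + 3 * z + 12 = 0" using assms(3) by (auto simp: add_eq_0_iff2)
    thus ?thesis using quad[of 3] by auto
  qed
qed

text \<open>The value of the cofactor at 2 is the derivative of the product there. It is nonzero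
  because \<open>harm (Suc K) > 1\<close>, so the root 2 is simple and every root of
  \<open>Q\<close> is one of the other roots.\<close>

lemma char_poly_factor:
  assumes "K \<ge> 1"
  obtains Q where "char_poly K = [:-2, 1:] * Q" "poly Q 2 = fact (K + 1) * (harm (Suc K) - 1)"
    "poly Q 2 \<noteq> 0" "\<And>z. poly Q z = 0 \<Longrightarrow> Re z < 2" "\<And>z. K \<le> 4 \<Longrightarrow> poly Q z = 0 \<Longrightarrow> Re z < 1"
proof -
  have "poly (char_poly K) 2 = 0" by (simp add: poly_char_poly pochhammer_2)
  then obtain Q where Q: "char_poly K = [:-2, 1:] * Q" by (auto simp: poly_eq_0_iff_dvd dvd_def)
  have "poly (pderiv (char_poly K)) 2 = poly Q 2"
    unfolding Q pderiv_mult by (simp add: pderiv_pCons)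
  hence Q2: "poly Q 2 = fact (K + 1) * (harm (Suc K) - 1)" by (simp add: poly_pderiv_char_poly_2)
  have "(harm (Suc K) :: real) \<noteq> 1"
  proof -
    have "harm 1 \<le> (harm K :: real)" by (rule harm_mono[OF assms])
    moreover have "harm (Suc K) = harm K + inverse (real (Suc K))" "inverse (real (Suc K)) > 0"
      by (simp_all add: harm_Suc)
    ultimately show ?thesis by (simp only: harm_expand One_nat_def)
  qed
  hence "(harm (Suc K) :: complex) \<noteq> 1"
    by (metis of_real_harm of_real_eq_1_iff)
  hence nz: "poly Q 2 \<noteq> 0" unfolding Q2 by (simp del: fact_Suc)
  have root: "poly (char_poly K) z = 0" "z \<noteq> 2" if "poly Q z = 0" for z
    using that nz by (auto simp: Q)
  show ?thesis
    by (rule that[OF Q Q2 nz]) (use root char_poly_root_Re_less_2 char_poly_root_Re_less_1 assms in auto)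
qed

section \<open>Asymptotics of the recurrence\<close>

abbreviation (input) harm_error :: "nat \<Rightarrow> real" where
  "harm_error n \<equiv> (real n + 1) * harm (n + 1) - (real n * ln (real n) + euler_mascheroni * real n)"

text \<open>Both \<open>harm n - ln (n + 1) - euler_mascheroni\<close> and
  \<open>ln (n + 1) - ln n\<close> are O(1/n), hence bounded after multiplication by
  \<open>n\<close>; what remains is \<open>harm n + 1\<close>.\<close>

lemma Suc_times_harm_asymp:
  "(\<lambda>n. harm_error n) \<in> O(\<lambda>n. ln (real n))"
proof -
  have "(\<lambda>n. harm_error n)
    \<in> O(\<lambda>n. ln (real n + 1) + (euler_mascheroni + 3))"
  proof (rule bigoI[of _ 1], rule eventually_mono[OF eventually_ge_at_top[of 1]])
    fix n :: nat assume n: "n \<ge> 1"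
    define d where "d = harm n - ln (real n + 1) - (euler_mascheroni :: real)"
    have "inverse (real (2 * (n + 1))) \<ge> 0" by simp
    with euler_mascheroni_bounds[OF n] have "d \<le> 0" "- inverse (real (2 * n)) \<le> d"
      unfolding d_def atLeastAtMost_iff Suc_eq_plus1 of_nat_add of_nat_1 by linarith+
    hence "d \<le> 0" "- (1 / (2 * real n)) \<le> d" by (simp_all add: inverse_eq_divide)
    hence d: "d \<le> 0" "- (1 / 2) \<le> real n * d"
      using n mult_left_mono[of "- (1 / (2 * real n))" d "real n"] by auto
    hence d': "real n * d \<le> 0" by (simp add: mult_nonneg_nonpos)
    define l where "l = ln (real n + 1) - ln (real n)"
    have "l = ln (1 + 1 / real n)"
      unfolding l_def using n by (subst ln_divide_pos[symmetric]) (auto simp: field_simps)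
    hence "0 \<le> l" "l \<le> 1 / real n" by (auto simp: ln_add_one_self_le_self)
    hence l: "0 \<le> real n * l" "real n * l \<le> 1"
      using n by (auto simp: field_simps)
    have eq: "harm_error n
       = real n * d + real n * l + harm n + 1"
      by (simp add: d_def l_def harm_Suc field_simps)
    have h: "harm n = d + (ln (real n + 1) + euler_mascheroni)" by (simp add: d_def)
    have "harm n \<ge> (0 :: real)" by (simp add: harm_nonneg)
    with d d' l h show "norm (harm_error n)
       \<le> 1 * norm (ln (real n + 1) + (euler_mascheroni + 3))"
      unfolding eq real_norm_def mult_1_left by (subst (1 2) abs_of_nonneg) linarith+
  qed
  also have "(\<lambda>n. ln (real n + 1) + (euler_mascheroni + 3)) \<in> O(\<lambda>n. ln (real n))"
    by real_asymp
  finally show ?thesis .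
qed

text \<open>The series is \<open>(1 - z)^(-2)\<close>, the eigenvector of the resonant root.\<close>

lemma euler_deriv_linear_fps:
  "euler_deriv (Abs_fps (\<lambda>n. of_nat (n + 1))) = fps_const 2 * Abs_fps (\<lambda>n. of_nat (n + 1))"
  by (rule fps_ext) (simp add: euler_deriv_nth algebra_simps)

text \<open>The series is \<open>(1 - ln (1 - z)) (1 - z)^(-2)\<close>, a generalised eigenvector
  for the eigenvalue 2; its coefficients carry the \<open>n ln n\<close> term.\<close>

lemma euler_deriv_harm_fps:
  "euler_deriv (Abs_fps (\<lambda>n. of_nat (n + 1) * harm (n + 1))) =
     fps_const 2 * Abs_fps (\<lambda>n. of_nat (n + 1) * harm (n + 1)) + Abs_fps (\<lambda>n. of_nat (n + 1))"
proof (rule fps_ext)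
  fix n
  have "(of_nat n + 2 :: complex) \<noteq> 0"
    by (metis of_nat_add of_nat_numeral of_nat_eq_0_iff add_is_0 zero_neq_numeral)
  hence "(of_nat n + 2) * harm (Suc (Suc n)) = (of_nat n + 2) * harm (Suc n) + (1 :: complex)"
    by (simp add: harm_Suc[of "Suc n"] field_simps)
  hence *: "(of_nat n + 1) * ((of_nat n + 2) * harm (Suc (Suc n))) =
     (of_nat n + 1) * ((of_nat n + 2) * harm (Suc n) + (1 :: complex))" by simp
  have "fps_nth (euler_deriv (Abs_fps (\<lambda>n. of_nat (n + 1) * harm (n + 1)))) n =
     (of_nat n + 1) * ((of_nat n + 2) * harm (Suc (Suc n))) - of_nat n * ((of_nat n + 1) * harm (Suc n))"
    by (simp add: euler_deriv_nth add_ac)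
  also have "\<dots> = fps_nth (fps_const 2 * Abs_fps (\<lambda>n. of_nat (n + 1) * harm (n + 1)) + Abs_fps (\<lambda>n. of_nat (n + 1))) n"
    unfolding * by (simp add: algebra_simps)
  finally show "fps_nth (euler_deriv (Abs_fps (\<lambda>n. of_nat (n + 1) * harm (n + 1)))) n =
     fps_nth (fps_const 2 * Abs_fps (\<lambda>n. of_nat (n + 1) * harm (n + 1)) + Abs_fps (\<lambda>n. of_nat (n + 1))) n" .
qed

text \<open>The factor \<open>n choose K\<close> is a \<open>K\<close>-th derivative, and
  convolution with the binomial coefficients is multiplication by \<open>(1 - z)^(-K)\<close>. With
  \<open>x - p\<close> as unknown this gives \<open>(1 - z)^K D^K (x - p) = (K + 1)! x\<close>;
  subtracting \<open>(K + 1)! (x - p)\<close> leaves only \<open>p\<close> on the right.\<close>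

lemma euler_op_char_poly_recurrence:
  fixes x p :: "nat \<Rightarrow> complex"
  assumes "K \<ge> 1"
    and rec: "\<And>n. of_nat (n choose K) * x n =
      of_nat (K + 1) * (\<Sum>j<n. of_nat ((n - 1 - j) choose (K - 1)) * x j) + of_nat (n choose K) * p n"
  shows "euler_op (char_poly K) (Abs_fps (\<lambda>n. x n - p n)) = fps_const (fact (K + 1)) * Abs_fps p"
proof -
  define Y where "Y = Abs_fps (\<lambda>n. x n - p n)"
  define B :: "complex fps" where "B = inverse ((1 - fps_X) ^ K)"
  have B: "B = Abs_fps (\<lambda>m. of_nat ((K + m - 1) choose m))"
    unfolding B_def using one_minus_const_fps_X_neg_power'[of K "1::complex"] assms(1) by simp
  have "(fps_deriv ^^ K) Y = fps_const (fact (K + 1)) * (Abs_fps x * B)"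
  proof (rule fps_ext)
    fix m
    have "fps_nth ((fps_deriv ^^ K) Y) m = fact K * (of_nat ((m + K) choose K) * (x (m + K) - p (m + K)))"
      by (simp add: higher_fps_deriv_nth Y_def mult_ac)
    also have "of_nat ((m + K) choose K) * (x (m + K) - p (m + K)) =
        of_nat (K + 1) * (\<Sum>j<m + K. of_nat ((m + K - 1 - j) choose (K - 1)) * x j)"
      unfolding right_diff_distrib rec by simp
    \<comment> \<open>For \<open>j > m\<close> the upper index drops below \<open>K - 1\<close> and
      the binomial coefficient vanishes.\<close>
    also have "(\<Sum>j<m + K. of_nat ((m + K - 1 - j) choose (K - 1)) * x j) =
        (\<Sum>j=0..m. x j * of_nat ((K + (m - j) - 1) choose (m - j)))"
    proof (rule sum.mono_neutral_cong_right)
      show "{0..m} \<subseteq> {..<m + K}" using assms(1) by auto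
      show "\<forall>i\<in>{..<m + K} - {0..m}. of_nat (m + K - 1 - i choose (K - 1)) * x i = 0"
        by (auto intro!: binomial_eq_0)
    next
      fix j assume "j \<in> {0..m}"
      hence "m + K - 1 - j = K + (m - j) - 1" "(K + (m - j) - 1) - (m - j) = K - 1" "m - j \<le> K + (m - j) - 1"
        using assms(1) by auto
      thus "of_nat (m + K - 1 - j choose (K - 1)) * x j = x j * of_nat (K + (m - j) - 1 choose (m - j))"
        using binomial_symmetric[of "m - j" "K + (m - j) - 1"] by simp
    qed auto
    also have "\<dots> = fps_nth (Abs_fps x * B) m" by (simp add: B fps_mult_nth)
    finally show "fps_nth ((fps_deriv ^^ K) Y) m = fps_nth (fps_const (fact (K + 1)) * (Abs_fps x * B)) m"
      unfolding fps_mult_left_const_nth by (simp add: algebra_simps)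
  qed
  moreover have "(1 - fps_X) ^ K * B = 1"
    unfolding B_def by (rule inverse_mult_eq_1') (simp add: fps_nth_power_0)
  ultimately have "euler_op (pochhammer [:0, 1:] K) Y = fps_const (fact (K + 1)) * Abs_fps x"
    unfolding euler_op_pochhammer by (simp only: mult.left_commute mult_1_right) (simp only: mult.commute)
  hence "euler_op (char_poly K) Y = fps_const (fact (K + 1)) * Abs_fps x - fps_const (fact (K + 1)) * Y"
    unfolding char_poly_def euler_op_diff by simp
  also have "\<dots> = fps_const (fact (K + 1)) * Abs_fps p"
    by (rule fps_ext) (simp add: Y_def algebra_simps)
  finally show ?thesis by (simp add: Y_def)
qed

lemma ln_smallo_real: "(\<lambda>n. ln (real n)) \<in> o(\<lambda>n. real n)"
  by real_asymp

lemma bigo_ln_imp_smallo: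
  fixes f :: "nat \<Rightarrow> complex"
  assumes "f \<in> bigo_ln"
  shows "f \<in> o(\<lambda>n. of_nat n)"
proof -
  have "(\<lambda>n. of_real (ln (real n)) :: complex) \<in> o(\<lambda>n. of_real (real n))"
    using ln_smallo_real by (simp only: landau_o.small.of_real_iff)
  with assms show ?thesis by (simp add: landau_o.big_small_trans)
qed

lemma const_bigo_ln: "(\<lambda>_. c :: complex) \<in> bigo_ln"
proof -
  have "(\<lambda>_. 1 :: real) \<in> O(\<lambda>n. ln (real n))" by real_asymp
  hence "(\<lambda>_. of_real 1 :: complex) \<in> bigo_ln"
    by (simp only: landau_o.big.of_real_iff)
  thus ?thesis using landau_o.big.cmult_in_iff[of c "\<lambda>_. 1"] by (cases "c = 0") auto
qed

text \<open>The solution is decomposed as \<open>x = q + \<alpha> S + b' L + Y2\<close>, where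
  \<open>L\<close> and \<open>S\<close> are the eigenvector and generalised eigenvector for 2, and
  \<open>Y2\<close> is governed by the remaining roots alone.\<close>

lemma quicksort_recurrence_asymptotics:
  fixes x p :: "nat \<Rightarrow> real"
  assumes "K \<ge> 1"
    and rec: "\<And>n. n > K \<Longrightarrow> real (n choose K) * x n =
      real (K + 1) * (\<Sum>j<n. real ((n - 1 - j) choose (K - 1)) * x j) + real (n choose K) * p n"
    and toll: "(\<lambda>n. p n - g * real n) \<in> O(\<lambda>n. ln (real n))"
  defines "\<alpha> \<equiv> g / (harm (Suc K) - 1)"
  obtains \<beta> where
    "(\<lambda>n. x n - (\<alpha> * real n * ln (real n) + \<beta> * real n)) \<in> o(\<lambda>n. real n)"
    "K \<le> 4 \<Longrightarrow> (\<lambda>n. x n - (\<alpha> * real n * ln (real n) + \<beta> * real n)) \<in> O(\<lambda>n. ln (real n))"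
proof -
  \<comment> \<open>Redefining the toll up to \<open>K\<close> makes the recurrence valid for all \<open>n\<close>; below \<open>K\<close> both sides vanish.\<close>
  define q where "q n = (if n > K then p n else if n = K then x K - real (K + 1) * x 0 else 0)" for n
  have rec': "real (n choose K) * x n =
      real (K + 1) * (\<Sum>j<n. real ((n - 1 - j) choose (K - 1)) * x j) + real (n choose K) * q n" for n
  proof (cases n K rule: linorder_cases)
    case less
    hence "(\<Sum>j<n. real ((n - 1 - j) choose (K - 1)) * x j) = 0"
      by (intro sum.neutral) (auto intro!: binomial_eq_0)
    thus ?thesis using less by (simp add: binomial_eq_0)
  next
    case equal
    have "(\<Sum>j<n. real ((n - 1 - j) choose (K - 1)) * x j) = (\<Sum>j\<in>{0}. real ((n - 1 - j) choose (K - 1)) * x j)"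
      using equal \<open>K \<ge> 1\<close> by (intro sum.mono_neutral_right) (auto intro!: binomial_eq_0)
    thus ?thesis using equal by (simp add: q_def)
  qed (use rec in \<open>auto simp: q_def\<close>)
  obtain Q where Q: "char_poly K = [:-2, 1:] * Q" "poly Q 2 = fact (K + 1) * (harm (Suc K) - 1)"
    "poly Q 2 \<noteq> 0" "\<And>z. poly Q z = 0 \<Longrightarrow> Re z < 2" "\<And>z. K \<le> 4 \<Longrightarrow> poly Q z = 0 \<Longrightarrow> Re z < 1"
    using char_poly_factor[OF \<open>K \<ge> 1\<close>] by blast
  have "Q \<noteq> 0" using Q(3) by auto
  define L :: "complex fps" where "L = Abs_fps (\<lambda>n. of_nat (n + 1))"
  define S :: "complex fps" where "S = Abs_fps (\<lambda>n. of_nat (n + 1) * harm (n + 1))"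
  have L: "euler_op P L = fps_const (poly P 2) * L" for P
    unfolding L_def by (rule euler_op_eigenvector[OF euler_deriv_linear_fps])
  have S: "euler_op (char_poly K) S = fps_const (poly Q 2) * L"
  proof -
    have "euler_op (char_poly K) S = euler_op Q (euler_deriv S) - euler_op Q (fps_const 2 * S)"
      unfolding Q(1) euler_op_linear_mult euler_op_deriv_commute euler_op_cmult_right
      by (simp flip: fps_const_neg)
    also have "\<dots> = euler_op Q (euler_deriv S - fps_const 2 * S)" by (simp only: euler_op_diff_right)
    also have "euler_deriv S - fps_const 2 * S = L" unfolding S_def euler_deriv_harm_fps L_def by simp
    finally show ?thesis by (simp add: L)
  qed
  define Y where "Y = Abs_fps (\<lambda>n. complex_of_real (x n) - complex_of_real (q n))"
  \<comment> \<open>As \<open>\<alpha>\<close> times \<open>poly Q 2\<close> equals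
    \<open>(K + 1)! g\<close>, this subtraction cancels the linear part of the right-hand side and
    leaves the logarithmic \<open>h\<close>.\<close>
  define Y1 where "Y1 = Y - fps_const (of_real \<alpha>) * S"
  define h where "h n = fact (K + 1) * (of_real (q n) - of_real g * of_nat (n + 1) :: complex)" for n
  have "euler_op (char_poly K) Y = fps_const (fact (K + 1)) * Abs_fps (\<lambda>n. of_real (q n))"
    unfolding Y_def
  proof (rule euler_op_char_poly_recurrence[OF \<open>K \<ge> 1\<close>])
    fix n
    from rec'[of n] have "complex_of_real (real (n choose K) * x n) = of_real (
      real (K + 1) * (\<Sum>j<n. real ((n - 1 - j) choose (K - 1)) * x j) + real (n choose K) * q n)"
      by (rule arg_cong)
    thus "of_nat (n choose K) * complex_of_real (x n) =
      of_nat (K + 1) * (\<Sum>j<n. of_nat (n - 1 - j choose (K - 1)) * complex_of_real (x j)) +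
      of_nat (n choose K) * complex_of_real (q n)"
      by (simp only: of_real_add of_real_mult of_real_of_nat_eq of_real_sum)
  qed
  hence Y1: "euler_op (char_poly K) Y1 = Abs_fps h"
  proof -
    assume *: "euler_op (char_poly K) Y = fps_const (fact (K + 1)) * Abs_fps (\<lambda>n. of_real (q n))"
    have "of_real \<alpha> * poly Q 2 = fact (K + 1) * complex_of_real g"
    proof -
      have "of_real (harm (Suc K) - 1) \<noteq> (0 :: complex)" using Q(2,3) by (auto simp: of_real_harm simp del: fact_Suc)
      hence "complex_of_real \<alpha> * of_real (harm (Suc K) - 1) = of_real g"
        unfolding \<alpha>_def of_real_divide by (rule nonzero_divide_eq_eq[THEN iffD1, OF _ refl, symmetric])
      thus ?thesis unfolding Q(2) by (simp add: of_real_harm mult_ac del: fact_Suc)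
    qed
    thus ?thesis
      unfolding Y1_def euler_op_diff_right euler_op_cmult_right S *
      by (intro fps_ext) (simp add: L_def h_def right_diff_distrib mult.assoc [symmetric] del: fact_Suc of_nat_Suc)
  qed
  have q: "(\<lambda>n. of_real (q n) - of_real g * of_nat n :: complex) \<in> bigo_ln"
  proof -
    have "(\<lambda>n. q n - g * real n) \<in> O(\<lambda>n. ln (real n))"
      using toll by (subst landau_o.big.in_cong[of _ "\<lambda>n. p n - g * real n"])
        (auto simp: q_def intro: eventually_mono[OF eventually_gt_at_top[of K]])
    hence "(\<lambda>n. of_real (q n - g * real n) :: complex) \<in> bigo_ln"
      by (simp only: landau_o.big.of_real_iff)
    thus ?thesis by simp
  qed
  have h: "h \<in> bigo_ln"
  proof -
    have "(\<lambda>n. of_real (q n) - of_real g * of_nat n - of_real g :: complex) \<in> bigo_ln"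
      by (intro sum_in_bigo q const_bigo_ln)
    hence "(\<lambda>n. fact (K + 1) * (of_real (q n) - of_real g * of_nat n - of_real g) :: complex) \<in> bigo_ln"
      by (subst landau_o.big.cmult_in_iff) (auto simp del: fact_Suc)
    thus ?thesis by (simp add: h_def [abs_def] algebra_simps del: fact_Suc)
  qed
  define G where "G = euler_op Q Y1"
  have "of_nat (n + 1) * fps_nth G (n + 1) = (of_nat n + 2) * fps_nth G n + h n" for n
  proof -
    have "euler_deriv G - fps_const 2 * G = Abs_fps h"
      using Y1 unfolding Q(1) euler_op_linear_mult G_def by (simp flip: fps_const_neg)
    from arg_cong[OF this, of "\<lambda>F. fps_nth F n"] show ?thesis
      by (simp add: euler_deriv_nth algebra_simps)
  qed
  from first_order_resonant[OF this h] obtain b where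
    b: "(\<lambda>n. fps_nth G n - b * of_nat (n + 1)) \<in> bigo_ln" by blast
  \<comment> \<open>The operator polynomial \<open>Q\<close> multiplies \<open>L\<close> by
    \<open>poly Q 2\<close>; this multiple of \<open>L\<close> therefore removes
    \<open>b * L\<close> from \<open>G\<close>.\<close>
  define b' where "b' = b / poly Q 2"
  define Y2 where "Y2 = Y1 - fps_const b' * L"
  have "euler_op Q Y2 = G - fps_const b * L"
    unfolding Y2_def euler_op_diff_right euler_op_cmult_right L G_def[symmetric]
    using Q(3) by (simp add: b'_def mult.assoc [symmetric])
  hence "fps_nth (euler_op Q Y2) = (\<lambda>n. fps_nth G n - b * of_nat (n + 1))"
    by (intro ext) (simp add: L_def)
  hence opY2: "fps_nth (euler_op Q Y2) \<in> bigo_ln"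
    using b by (simp only:)
  have Y2_small: "fps_nth Y2 \<in> o(\<lambda>n. of_nat n)"
  proof (rule euler_op_solution_closed[OF \<open>Q \<noteq> 0\<close> Q(4), where S = "\<lambda>F. fps_nth F \<in> o(\<lambda>n. of_nat n)"])
    fix \<rho> and G :: "complex fps" assume *: "Re \<rho> < 2" "fps_nth (euler_deriv G - fps_const \<rho> * G) \<in> o(\<lambda>n. of_nat n)"
    show "fps_nth G \<in> o(\<lambda>n. of_nat n)"
      by (rule first_order_smallo[OF _ *]) (simp add: euler_deriv_nth algebra_simps)
  next
    fix a and G :: "complex fps" assume *: "fps_nth G \<in> o(\<lambda>n. of_nat n)"
    have "(\<lambda>n. a * fps_nth G n) \<in> o(\<lambda>n. of_nat n)"
      using * by (cases "a = 0") auto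
    moreover have "fps_nth (fps_const a * G) = (\<lambda>n. a * fps_nth G n)" by (rule ext) simp
    ultimately show "fps_nth (fps_const a * G) \<in> o(\<lambda>n. of_nat n)" by (simp only:)
  qed (use opY2 bigo_ln_imp_smallo in auto)
  have Y2_ln: "fps_nth Y2 \<in> bigo_ln" if "K \<le> 4"
  proof (rule euler_op_solution_closed[OF \<open>Q \<noteq> 0\<close> Q(5)[OF that], where S = "\<lambda>F. fps_nth F \<in> bigo_ln"])
    fix \<rho> and G :: "complex fps" assume *: "Re \<rho> < 1" "fps_nth (euler_deriv G - fps_const \<rho> * G) \<in> bigo_ln"
    show "fps_nth G \<in> bigo_ln"
      by (rule first_order_bigo_ln[OF _ *]) (simp add: euler_deriv_nth algebra_simps)
  next
    fix a and G :: "complex fps" assume *: "fps_nth G \<in> bigo_ln"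
    have "(\<lambda>n. a * fps_nth G n) \<in> bigo_ln"
      using * by (cases "a = 0") auto
    moreover have "fps_nth (fps_const a * G) = (\<lambda>n. a * fps_nth G n)" by (rule ext) simp
    ultimately show "fps_nth (fps_const a * G) \<in> bigo_ln" by (simp only:)
  qed (use opY2 in auto)
  \<comment> \<open>Linear terms have three sources: the resonance constant, the toll
    \<open>q\<close> hidden in \<open>x = Y + q\<close>, and Euler's constant from the harmonic
    numbers in \<open>S\<close>.\<close>
  define \<beta>' where "\<beta>' = b' + of_real (g + \<alpha> * euler_mascheroni)"
  define E where "E n = of_real (x n) - (of_real (\<alpha> * real n * ln (real n)) + \<beta>' * of_nat n)" for n
  define D where "D n = (of_real (q n) - of_real g * of_nat n) +
      (of_real (\<alpha> * harm_error n) + b')" for n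
  have E_eq: "E = (\<lambda>n. fps_nth Y2 n + D n)"
    by (rule ext) (simp add: E_def D_def Y2_def Y1_def Y_def S_def L_def \<beta>'_def of_real_harm algebra_simps)
  have D: "D \<in> bigo_ln"
  proof -
    have "(\<lambda>n. \<alpha> * harm_error n) \<in> O(\<lambda>n. ln (real n))"
      using Suc_times_harm_asymp by (cases "\<alpha> = 0") auto
    hence "(\<lambda>n. of_real (\<alpha> * harm_error n) :: complex)
      \<in> bigo_ln" by (simp only: landau_o.big.of_real_iff)
    thus ?thesis unfolding D_def [abs_def] by (intro sum_in_bigo q const_bigo_ln)
  qed
  \<comment> \<open>The resonance constant is obtained as a complex number; since \<open>x\<close>
    and \<open>\<alpha>\<close> are real, taking real parts of the error replaces
    \<open>\<beta>'\<close> by \<open>Re \<beta>'\<close>.\<close>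
  have Re_E: "x n - (\<alpha> * real n * ln (real n) + Re \<beta>' * real n) = Re (E n)" for n
    by (simp add: E_def)
  have le: "(\<lambda>n. Re (E n)) \<in> O(\<lambda>n. norm (E n))"
    by (intro bigoI[of _ 1] always_eventually) (auto simp: abs_Re_le_cmod)
  show ?thesis
  proof (rule that[of "Re \<beta>'"]; unfold Re_E)
    have "E \<in> o(\<lambda>n. of_nat n)"
      unfolding E_eq by (intro sum_in_smallo Y2_small bigo_ln_imp_smallo D)
    hence "(\<lambda>n. norm (E n)) \<in> o(\<lambda>n. norm (of_nat n :: complex))" by (simp only: landau_o.small.norm_iff)
    with le show "(\<lambda>n. Re (E n)) \<in> o(\<lambda>n. real n)" by (simp add: landau_o.big_small_trans)
  next
    assume "K \<le> 4"
    hence "E \<in> bigo_ln"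
      unfolding E_eq by (intro sum_in_bigo Y2_ln D)
    hence "(\<lambda>n. norm (E n)) \<in> O(\<lambda>n. norm (of_real (ln (real n)) :: complex))" by (simp only: landau_o.big.norm_iff)
    hence "(\<lambda>n. norm (E n)) \<in> O(\<lambda>n. ln (real n))" by simp
    with le show "(\<lambda>n. Re (E n)) \<in> O(\<lambda>n. ln (real n))" by (rule landau_o.big_trans)
  qed
qed

section \<open>Classification trees\<close>

lemma length_leaf_depths: "length (leaf_depths t) = Suc (size t)"
  by (induction t) auto

lemma leaf_depths_le_size: "d \<in> set (leaf_depths t) \<Longrightarrow> d \<le> size t"
proof (induction t arbitrary: d)
  case (Node l a r)
  then obtain d' where "d = Suc d'" "d' \<in> set (leaf_depths l) \<or> d' \<in> set (leaf_depths r)" by auto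
  thus ?case using Node.IH(1)[of d'] Node.IH(2)[of d'] by auto
qed simp

text \<open>A nonempty tree is fixed by the position of its root in the list and by two subtrees
  over the shorter pieces on either side.\<close>

lemma finite_trees_inorder: "finite {t :: 'a tree. inorder t = xs}"
proof (induction xs rule: length_induct)
  case (1 xs)
  have "{t. inorder t = xs} \<subseteq> insert Leaf (\<Union>i\<in>{..<length xs}.
      (\<lambda>(l, r). Node l (xs ! i) r) ` ({l. inorder l = take i xs} \<times> {r. inorder r = drop (Suc i) xs}))"
  proof
    fix t assume "t \<in> {t. inorder t = xs}"
    thus "t \<in> insert Leaf (\<Union>i\<in>{..<length xs}.
      (\<lambda>(l, r). Node l (xs ! i) r) ` ({l. inorder l = take i xs} \<times> {r. inorder r = drop (Suc i) xs}))"
    proof (cases t)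
      case (Node l a r)
      with \<open>t \<in> _\<close> have xs: "xs = inorder l @ a # inorder r" by simp
      have len: "length (inorder l) \<in> {..<length xs}"
        and lr: "(l, r) \<in> {l'. inorder l' = take (length (inorder l)) xs} \<times> {r'. inorder r' = drop (Suc (length (inorder l))) xs}"
        and t: "t = (\<lambda>(l', r'). Node l' (xs ! length (inorder l)) r') (l, r)"
        using xs Node nth_append_length[of "inorder l" a "inorder r"] by auto
      show ?thesis by (rule insertI2, rule UN_I[OF len], rule image_eqI, rule t, rule lr)
    qed simp
  qed
  moreover have "finite {l :: 'a tree. inorder l = take i xs}" "finite {r :: 'a tree. inorder r = drop (Suc i) xs}"
    if "i < length xs" for i
    using 1 that by auto
  ultimately show ?case by (elim finite_subset) auto
qed

lemma finite_classification_trees: "finite (classification_trees K)"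
  unfolding classification_trees_def by (rule finite_trees_inorder)

lemma ex_tree_inorder: "\<exists>t. inorder t = xs"
proof (induction xs)
  case Nil
  show ?case by (rule exI[of _ Leaf]) simp
next
  case (Cons x xs)
  then obtain t where "inorder t = xs" by blast
  thus ?case by (intro exI[of _ "Node Leaf x t"]) simp
qed

lemma classification_trees_nonempty: "classification_trees K \<noteq> {}"
  using ex_tree_inorder unfolding classification_trees_def by auto

lemma leaf_depth_le:
  assumes "t \<in> classification_trees K" "i \<le> K"
  shows "leaf_depth t i \<le> K"
proof -
  have "size t = K"
    using assms(1) length_inorder[of t] by (simp add: classification_trees_def del: upt_Suc)
  thus ?thesis
    using leaf_depths_le_size[of "leaf_depths t ! i" t] assms(2)
    by (simp add: leaf_depth_def length_leaf_depths)
qed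

lemma opt_cost_le: "t \<in> classification_trees K \<Longrightarrow> opt_cost K x \<le> tree_cost K t x"
  unfolding opt_cost_def using finite_classification_trees by (intro Min_le) auto

lemma opt_cost_attained:
  obtains t where "t \<in> classification_trees K" "opt_cost K x = tree_cost K t x"
proof -
  have "opt_cost K x \<in> (\<lambda>t. tree_cost K t x) ` classification_trees K"
    unfolding opt_cost_def using finite_classification_trees classification_trees_nonempty
    by (intro Min_in) auto
  thus ?thesis using that by blast
qed

lemma tree_cost_diff_le:
  assumes "t \<in> classification_trees K" "\<And>i. i \<le> K \<Longrightarrow> \<bar>x i - y i\<bar> \<le> \<epsilon>"
  shows "tree_cost K t x - tree_cost K t y \<le> real (K + 1) * real K * \<epsilon>"
proof -
  have "tree_cost K t x - tree_cost K t y = (\<Sum>i\<le>K. (x i - y i) * real (leaf_depth t i))"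
    by (simp add: tree_cost_def sum_subtractf left_diff_distrib)
  also have "\<dots> \<le> (\<Sum>i\<le>K. \<epsilon> * real K)"
  proof (rule sum_mono)
    fix i assume i: "i \<in> {..K}"
    have "(x i - y i) * real (leaf_depth t i) \<le> \<bar>x i - y i\<bar> * real (leaf_depth t i)"
      by (intro mult_right_mono) auto
    also have "\<dots> \<le> \<epsilon> * real K"
      using i assms leaf_depth_le[OF assms(1)] order_trans[OF abs_ge_zero assms(2)[of i]]
      by (intro mult_mono) auto
    finally show "(x i - y i) * real (leaf_depth t i) \<le> \<epsilon> * real K" .
  qed
  also have "\<dots> = real (K + 1) * real K * \<epsilon>" by simp
  finally show ?thesis .
qed

text \<open>A minimum of functions with a common Lipschitz constant inherits it: the tree optimal
  for one argument is tried on the other.\<close>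

lemma opt_cost_diff_le:
  assumes "\<And>i. i \<le> K \<Longrightarrow> \<bar>x i - y i\<bar> \<le> \<epsilon>"
  shows "\<bar>opt_cost K x - opt_cost K y\<bar> \<le> real (K + 1) * real K * \<epsilon>"
proof -
  have *: "opt_cost K x - opt_cost K y \<le> real (K + 1) * real K * \<epsilon>"
    if "\<And>i. i \<le> K \<Longrightarrow> \<bar>x i - y i\<bar> \<le> \<epsilon>" for x y
  proof -
    obtain t where t: "t \<in> classification_trees K" "opt_cost K y = tree_cost K t y"
      by (rule opt_cost_attained)
    show ?thesis
      using opt_cost_le[OF t(1), of x] tree_cost_diff_le[OF t(1), of x y \<epsilon>, OF that] t(2) by linarith
  qed
  from *[of x y] *[of y x] assms show ?thesis by (simp add: abs_minus_commute abs_le_iff)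
qed

lemma tree_cost_cmult: "tree_cost K t (\<lambda>i. c * x i) = c * tree_cost K t x"
  by (simp add: tree_cost_def sum_distrib_left mult.assoc)

lemma opt_cost_cmult:
  assumes "c \<ge> 0"
  shows "opt_cost K (\<lambda>i. c * x i) = c * opt_cost K x"
proof (rule antisym)
  obtain t where t: "t \<in> classification_trees K" "opt_cost K x = tree_cost K t x"
    by (rule opt_cost_attained)
  show "opt_cost K (\<lambda>i. c * x i) \<le> c * opt_cost K x"
    using opt_cost_le[OF t(1), of "\<lambda>i. c * x i"] t(2) by (simp add: tree_cost_cmult)
next
  obtain t where t: "t \<in> classification_trees K" "opt_cost K (\<lambda>i. c * x i) = tree_cost K t (\<lambda>i. c * x i)"
    by (rule opt_cost_attained)
  show "c * opt_cost K x \<le> opt_cost K (\<lambda>i. c * x i)"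
    using opt_cost_le[OF t(1), of x] t(2) assms by (simp add: tree_cost_cmult mult_left_mono)
qed

lemma opt_cost_cong: "(\<And>i. i \<le> K \<Longrightarrow> x i = y i) \<Longrightarrow> opt_cost K x = opt_cost K y"
  by (simp add: opt_cost_def tree_cost_def)

lemma chosen_tree_cong:
  assumes "\<And>i. i \<le> K \<Longrightarrow> x i = y i"
  shows "chosen_tree K r x = chosen_tree K r y"
proof -
  have "(\<lambda>t. tree_cost K t x) = (\<lambda>t. tree_cost K t y)" using assms by (simp add: tree_cost_def)
  thus ?thesis by (simp add: chosen_tree_def minimizing_tree_def)
qed

lemma linear_order_on_finite_least:
  assumes "linear_order_on A r" "finite B" "B \<subseteq> A" "B \<noteq> {}"
  shows "\<exists>!b. b \<in> B \<and> (\<forall>b'\<in>B. (b, b') \<in> r)"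
proof -
  from assms(1) have tr: "trans r" and tot: "total_on A r" and rf: "refl_on A r" and as: "antisym r"
    unfolding linear_order_on_def partial_order_on_def preorder_on_def by auto
  have rel: "(a, b) \<in> r \<or> (b, a) \<in> r" if "a \<in> A" "b \<in> A" for a b
    using that tot rf unfolding total_on_def refl_on_def by (cases "a = b") auto
  from assms(2,4,3) have "\<exists>b\<in>B. \<forall>b'\<in>B. (b, b') \<in> r"
  proof (induction rule: finite_ne_induct)
    case (singleton x)
    thus ?case using rel[of x x] by auto
  next
    case (insert x F)
    then obtain b where b: "b \<in> F" "\<forall>b'\<in>F. (b, b') \<in> r" by auto
    show ?case
    proof (cases "(b, x) \<in> r")
      case False
      hence "(x, b) \<in> r" using rel[of b x] b insert.prems by auto
      hence "\<forall>b'\<in>F. (x, b') \<in> r" using b tr by (meson transD)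
      moreover have "(x, x) \<in> r" using rel[of x x] insert.prems by simp
      ultimately show ?thesis by simp
    qed (use b in auto)
  qed
  thus ?thesis using as by (meson antisymD)
qed

text \<open>The linear order on the finite set of trees supplies a unique least minimiser, so the
  \<open>THE\<close> in \<open>chosen_tree\<close> is well defined.\<close>

lemma chosen_tree_optimal:
  assumes "linear_order_on (classification_trees K) r"
  shows "chosen_tree K r x \<in> classification_trees K" "tree_cost K (chosen_tree K r x) x = opt_cost K x"
proof -
  have min: "minimizing_tree K x t \<longleftrightarrow> t \<in> classification_trees K \<and> tree_cost K t x = opt_cost K x" for t
  proof
    assume "minimizing_tree K x t"
    moreover obtain t' where "t' \<in> classification_trees K" "opt_cost K x = tree_cost K t' x"
      by (rule opt_cost_attained)
    ultimately show "t \<in> classification_trees K \<and> tree_cost K t x = opt_cost K x"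
      using opt_cost_le[of t K x] unfolding minimizing_tree_def is_arg_min_def by force
  next
    assume "t \<in> classification_trees K \<and> tree_cost K t x = opt_cost K x"
    thus "minimizing_tree K x t"
      using opt_cost_le[of _ K x] unfolding minimizing_tree_def is_arg_min_def by (auto simp: not_less)
  qed
  have "\<exists>!t. t \<in> Collect (minimizing_tree K x) \<and> (\<forall>t'\<in>Collect (minimizing_tree K x). (t, t') \<in> r)"
  proof (rule linear_order_on_finite_least[OF assms])
    show "finite (Collect (minimizing_tree K x))"
      by (rule finite_subset[OF _ finite_classification_trees[of K]]) (auto simp: min)
    show "Collect (minimizing_tree K x) \<subseteq> classification_trees K" by (auto simp: min)
    obtain t where "t \<in> classification_trees K" "opt_cost K x = tree_cost K t x"
      by (rule opt_cost_attained)
    hence "minimizing_tree K x t" by (simp add: min)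
    thus "Collect (minimizing_tree K x) \<noteq> {}" by blast
  qed
  hence "\<exists>!t. minimizing_tree K x t \<and> (\<forall>t'. minimizing_tree K x t' \<longrightarrow> (t, t') \<in> r)" by auto
  from theI'[OF this] have "minimizing_tree K x (chosen_tree K r x)"
    unfolding chosen_tree_def by blast
  thus "chosen_tree K r x \<in> classification_trees K" "tree_cost K (chosen_tree K r x) x = opt_cost K x"
    by (auto simp: min)
qed

lemma opt_cost_nonneg_le:
  assumes "\<And>i. i \<le> K \<Longrightarrow> 0 \<le> x i" "(\<Sum>i\<le>K. x i) = s"
  shows "0 \<le> opt_cost K x" "opt_cost K x \<le> real K * s"
proof -
  obtain t where t: "t \<in> classification_trees K" "opt_cost K x = tree_cost K t x"
    by (rule opt_cost_attained)
  show "0 \<le> opt_cost K x"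
    unfolding t tree_cost_def using assms by (intro sum_nonneg) auto
  have "opt_cost K x \<le> (\<Sum>i\<le>K. x i * real K)"
    unfolding t tree_cost_def using assms leaf_depth_le[OF t(1)]
    by (intro sum_mono mult_left_mono) auto
  also have "\<dots> = real K * s" by (simp add: assms(2)[symmetric] sum_distrib_left mult.commute)
  finally show "opt_cost K x \<le> real K * s" .
qed

section \<open>Sizes of sublists and compositions\<close>

text \<open>A version of \<open>sorted_pivot\<close> for a set of pivots instead of a tuple, so that
  the choice of the pivots within a sample can be varied.\<close>

definition cut_point :: "real set \<Rightarrow> nat \<Rightarrow> real" where
  "cut_point Q i = (0 # sorted_list_of_set Q @ [1]) ! i"

text \<open>The sublist sizes that result when the points \<open>Q\<close> of the sample
  \<open>T\<close> act as pivots.\<close>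

definition gap :: "real set \<Rightarrow> real set \<Rightarrow> nat \<Rightarrow> nat" where
  "gap T Q i = card {x \<in> T - Q. cut_point Q i < x \<and> x < cut_point Q (Suc i)}"

definition compositions :: "nat \<Rightarrow> nat \<Rightarrow> nat list set" where
  "compositions K m = {l. length l = Suc K \<and> sum_list l = m}"

definition subsets_of_card :: "'a set \<Rightarrow> nat \<Rightarrow> 'a set set" where
  "subsets_of_card T K = {Q. Q \<subseteq> T \<and> card Q = K}"

lemma card_compositions: "card (compositions K m) = (m + K) choose K"
proof -
  have "card (compositions K m) = (m + K) choose m"
    unfolding compositions_def using card_length_sum_list[of "Suc K" m] by simp
  thus ?thesis using binomial_symmetric[of m "m + K"] by simp
qed

lemma finite_compositions: "finite (compositions K m)"
  using card_compositions[of K m] by (intro card_ge_0_finite) simp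

lemma card_subsets_of_card: "finite T \<Longrightarrow> card (subsets_of_card T K) = card T choose K"
  unfolding subsets_of_card_def by (rule n_subsets)

lemma finite_subsets_of_card: "finite T \<Longrightarrow> finite (subsets_of_card T K)"
  unfolding subsets_of_card_def by (rule finite_subset[of _ "Pow T"]) auto

lemma sorted_pivot_eq_cut:
  assumes "inj_on v {1..K}"
  shows "sorted_pivot K v i = cut_point (v ` {1..K}) i"
proof -
  have "distinct (map v [1..<Suc K])"
    using assms by (simp add: distinct_map atLeastLessThanSuc_atLeastAtMost del: upt_Suc)
  hence "sort (map v [1..<Suc K]) = sorted_list_of_set (set (map v [1..<Suc K]))"
    by (simp only: sorted_list_of_set_sort_remdups distinct_remdups_id)
  also have "set (map v [1..<Suc K]) = v ` {1..K}"
    by (simp add: atLeastLessThanSuc_atLeastAtMost del: upt_Suc)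
  finally show ?thesis by (simp only: sorted_pivot_def cut_point_def)
qed

context
  fixes T Q :: "real set" and K :: nat
  assumes T: "finite T" "T \<subseteq> {0<..<1}" and Q: "Q \<in> subsets_of_card T K"
begin

lemma finite_pivots: "finite Q" and pivots_subset: "Q \<subseteq> T" and card_pivots: "card Q = K"
  using Q T(1) by (auto simp: subsets_of_card_def intro: finite_subset)

lemma cut_0: "cut_point Q 0 = 0"
  by (simp add: cut_point_def)

lemma cut_last: "cut_point Q (Suc K) = 1"
  by (simp add: cut_point_def nth_append card_pivots)

lemma cut_less: "i < j \<Longrightarrow> j \<le> Suc K \<Longrightarrow> cut_point Q i < cut_point Q j"
proof -
  assume ij: "i < j" "j \<le> Suc K"
  have "sorted_wrt (<) (0 # sorted_list_of_set Q @ [1])"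
    using T(2) pivots_subset finite_pivots by (auto simp: sorted_wrt_append)
  from sorted_wrt_nth_less[OF this ij(1)] ij(2) show ?thesis
    by (simp add: cut_point_def card_pivots)
qed

lemma cut_less_iff: "i \<le> Suc K \<Longrightarrow> j \<le> Suc K \<Longrightarrow> cut_point Q i < cut_point Q j \<longleftrightarrow> i < j"
  using cut_less[of i j] cut_less[of j i] by (cases i j rule: linorder_cases) auto

lemma cut_image: "cut_point Q ` {1..K} = Q"
proof -
  have "Q = set (sorted_list_of_set Q)" using finite_pivots by simp
  also have "\<dots> = (\<lambda>i. sorted_list_of_set Q ! i) ` {..<K}"
    by (auto simp: set_conv_nth card_pivots)
  also have "\<dots> = (\<lambda>i. cut_point Q (Suc i)) ` {..<K}"
    by (intro image_cong) (auto simp: cut_point_def nth_append card_pivots)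
  also have "\<dots> = cut_point Q ` Suc ` {..<K}" by (simp only: image_image)
  also have "Suc ` {..<K} = {1..K}" by (simp add: image_Suc_lessThan)
  finally show ?thesis ..
qed

lemma no_pivot_between:
  assumes "i \<le> K" "x \<in> Q"
  shows "\<not> (cut_point Q i < x \<and> x < cut_point Q (Suc i))"
proof
  assume *: "cut_point Q i < x \<and> x < cut_point Q (Suc i)"
  obtain j where "j \<in> {1..K}" "x = cut_point Q j" using assms(2) cut_image by blast
  with * assms(1) show False by (auto simp: cut_less_iff)
qed

lemma gap_altdef: "i \<le> K \<Longrightarrow> gap T Q i = card {x \<in> T. cut_point Q i < x \<and> x < cut_point Q (Suc i)}"
  unfolding gap_def using no_pivot_between by (intro arg_cong[of _ _ card]) blast

text \<open>This is the rank of the \<open>i\<close>-th pivot in the sample: the pivots up to it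
  plus the gaps to its left. It lets the gaps determine the pivots and, on a grid, their
  positions.\<close>

lemma card_below_cut: "i \<le> K \<Longrightarrow> card {x \<in> T. x \<le> cut_point Q i} = i + (\<Sum>j<i. gap T Q j)"
proof (induction i)
  case 0
  have "{x \<in> T. x \<le> cut_point Q 0} = {}" using T(2) cut_0 by force
  thus ?case by (simp only: card.empty) simp
next
  case (Suc i)
  have "cut_point Q (Suc i) \<in> Q" using Suc.prems by (subst cut_image [symmetric]) auto
  hence "{x \<in> T. x \<le> cut_point Q (Suc i)} =
      {x \<in> T. x \<le> cut_point Q i} \<union> {x \<in> T. cut_point Q i < x \<and> x < cut_point Q (Suc i)} \<union> {cut_point Q (Suc i)}"
    using pivots_subset cut_less[of i "Suc i"] Suc.prems by auto
  also have "card \<dots> = card {x \<in> T. x \<le> cut_point Q i} + card {x \<in> T. cut_point Q i < x \<and> x < cut_point Q (Suc i)} + 1"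
    using T(1) cut_less[of i "Suc i"] Suc.prems
    by (subst card_Un_disjoint; (subst card_Un_disjoint)?) auto
  finally show ?case using Suc gap_altdef[of i] by simp
qed

lemma sum_gap: "K + (\<Sum>i\<le>K. gap T Q i) = card T"
proof -
  have "T = {x \<in> T. x \<le> cut_point Q K} \<union> {x \<in> T. cut_point Q K < x \<and> x < cut_point Q (Suc K)}"
    using T(2) cut_last by auto
  hence "card T = card ({x \<in> T. x \<le> cut_point Q K} \<union> {x \<in> T. cut_point Q K < x \<and> x < cut_point Q (Suc K)})"
    by (rule arg_cong)
  also have "\<dots> = card {x \<in> T. x \<le> cut_point Q K} + card {x \<in> T. cut_point Q K < x \<and> x < cut_point Q (Suc K)}"
    using T(1) by (subst card_Un_disjoint) auto
  also have "\<dots> = K + (\<Sum>j<K. gap T Q j) + gap T Q K"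
    by (simp add: card_below_cut gap_altdef)
  finally show ?thesis by (simp add: lessThan_Suc_atMost[symmetric])
qed

lemma gap_list_in_compositions: "map (gap T Q) [0..<Suc K] \<in> compositions K (card T - K)"
proof -
  have "sum_list (map (gap T Q) [0..<Suc K]) = (\<Sum>i\<le>K. gap T Q i)"
    by (simp add: interv_sum_list_conv_sum_set_nat atLeast0LessThan lessThan_Suc_atMost del: upt_Suc)
  thus ?thesis using sum_gap by (simp add: compositions_def del: upt_Suc)
qed

end

text \<open>The gaps determine the ranks of the pivots by \<open>card_below_cut\<close>, and a point
  of a finite set of reals is determined by its rank.\<close>

lemma inj_on_gap_list:
  assumes "finite T" "T \<subseteq> {0<..<1}"
  shows "inj_on (\<lambda>Q. map (gap T Q) [0..<Suc K]) (subsets_of_card T K)"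
proof (rule inj_onI)
  fix Q Q' assume Q: "Q \<in> subsets_of_card T K" "Q' \<in> subsets_of_card T K"
    and "map (gap T Q) [0..<Suc K] = map (gap T Q') [0..<Suc K]"
  hence gap: "gap T Q i = gap T Q' i" if "i \<le> K" for i
    using that by (auto simp del: upt_Suc)
  have inj: "x = y" if "x \<in> T" "y \<in> T" "card {z \<in> T. z \<le> x} = card {z \<in> T. z \<le> y}" for x y
  proof -
    have *: "x = y" if "x \<le> y" "y \<in> T" "card {z \<in> T. z \<le> x} = card {z \<in> T. z \<le> y}" for x y
    proof -
      have "{z \<in> T. z \<le> x} = {z \<in> T. z \<le> y}"
        using that assms(1) by (intro card_subset_eq) auto
      thus ?thesis using that by force
    qed
    show ?thesis using *[of x y] *[of y x] that by (cases "x \<le> y") auto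
  qed
  have "cut_point Q i = cut_point Q' i" if i: "i \<in> {1..K}" for i
  proof (rule inj)
    show "cut_point Q i \<in> T" "cut_point Q' i \<in> T"
      using i cut_image[OF assms Q(1)] cut_image[OF assms Q(2)] Q by (auto simp: subsets_of_card_def)
    show "card {z \<in> T. z \<le> cut_point Q i} = card {z \<in> T. z \<le> cut_point Q' i}"
      using i gap by (simp add: card_below_cut[OF assms Q(1)] card_below_cut[OF assms Q(2)])
  qed
  hence "cut_point Q ` {1..K} = cut_point Q' ` {1..K}" by (rule image_cong[OF refl])
  thus "Q = Q'" by (simp only: cut_image[OF assms Q(1)] cut_image[OF assms Q(2)])
qed

text \<open>Injectivity suffices because both sides have \<open>card T choose K\<close> elements.\<close>

lemma bij_betw_gap_list:
  assumes "finite T" "T \<subseteq> {0<..<1}" "K \<le> card T"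
  shows "bij_betw (\<lambda>Q. map (gap T Q) [0..<Suc K]) (subsets_of_card T K) (compositions K (card T - K))"
  unfolding bij_betw_def
proof
  show inj: "inj_on (\<lambda>Q. map (gap T Q) [0..<Suc K]) (subsets_of_card T K)"
    by (rule inj_on_gap_list[OF assms(1,2)])
  show "(\<lambda>Q. map (gap T Q) [0..<Suc K]) ` subsets_of_card T K = compositions K (card T - K)"
  proof (rule card_subset_eq[OF finite_compositions])
    show "(\<lambda>Q. map (gap T Q) [0..<Suc K]) ` subsets_of_card T K \<subseteq> compositions K (card T - K)"
      using gap_list_in_compositions[OF assms(1,2)] by blast
    show "card ((\<lambda>Q. map (gap T Q) [0..<Suc K]) ` subsets_of_card T K) = card (compositions K (card T - K))"
      using assms by (simp add: card_image[OF inj] card_subsets_of_card card_compositions del: upt_Suc)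
  qed
qed

text \<open>A sample in which rank and position agree up to the factor \<open>N\<close>, so gap
  sizes turn into spacings.\<close>

definition grid :: "nat \<Rightarrow> real set" where
  "grid N = (\<lambda>l. real l / real N) ` {1..<N}"

lemma finite_grid: "finite (grid N)"
  and grid_subset: "grid N \<subseteq> {0<..<1}"
  by (auto simp: grid_def)

lemma card_grid: "card (grid N) = N - 1"
  unfolding grid_def by (subst card_image) (auto simp: inj_on_def)

text \<open>A grid point \<open>l / N\<close> has rank \<open>l\<close>, which
  \<open>card_below_cut\<close> expresses by gaps. The right boundary fits the same formula, as
  \<open>N - 1\<close> grid points and one boundary point make \<open>N\<close>.\<close>

lemma cut_grid:
  assumes "Q \<in> subsets_of_card (grid N) K" "N \<ge> 1" "i \<le> Suc K"
  shows "real N * cut_point Q i = real (i + (\<Sum>j<i. gap (grid N) Q j))"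
proof -
  note * = finite_grid grid_subset assms(1)
  consider "i = 0" | "i = Suc K" | "i \<in> {1..K}" using assms(3) by force
  thus ?thesis
  proof cases
    case 1
    thus ?thesis using cut_0[OF *] by simp
  next
    case 2
    have "Suc K + (\<Sum>j<Suc K. gap (grid N) Q j) = N"
      using sum_gap[OF *] assms(2) by (simp add: card_grid lessThan_Suc_atMost)
    thus ?thesis unfolding 2 cut_last[OF *] by (simp only: mult_1_right)
  next
    case 3
    hence "cut_point Q i \<in> Q" using cut_image[OF *] by blast
    then obtain l where l: "l \<in> {1..<N}" "cut_point Q i = real l / real N"
      using assms(1) by (auto simp: subsets_of_card_def grid_def)
    have "{x \<in> grid N. x \<le> cut_point Q i} = (\<lambda>l. real l / real N) ` {1..l}"
      using l by (auto simp: grid_def divide_le_cancel)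
    moreover have "card ((\<lambda>l. real l / real N) ` {1..l}) = l"
      using l by (subst card_image) (auto simp: inj_on_def)
    ultimately have "l = i + (\<Sum>j<i. gap (grid N) Q j)"
      using card_below_cut[OF *, of i] 3 by simp
    moreover have "real N * cut_point Q i = real l" using l by simp
    ultimately show ?thesis by simp
  qed
qed

lemma cut_grid_diff:
  assumes "Q \<in> subsets_of_card (grid N) K" "N \<ge> 1" "i \<le> K"
  shows "cut_point Q (Suc i) - cut_point Q i = (real (gap (grid N) Q i) + 1) / real N"
proof -
  have "real N * (cut_point Q (Suc i) - cut_point Q i) = real (gap (grid N) Q i) + 1"
    using cut_grid[OF assms(1,2), of "Suc i"] cut_grid[OF assms(1,2), of i] assms(3)
    by (simp add: right_diff_distrib)
  thus ?thesis using assms(2) by (simp add: field_simps)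
qed

abbreviation (input) pivots_cost :: "nat \<Rightarrow> real set \<Rightarrow> real" where
  "pivots_cost K Q \<equiv> opt_cost K (\<lambda>i. cut_point Q (Suc i) - cut_point Q i)"

text \<open>The summand 1 in the weights is exactly the step from a gap to a spacing of the grid.
  With \<open>N = K + k\<close> the grid has \<open>k - 1\<close> points besides the pivots, one for
  each element classified before the \<open>k\<close>-th.\<close>

lemma sum_opt_cost_compositions:
  assumes "k \<ge> 1"
  shows "(\<Sum>c\<in>compositions K (k - 1). opt_cost K (\<lambda>i. real (c ! i) + 1)) =
    real (K + k) * (\<Sum>Q\<in>subsets_of_card (grid (K + k)) K. pivots_cost K Q)"
proof -
  define N where "N = K + k"
  have N: "N \<ge> 1" "card (grid N) - K = k - 1" "K \<le> card (grid N)" using assms by (auto simp: N_def card_grid)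
  have "(\<Sum>c\<in>compositions K (k - 1). opt_cost K (\<lambda>i. real (c ! i) + 1)) =
    (\<Sum>Q\<in>subsets_of_card (grid N) K. opt_cost K (\<lambda>i. real (map (gap (grid N) Q) [0..<Suc K] ! i) + 1))"
    using sum.reindex_bij_betw[OF bij_betw_gap_list[OF finite_grid grid_subset N(3)],
        of "\<lambda>c. opt_cost K (\<lambda>i. real (c ! i) + 1)"] N by simp
  also have "\<dots> = (\<Sum>Q\<in>subsets_of_card (grid N) K. real N * pivots_cost K Q)"
  proof (rule sum.cong[OF refl])
    fix Q assume Q: "Q \<in> subsets_of_card (grid N) K"
    have "opt_cost K (\<lambda>i. real (map (gap (grid N) Q) [0..<Suc K] ! i) + 1) =
      opt_cost K (\<lambda>i. real N * (cut_point Q (Suc i) - cut_point Q i))"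
      using N(1) by (intro opt_cost_cong) (simp add: cut_grid_diff[OF Q N(1)] del: upt_Suc)
    thus "opt_cost K (\<lambda>i. real (map (gap (grid N) Q) [0..<Suc K] ! i) + 1) =
      real N * pivots_cost K Q"
      by (simp add: opt_cost_cmult)
  qed
  finally show ?thesis by (simp add: N_def sum_distrib_left)
qed

section \<open>Exchangeable uniform inputs\<close>

lemma sorted_nth_le_iff:
  assumes "sorted xs" "i < length xs"
  shows "xs ! i \<le> (x :: 'a :: linorder) \<longleftrightarrow> Suc i \<le> length (filter (\<lambda>y. y \<le> x) xs)"
  using assms
proof (induction xs arbitrary: i)
  case (Cons y ys)
  show ?case
  proof (cases "y \<le> x")
    case True
    with Cons show ?thesis by (cases i) auto
  next
    case False
    with Cons.prems(1) have "filter (\<lambda>y. y \<le> x) ys = []" by (auto simp: filter_empty_conv)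
    moreover have "\<not> (y # ys) ! i \<le> x"
      using False Cons.prems nth_mem[of i "y # ys"] by (auto simp: nth_Cons split: nat.splits dest!: nth_mem)
    ultimately show ?thesis using False by simp
  qed
qed simp

text \<open>Describing order statistics by counting makes them measurable without any statement
  about sorting as a map.\<close>

lemma sorted_pivot_le_iff:
  assumes "i \<in> {1..K}"
  shows "sorted_pivot K v i \<le> x \<longleftrightarrow> i \<le> card {j \<in> {1..K}. v j \<le> x}"
proof -
  obtain i' where i': "i = Suc i'" "i' < K" using assms by (cases i) auto
  define xs where "xs = map v [1..<Suc K]"
  have "sorted_pivot K v i = sort xs ! i'"
    using i' by (simp add: sorted_pivot_def nth_append xs_def del: upt_Suc)
  also have "\<dots> \<le> x \<longleftrightarrow> i \<le> length (filter (\<lambda>y. y \<le> x) (sort xs))"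
    using i' by (subst sorted_nth_le_iff) (auto simp: xs_def simp del: upt_Suc)
  also have "length (filter (\<lambda>y. y \<le> x) (sort xs)) = length (filter (\<lambda>y. y \<le> x) xs)"
    by (metis mset_sort mset_filter size_mset)
  also have "\<dots> = length (filter (\<lambda>j. v j \<le> x) [1..<Suc K])"
    by (simp add: xs_def filter_map o_def del: upt_Suc)
  also have "\<dots> = card (set (filter (\<lambda>j. v j \<le> x) [1..<Suc K]))"
    by (intro distinct_card [symmetric] distinct_filter distinct_upt)
  also have "set (filter (\<lambda>j. v j \<le> x) [1..<Suc K]) = {j \<in> {1..K}. v j \<le> x}"
    by (auto simp del: upt_Suc)
  finally show ?thesis .
qed

lemma sorted_pivot_0: "sorted_pivot K v 0 = 0"
  and sorted_pivot_last: "sorted_pivot K v (Suc K) = 1"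
  by (simp_all add: sorted_pivot_def nth_append del: upt_Suc)

lemma measurable_sorted_pivot:
  assumes v: "\<And>j. j \<in> {1..K} \<Longrightarrow> (\<lambda>\<omega>. v \<omega> j) \<in> borel_measurable M" and "i \<le> Suc K"
  shows "(\<lambda>\<omega>. sorted_pivot K (v \<omega>) i) \<in> borel_measurable M"
proof -
  consider "i = 0" | "i = Suc K" | "i \<in> {1..K}" using assms(2) by force
  thus ?thesis
  proof cases
    case 3
    have "{\<omega> \<in> space M. sorted_pivot K (v \<omega>) i \<le> y} \<in> sets M" for y
    proof -
      have "(\<lambda>\<omega>. card {j \<in> {1..K}. v \<omega> j \<le> y}) \<in> measurable M (count_space UNIV)"
      proof (rule measurable_card)
        fix j
        show "{\<omega> \<in> space M. j \<in> {j \<in> {1..K}. v \<omega> j \<le> y}} \<in> sets M"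
        proof (cases "j \<in> {1..K}")
          case True
          note [measurable] = v[OF True]
          have "{\<omega> \<in> space M. v \<omega> j \<le> y} \<in> sets M" by measurable
          with True show ?thesis by simp
        next
          case False
          thus ?thesis by (simp only: mem_Collect_eq simp_thms) simp
        qed
      qed
      hence "(\<lambda>\<omega>. card {j \<in> {1..K}. v \<omega> j \<le> y}) -` {i..} \<inter> space M \<in> sets M"
        by (rule measurable_sets) simp
      also have "(\<lambda>\<omega>. card {j \<in> {1..K}. v \<omega> j \<le> y}) -` {i..} \<inter> space M =
          {\<omega> \<in> space M. i \<le> card {j \<in> {1..K}. v \<omega> j \<le> y}}"
        by blast
      finally have "{\<omega> \<in> space M. i \<le> card {j \<in> {1..K}. v \<omega> j \<le> y}} \<in> sets M" .
      thus ?thesis by (simp only: sorted_pivot_le_iff[OF 3])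
    qed
    thus ?thesis by (rule borel_measurableI_le)
  qed (simp_all add: sorted_pivot_0 sorted_pivot_last)
qed

lemma pred_in_segment:
  assumes "\<And>j. j \<in> {1..K} \<Longrightarrow> (\<lambda>\<omega>. v \<omega> j) \<in> borel_measurable M" "x \<in> borel_measurable M" "i \<le> K"
  shows "Measurable.pred M (\<lambda>\<omega>. x \<omega> \<in> segment K (v \<omega>) i)"
proof -
  note [measurable] = assms(2)
  have [measurable]: "(\<lambda>\<omega>. sorted_pivot K (v \<omega>) i) \<in> borel_measurable M"
      "(\<lambda>\<omega>. sorted_pivot K (v \<omega>) (Suc i)) \<in> borel_measurable M"
    using measurable_sorted_pivot[OF assms(1)] assms(3) by auto
  show ?thesis unfolding segment_def greaterThanLessThan_iff by measurable
qed

lemma measurable_card_in_segment: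
  fixes x :: "'b \<Rightarrow> nat \<Rightarrow> real"
  assumes "\<And>j. j \<in> {1..K} \<Longrightarrow> (\<lambda>\<omega>. v \<omega> j) \<in> borel_measurable M"
    "\<And>k. k \<in> L \<Longrightarrow> (\<lambda>\<omega>. x \<omega> k) \<in> borel_measurable M" "i \<le> K"
  shows "(\<lambda>\<omega>. card {k \<in> L. x \<omega> k \<in> segment K (v \<omega>) i}) \<in> measurable M (count_space UNIV)"
proof (rule measurable_card)
  fix k
  show "{\<omega> \<in> space M. k \<in> {k \<in> L. x \<omega> k \<in> segment K (v \<omega>) i}} \<in> sets M"
  proof (cases "k \<in> L")
    case True
    from pred_in_segment[of K v M "\<lambda>\<omega>. x \<omega> k" i, OF assms(1) assms(2)[OF True] assms(3)] True
    show ?thesis by (simp add: pred_def)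
  qed simp
qed

context prob_space
begin

text \<open>The source of exchangeability. The two index types may differ, which lets the families
  \<open>V\<close> and \<open>a\<close>, joined over a sum type, be read as one sequence.\<close>

lemma distr_PiM_iid_reindex:
  assumes "indep_vars (\<lambda>_. borel) Z I" "\<And>i. i \<in> I \<Longrightarrow> distr M borel (Z i) = \<mu>"
    and "inj_on f J" "f ` J \<subseteq> I" "J \<noteq> {}"
  shows "distr M (PiM J (\<lambda>_. borel)) (\<lambda>\<omega>. \<lambda>n\<in>J. Z (f n) \<omega>) = PiM J (\<lambda>_. \<mu>)"
proof -
  have "I \<noteq> {}" using assms(4,5) by auto
  have meas: "random_variable borel (Z i)" if "i \<in> I" for i
    using assms(1) that by (auto simp: indep_vars_def)
  have prob: "prob_space \<mu>"
    using prob_space_distr[OF meas] assms(2) \<open>I \<noteq> {}\<close> by (metis ex_in_conv)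
  have sets: "sets \<mu> = sets borel"
    using assms(2) \<open>I \<noteq> {}\<close> by (metis ex_in_conv sets_distr)
  have sets': "sets (PiM J' (\<lambda>_. \<mu>)) = sets (PiM J' (\<lambda>_. borel))" for J' :: "'x set"
    by (intro sets_PiM_cong) (auto simp: sets)
  have "distr M (PiM I (\<lambda>_. borel)) (\<lambda>\<omega>. \<lambda>i\<in>I. Z i \<omega>) = PiM I (\<lambda>i. distr M borel (Z i))"
    using assms(1) indep_vars_iff_distr_eq_PiM'[OF \<open>I \<noteq> {}\<close>, of Z "\<lambda>_. borel"] meas by simp
  also have "\<dots> = PiM I (\<lambda>_. \<mu>)" by (intro PiM_cong) (auto simp: assms(2))
  finally have law: "PiM I (\<lambda>_. \<mu>) = distr M (PiM I (\<lambda>_. borel)) (\<lambda>\<omega>. \<lambda>i\<in>I. Z i \<omega>)" ..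
  have "PiM J (\<lambda>_. \<mu>) = distr (PiM I (\<lambda>_. \<mu>)) (PiM J (\<lambda>_. \<mu>)) (\<lambda>\<omega>. \<lambda>n\<in>J. \<omega> (f n))"
    using assms(3,4) prob by (subst distr_PiM_reindex) auto
  also have "\<dots> = distr (PiM I (\<lambda>_. \<mu>)) (PiM J (\<lambda>_. borel)) (\<lambda>\<omega>. \<lambda>n\<in>J. \<omega> (f n))"
    by (intro distr_cong refl) (simp add: sets')
  also have "\<dots> = distr M (PiM J (\<lambda>_. borel)) ((\<lambda>\<omega>. \<lambda>n\<in>J. \<omega> (f n)) \<circ> (\<lambda>\<omega>. \<lambda>i\<in>I. Z i \<omega>))"
    unfolding law
  proof (rule distr_distr)
    show "(\<lambda>\<omega>. \<lambda>n\<in>J. \<omega> (f n)) \<in> PiM I (\<lambda>_. borel) \<rightarrow>\<^sub>M PiM J (\<lambda>_. borel)"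
      using assms(4) by (intro measurable_restrict measurable_component_singleton) auto
    show "(\<lambda>\<omega>. \<lambda>i\<in>I. Z i \<omega>) \<in> M \<rightarrow>\<^sub>M PiM I (\<lambda>_. borel)"
      using meas by (intro measurable_restrict) auto
  qed
  also have "(\<lambda>\<omega>. \<lambda>n\<in>J. \<omega> (f n)) \<circ> (\<lambda>\<omega>. \<lambda>i\<in>I. Z i \<omega>) = (\<lambda>\<omega>. \<lambda>n\<in>J. Z (f n) \<omega>)"
    using assms(4) by (auto simp: fun_eq_iff)
  finally show ?thesis ..
qed

end

section \<open>Uniform samples without ties\<close>

definition unit_uniform :: "real measure" where
  "unit_uniform = uniform_measure lborel {0..1}"

lemma sets_unit_uniform [measurable_cong, simp]: "sets unit_uniform = sets borel"
  by (simp add: unit_uniform_def)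

lemma space_unit_uniform [simp]: "space unit_uniform = UNIV"
  by (simp add: unit_uniform_def)

lemma prob_space_unit_uniform: "prob_space unit_uniform"
  unfolding unit_uniform_def by (rule prob_space_uniform_measure) auto

lemma AE_unit_uniform_neq: "AE x in unit_uniform. x \<noteq> c"
  unfolding unit_uniform_def
  by (rule AE_uniform_measureI) (use AE_lborel_singleton[of c] in auto)

lemma AE_unit_uniform_interior: "AE x in unit_uniform. x \<in> {0<..<1}"
proof -
  have "AE x in unit_uniform. x \<in> {0..1}"
    unfolding unit_uniform_def by (rule AE_uniform_measureI) auto
  with AE_unit_uniform_neq[of 0] AE_unit_uniform_neq[of 1] show ?thesis
    by eventually_elim auto
qed

text \<open>A single sequence supplies pivots and elements: entries 1 to \<open>K\<close> are the
  pivots and the indices in \<open>L\<close> are classified. Permuting \<open>u\<close> thus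
  exchanges these roles.\<close>

definition segment_count :: "nat \<Rightarrow> nat set \<Rightarrow> (nat \<Rightarrow> real) \<Rightarrow> nat \<Rightarrow> nat" where
  "segment_count K L u i = card {l \<in> L. u l \<in> segment K u i}"

text \<open>The almost sure event on which the open segments catch every element that is not a
  pivot.\<close>

definition generic :: "nat \<Rightarrow> (nat \<Rightarrow> real) \<Rightarrow> bool" where
  "generic N u \<longleftrightarrow> inj_on u {1..N} \<and> u ` {1..N} \<subseteq> {0<..<1}"

lemma sorted_pivot_cong:
  assumes "\<And>j. j \<in> {1..K} \<Longrightarrow> v j = v' j"
  shows "sorted_pivot K v = sorted_pivot K v'"
proof -
  have "map v [1..<Suc K] = map v' [1..<Suc K]" using assms by (auto simp del: upt_Suc)
  thus ?thesis by (simp only: sorted_pivot_def fun_eq_iff simp_thms)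
qed

lemma segment_cong: "(\<And>j. j \<in> {1..K} \<Longrightarrow> v j = v' j) \<Longrightarrow> segment K v = segment K v'"
  using sorted_pivot_cong[of K v v'] by (simp add: segment_def fun_eq_iff)

lemma sublist_size_eq_segment_count:
  assumes "\<And>j. j \<in> {1..K} \<Longrightarrow> u j = v j" "\<And>k. k \<ge> 1 \<Longrightarrow> u (K + k) = x k" "K \<le> n"
  shows "sublist_size K v x n i = segment_count K {K + 1..n} u i"
proof -
  have *: "segment K u = segment K v" by (rule segment_cong) (rule assms(1))
  have "x (l - K) = u l" if "l \<ge> K + 1" for l
    using assms(2)[of "l - K"] that by simp
  hence bij: "bij_betw ((+) K) {k \<in> {1..n - K}. x k \<in> segment K v i} {l \<in> {K + 1..n}. u l \<in> segment K v i}"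
    using assms(2,3) by (intro bij_betwI[of _ _ _ "\<lambda>l. l - K"]) (auto simp: le_diff_conv2)
  show ?thesis
    using bij_betw_same_card[OF bij] by (simp only: sublist_size_def segment_count_def *)
qed

lemma classified_before_eq_segment_count:
  assumes "\<And>j. j \<in> {1..K} \<Longrightarrow> u j = v j" "\<And>k. k \<ge> 1 \<Longrightarrow> u (K + k) = x k" "k \<ge> 1"
  shows "classified_before K v x k i = segment_count K {K + 1..<K + k} u i"
proof -
  have "{1..<k} = {1..(K + (k - 1)) - K}" "{K + 1..<K + k} = {K + 1..K + (k - 1)}" using assms(3) by auto
  thus ?thesis
    using sublist_size_eq_segment_count[of K u v x "K + (k - 1)" i] assms(1,2)
    by (simp only: classified_before_def sublist_size_def le_add1)
qed

lemma generic_pivots: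
  assumes "generic N u" "J \<in> subsets_of_card {1..N} K"
  shows "u ` J \<in> subsets_of_card (u ` {1..N}) K"
proof -
  have J: "J \<subseteq> {1..N}" "card J = K" using assms(2) by (auto simp: subsets_of_card_def)
  have "inj_on u J" using assms(1) J(1) unfolding generic_def by (blast intro: inj_on_subset)
  thus ?thesis using J by (simp add: subsets_of_card_def card_image image_mono)
qed

lemma generic_permuted_inj:
  assumes "generic N u" "\<sigma> permutes {1..N}"
  shows "inj_on (\<lambda>l. u (\<sigma> l)) {1..N}"
proof -
  have "inj_on (u \<circ> \<sigma>) {1..N}"
    using assms(1) permutes_image[OF assms(2)] permutes_inj_on[OF assms(2)]
    by (intro comp_inj_on) (simp_all add: generic_def)
  thus ?thesis by (simp add: o_def)
qed

lemma sorted_pivot_permuted: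
  assumes "generic N u" "\<sigma> permutes {1..N}" "K \<le> N"
  shows "sorted_pivot K (\<lambda>l. u (\<sigma> l)) = cut_point (u ` \<sigma> ` {1..K})"
proof
  fix i
  have "inj_on (\<lambda>l. u (\<sigma> l)) {1..K}"
    by (rule inj_on_subset[OF generic_permuted_inj[OF assms(1,2)]]) (use assms(3) in auto)
  thus "sorted_pivot K (\<lambda>l. u (\<sigma> l)) i = cut_point (u ` \<sigma> ` {1..K}) i"
    by (simp add: sorted_pivot_eq_cut image_image)
qed

text \<open>A permutation affects the counts only through the set of inputs it makes pivots, which
  turns probabilities of counts into a count of \<open>K\<close>-subsets.\<close>

lemma segment_count_permuted:
  assumes "generic N u" "\<sigma> permutes {1..N}" "K \<le> N"
  shows "segment_count K {K + 1..N} (\<lambda>l. u (\<sigma> l)) i = gap (u ` {1..N}) (u ` \<sigma> ` {1..K}) i"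
proof -
  define Q where "Q = u ` \<sigma> ` {1..K}"
  define S where "S = {cut_point Q i <..< cut_point Q (Suc i)}"
  have inj: "inj_on (\<lambda>l. u (\<sigma> l)) {1..N}"
    by (rule generic_permuted_inj[OF assms(1,2)])
  have im: "(\<lambda>l. u (\<sigma> l)) ` {1..N} = u ` {1..N}"
    using permutes_image[OF assms(2)] by (metis image_image)
  have "segment K (\<lambda>l. u (\<sigma> l)) i = S"
    by (simp add: segment_def sorted_pivot_permuted[OF assms] Q_def S_def)
  hence "segment_count K {K + 1..N} (\<lambda>l. u (\<sigma> l)) i = card {l \<in> {K + 1..N}. u (\<sigma> l) \<in> S}"
    by (simp add: segment_count_def)
  also have "\<dots> = card ((\<lambda>l. u (\<sigma> l)) ` {l \<in> {K + 1..N}. u (\<sigma> l) \<in> S})"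
    using inj by (intro card_image [symmetric]) (auto intro: inj_on_subset)
  also have "(\<lambda>l. u (\<sigma> l)) ` {l \<in> {K + 1..N}. u (\<sigma> l) \<in> S} = {x \<in> (\<lambda>l. u (\<sigma> l)) ` ({1..N} - {1..K}). x \<in> S}"
  proof -
    have "{K + 1..N} = {1..N} - {1..K}" by auto
    thus ?thesis by auto
  qed
  also have "(\<lambda>l. u (\<sigma> l)) ` ({1..N} - {1..K}) = u ` {1..N} - Q"
  proof -
    have "(\<lambda>l. u (\<sigma> l)) ` ({1..N} - {1..K}) = (\<lambda>l. u (\<sigma> l)) ` {1..N} - (\<lambda>l. u (\<sigma> l)) ` {1..K}"
      using assms(3) by (intro inj_on_image_set_diff[OF inj]) auto
    thus ?thesis unfolding im by (simp only: Q_def image_image)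
  qed
  finally show ?thesis by (simp add: gap_def S_def Q_def)
qed

lemma segments_disjoint:
  assumes "generic N u" "K \<le> N" "i \<le> K" "j \<le> K" "x \<in> segment K u i" "x \<in> segment K u j"
  shows "i = j"
proof -
  define Q where "Q = u ` {1..K}"
  have "{1..K} \<in> subsets_of_card {1..N} K" using assms(2) by (simp add: subsets_of_card_def)
  hence Q: "Q \<in> subsets_of_card (u ` {1..N}) K" unfolding Q_def by (rule generic_pivots[OF assms(1)])
  have T: "finite (u ` {1..N})" "u ` {1..N} \<subseteq> {0<..<1}" using assms(1) by (auto simp: generic_def)
  have sp: "sorted_pivot K u = cut_point Q"
    using sorted_pivot_permuted[OF assms(1) permutes_id assms(2)] by (simp add: Q_def)
  have less: False if "i < j" "j \<le> K" "x \<in> segment K u i" "x \<in> segment K u j" for i j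
  proof -
    have "cut_point Q (Suc i) \<le> cut_point Q j"
      using cut_less[OF T Q, of "Suc i" j] that by (cases "Suc i = j") auto
    with that show False by (auto simp: segment_def sp)
  qed
  show ?thesis using less[of i j] less[of j i] assms(3-6) by (cases i j rule: linorder_cases) auto
qed

lemma ex_permutation_image:
  assumes "J \<in> subsets_of_card {1..N} K"
  shows "\<exists>\<sigma>. \<sigma> permutes {1..N} \<and> \<sigma> ` {1..K} = J"
proof -
  have J: "J \<subseteq> {1..N}" "card J = K" using assms by (auto simp: subsets_of_card_def)
  hence "K \<le> N" using card_mono[of "{1..N}" J] by simp
  have "finite J" using J(1) by (rule finite_subset) simp
  obtain f where f: "bij_betw f {1..K} J"
    using \<open>finite J\<close> J(2) finite_same_card_bij[of "{1..K}" J] by auto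
  have "card {K + 1..N} = card ({1..N} - J)"
    using J \<open>finite J\<close> by (simp add: card_Diff_subset)
  then obtain g where g: "bij_betw g {K + 1..N} ({1..N} - J)"
    using finite_same_card_bij[of "{K + 1..N}" "{1..N} - J"] by auto
  define \<sigma> where "\<sigma> l = (if l \<in> {1..K} then f l else if l \<in> {K + 1..N} then g l else l)" for l
  have \<sigma>1: "bij_betw \<sigma> {1..K} J" using f by (rule bij_betw_cong[THEN iffD1, rotated]) (simp add: \<sigma>_def)
  have \<sigma>2: "bij_betw \<sigma> {K + 1..N} ({1..N} - J)" using g by (rule bij_betw_cong[THEN iffD1, rotated]) (simp add: \<sigma>_def)
  have "bij_betw \<sigma> ({1..K} \<union> {K + 1..N}) (J \<union> ({1..N} - J))"
    by (rule bij_betw_combine[OF \<sigma>1 \<sigma>2]) auto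
  moreover have "{1..K} \<union> {K + 1..N} = {1..N}" "J \<union> ({1..N} - J) = {1..N}" using J(1) \<open>K \<le> N\<close> by auto
  ultimately have "bij_betw \<sigma> {1..N} {1..N}" by simp
  hence "\<sigma> permutes {1..N}" by (rule bij_imp_permutes) (use \<open>K \<le> N\<close> in \<open>auto simp: \<sigma>_def\<close>)
  moreover have "\<sigma> ` {1..K} = J" using \<sigma>1 by (rule bij_betw_imp_surj_on)
  ultimately show ?thesis by blast
qed

lemma segment_transpose:
  assumes "K < l" "K < N"
  shows "segment K (\<lambda>j. u (Transposition.transpose l N j)) = segment K u"
  using assms by (intro segment_cong) (auto simp: Transposition.transpose_def)

text \<open>After the swap the \<open>l\<close>-th input is the last one, so the inputs before it
  are all elements other than \<open>l\<close>.\<close>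

lemma segment_count_transpose:
  assumes "l \<in> {K + 1..N}"
  shows "segment_count K {K + 1..<N} (\<lambda>j. u (Transposition.transpose l N j)) i =
    card ({j \<in> {K + 1..N}. u j \<in> segment K u i} - {l})"
proof -
  have "bij_betw (Transposition.transpose l N) {j \<in> {K + 1..<N}. u (Transposition.transpose l N j) \<in> segment K u i}
      ({j \<in> {K + 1..N}. u j \<in> segment K u i} - {l})"
    using assms by (intro bij_betwI[of _ _ _ "Transposition.transpose l N"]) (auto simp: Transposition.transpose_def)
  thus ?thesis
    using assms by (simp add: segment_count_def segment_transpose bij_betw_same_card)
qed

text \<open>Removing an input of segment \<open>i\<close> lowers exactly the \<open>i\<close>-th
  final count by one. The condition on the final counts no longer mentions \<open>l\<close>, so
  summing over \<open>l\<close> just counts the inputs in segment \<open>i\<close>.\<close>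

lemma last_in_segment_transpose_iff:
  assumes "generic N u" "l \<in> {K + 1..N}" "i \<le> K" "length c = Suc K"
  shows "(u l \<in> segment K u i \<and>
      (\<forall>j\<le>K. segment_count K {K + 1..<N} (\<lambda>j. u (Transposition.transpose l N j)) j = c ! j)) \<longleftrightarrow>
    (u l \<in> segment K u i \<and> (\<forall>j\<le>K. segment_count K {K + 1..N} u j = c[i := Suc (c ! i)] ! j))"
proof (rule conj_cong[OF refl])
  assume l: "u l \<in> segment K u i"
  have "segment_count K {K + 1..<N} (\<lambda>j. u (Transposition.transpose l N j)) j = c ! j \<longleftrightarrow>
      segment_count K {K + 1..N} u j = c[i := Suc (c ! i)] ! j" if j: "j \<le> K" for j
  proof (cases "j = i")
    case True
    define B where "B = {j \<in> {K + 1..N}. u j \<in> segment K u i}"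
    have "l \<in> B" "finite B" using l assms(2) by (auto simp: B_def)
    hence "card (B - {l}) = c ! i \<longleftrightarrow> card B = Suc (c ! i)"
      using card_Suc_Diff1[of B l] by auto
    thus ?thesis using True assms(3,4)
      unfolding segment_count_transpose[OF assms(2)] by (simp add: B_def segment_count_def)
  next
    case False
    have "u l \<notin> segment K u j"
      using segments_disjoint[OF assms(1) _ j assms(3) _ l] False assms(2) by auto
    hence "{j' \<in> {K + 1..N}. u j' \<in> segment K u j} - {l} = {j' \<in> {K + 1..N}. u j' \<in> segment K u j}"
      by auto
    thus ?thesis using False
      unfolding segment_count_transpose[OF assms(2)] by (simp add: segment_count_def)
  qed
  thus "(\<forall>j\<le>K. segment_count K {K + 1..<N} (\<lambda>j. u (Transposition.transpose l N j)) j = c ! j) \<longleftrightarrow>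
    (\<forall>j\<le>K. segment_count K {K + 1..N} u j = c[i := Suc (c ! i)] ! j)" by blast
qed

context optimal_quicksort
begin

text \<open>The pivots come first here, so that their indices do not depend on the length of the
  list.\<close>

definition input :: "'a \<Rightarrow> nat \<Rightarrow> real" where
  "input \<omega> l = (if l \<le> K then V l \<omega> else a (l - K) \<omega>)"

lemma input_law:
  assumes "inj_on \<sigma> J" "\<sigma> ` J \<subseteq> {1..}" "J \<noteq> {}"
  shows "distr M (PiM J (\<lambda>_. borel)) (\<lambda>\<omega>. \<lambda>n\<in>J. input \<omega> (\<sigma> n)) = PiM J (\<lambda>_. unit_uniform)"
proof -
  define f where "f n = (if \<sigma> n \<le> K then Inl (\<sigma> n) else Inr (\<sigma> n - K))" for n
  have "inj_on f J" using assms(1) by (auto simp: f_def inj_on_def split: if_splits)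
  moreover have "f ` J \<subseteq> Inl ` {1..K} \<union> Inr ` {1..}" using assms(2) by (auto simp: f_def)
  moreover have "distr M borel (case_sum V a i) = unit_uniform" if "i \<in> Inl ` {1..K} \<union> Inr ` {1..}" for i
    using that uniform_V uniform_a by (auto simp: unit_uniform_def)
  ultimately have "distr M (PiM J (\<lambda>_. borel)) (\<lambda>\<omega>. \<lambda>n\<in>J. case_sum V a (f n) \<omega>) = PiM J (\<lambda>_. unit_uniform)"
    using distr_PiM_iid_reindex[OF indep_input] assms(3) by blast
  moreover have "case_sum V a (f n) \<omega> = input \<omega> (\<sigma> n)" for n \<omega> by (simp add: f_def input_def)
  ultimately show ?thesis by simp
qed

lemma measurable_input [measurable]:
  assumes "l \<ge> 1"
  shows "(\<lambda>\<omega>. input \<omega> l) \<in> borel_measurable M"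
proof -
  have meas: "random_variable borel (case_sum V a i)" if "i \<in> Inl ` {1..K} \<union> Inr ` {1..}" for i
    using indep_input that by (auto simp: indep_vars_def)
  show ?thesis
  proof (cases "l \<le> K")
    case True
    thus ?thesis using meas[of "Inl l"] assms by (simp add: input_def)
  next
    case False
    thus ?thesis using meas[of "Inr (l - K)"] by (simp add: input_def)
  qed
qed

text \<open>The event is transported through the product law on \<open>{1..N}\<close>; as
  \<open>\<Phi>\<close> takes total functions, it has to ignore all other coordinates.\<close>

lemma prob_input_permuted:
  assumes "\<sigma> permutes {1..N}" "N \<ge> 1"
    and pred: "Measurable.pred (PiM {1..N} (\<lambda>_. borel)) \<Phi>"
    and \<Phi>: "\<And>u v. (\<And>l. l \<in> {1..N} \<Longrightarrow> u l = v l) \<Longrightarrow> \<Phi> u \<longleftrightarrow> \<Phi> v"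
  shows "prob {\<omega> \<in> space M. \<Phi> (\<lambda>l. input \<omega> (\<sigma> l))} = prob {\<omega> \<in> space M. \<Phi> (input \<omega>)}"
proof -
  let ?B = "{u \<in> space (PiM {1..N} (\<lambda>_. borel)). \<Phi> u}"
  have *: "prob {\<omega> \<in> space M. \<Phi> (\<lambda>l. input \<omega> (\<tau> l))} = measure (PiM {1..N} (\<lambda>_. unit_uniform)) ?B"
    if "\<tau> permutes {1..N}" for \<tau>
  proof -
    have \<tau>: "inj_on \<tau> {1..N}" "\<tau> ` {1..N} \<subseteq> {1..}"
      using permutes_inj_on[OF that] permutes_image[OF that] by auto
    have meas: "(\<lambda>\<omega>. \<lambda>n\<in>{1..N}. input \<omega> (\<tau> n)) \<in> M \<rightarrow>\<^sub>M PiM {1..N} (\<lambda>_. borel)"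
      using \<tau>(2) by (intro measurable_restrict measurable_input) (auto simp: image_subset_iff)
    have "measure (PiM {1..N} (\<lambda>_. unit_uniform)) ?B =
        measure M ((\<lambda>\<omega>. \<lambda>n\<in>{1..N}. input \<omega> (\<tau> n)) -` ?B \<inter> space M)"
    proof -
      have "{1..N} \<noteq> {}" "?B \<in> sets (PiM {1..N} (\<lambda>_. borel))"
        using assms(2) pred by (auto simp: pred_def)
      thus ?thesis unfolding input_law[OF \<tau> \<open>{1..N} \<noteq> {}\<close>, symmetric] by (intro measure_distr meas)
    qed
    also have "(\<lambda>\<omega>. \<lambda>n\<in>{1..N}. input \<omega> (\<tau> n)) -` ?B \<inter> space M = {\<omega> \<in> space M. \<Phi> (\<lambda>l. input \<omega> (\<tau> l))}"
    proof -
      have "\<Phi> (\<lambda>n\<in>{1..N}. input \<omega> (\<tau> n)) \<longleftrightarrow> \<Phi> (\<lambda>l. input \<omega> (\<tau> l))" for \<omega>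
        by (rule \<Phi>) simp
      thus ?thesis using measurable_space[OF meas] by blast
    qed
    finally show ?thesis ..
  qed
  show ?thesis using *[OF assms(1)] *[OF permutes_id] by simp
qed

lemma AE_input_interior:
  assumes "l \<ge> 1"
  shows "AE \<omega> in M. input \<omega> l \<in> {0<..<1}"
proof -
  have "distr M borel (\<lambda>\<omega>. input \<omega> l) = unit_uniform"
    using assms uniform_V[of l] uniform_a[of "l - K"]
    by (cases "l \<le> K") (simp_all add: input_def unit_uniform_def)
  hence "AE x in distr M borel (\<lambda>\<omega>. input \<omega> l). x \<in> {0<..<1}" using AE_unit_uniform_interior by (simp only:)
  thus ?thesis by (rule AE_distrD[OF measurable_input[OF assms]])
qed

text \<open>By Fubini, since the pair has an atomless product law. Indexing the pair by
  \<open>bool\<close> makes \<open>input_law\<close> applicable and links it to the binary product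
  measure.\<close>

lemma AE_input_neq:
  assumes "l \<ge> 1" "l' \<ge> 1" "l \<noteq> l'"
  shows "AE \<omega> in M. input \<omega> l \<noteq> input \<omega> l'"
proof -
  interpret U: prob_space unit_uniform by (rule prob_space_unit_uniform)
  interpret UU: pair_sigma_finite unit_uniform unit_uniform ..
  define \<sigma> where "\<sigma> b = (if b then l else l')" for b
  have law: "distr M (PiM UNIV (\<lambda>_. borel)) (\<lambda>\<omega>. \<lambda>b\<in>UNIV. input \<omega> (\<sigma> b)) = PiM UNIV (\<lambda>_. unit_uniform)"
    using assms by (intro input_law) (auto simp: \<sigma>_def inj_on_def split: if_splits)
  have neq: "AE z in unit_uniform \<Otimes>\<^sub>M unit_uniform. fst z \<noteq> snd z"
  proof (rule UU.AE_pair_measure)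
    show "{x \<in> space (unit_uniform \<Otimes>\<^sub>M unit_uniform). fst x \<noteq> snd x} \<in> sets (unit_uniform \<Otimes>\<^sub>M unit_uniform)"
      by measurable
    show "AE x in unit_uniform. AE y in unit_uniform. fst (x, y) \<noteq> snd (x, y)"
      using AE_unit_uniform_neq by (auto simp: eq_commute)
  qed
  have eq: "unit_uniform \<Otimes>\<^sub>M unit_uniform = distr (PiM UNIV (\<lambda>_. unit_uniform)) (unit_uniform \<Otimes>\<^sub>M unit_uniform) (\<lambda>x. (x True, x False))"
  proof -
    have "case_bool unit_uniform unit_uniform = (\<lambda>_. unit_uniform)" by (auto split: bool.split)
    thus ?thesis using pair_measure_eq_distr_PiM[OF U.sigma_finite_measure_axioms U.sigma_finite_measure_axioms] by simp
  qed
  have "AE z in distr (PiM UNIV (\<lambda>_. unit_uniform)) (unit_uniform \<Otimes>\<^sub>M unit_uniform) (\<lambda>x. (x True, x False)). fst z \<noteq> snd z"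
    by (subst eq [symmetric]) (rule neq)
  hence "AE x in PiM UNIV (\<lambda>_. unit_uniform). fst (x True, x False) \<noteq> snd (x True, x False)"
    by (rule AE_distrD[rotated]) measurable
  hence "AE x in PiM UNIV (\<lambda>_. unit_uniform). x True \<noteq> x False" by simp
  hence "AE x in distr M (PiM UNIV (\<lambda>_. borel)) (\<lambda>\<omega>. \<lambda>b\<in>UNIV. input \<omega> (\<sigma> b)). x True \<noteq> x False"
    unfolding law .
  hence "AE \<omega> in M. (\<lambda>b\<in>UNIV. input \<omega> (\<sigma> b)) True \<noteq> (\<lambda>b\<in>UNIV. input \<omega> (\<sigma> b)) False"
  proof (rule AE_distrD[rotated])
    show "(\<lambda>\<omega>. \<lambda>b\<in>UNIV. input \<omega> (\<sigma> b)) \<in> M \<rightarrow>\<^sub>M PiM UNIV (\<lambda>_. borel)"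
      using assms by (intro measurable_restrict measurable_input) (simp add: \<sigma>_def)
  qed
  thus ?thesis by (simp add: \<sigma>_def)
qed

lemma AE_generic: "AE \<omega> in M. generic N (input \<omega>)"
proof -
  have "AE \<omega> in M. \<forall>l\<in>{1..N}. input \<omega> l \<in> {0<..<1}"
    by (rule AE_finite_allI) (use AE_input_interior in auto)
  moreover have "AE \<omega> in M. \<forall>p\<in>{p\<in>{1..N} \<times> {1..N}. fst p \<noteq> snd p}. input \<omega> (fst p) \<noteq> input \<omega> (snd p)"
    by (rule AE_finite_allI) (use AE_input_neq in auto)
  ultimately show ?thesis
  proof eventually_elim
    case (elim \<omega>)
    have "inj_on (input \<omega>) {1..N}"
    proof (rule inj_onI)
      fix l l' assume "l \<in> {1..N}" "l' \<in> {1..N}" "input \<omega> l = input \<omega> l'"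
      with elim(2)[rule_format, of "(l, l')"] show "l = l'" by auto
    qed
    with elim(1) show ?case unfolding generic_def by blast
  qed
qed

lemma measurable_segment_count:
  assumes "\<And>j. j \<in> {1..K} \<union> L \<Longrightarrow> (\<lambda>\<omega>. u \<omega> j) \<in> borel_measurable N" "i \<le> K"
  shows "(\<lambda>\<omega>. segment_count K L (u \<omega>) i) \<in> measurable N (count_space UNIV)"
  unfolding segment_count_def using assms by (intro measurable_card_in_segment) auto

definition counts_eq :: "nat set \<Rightarrow> (nat \<Rightarrow> real) \<Rightarrow> nat list \<Rightarrow> bool" where
  "counts_eq L u c \<longleftrightarrow> (\<forall>i\<le>K. segment_count K L u i = c ! i)"

lemma pred_counts_eq:
  assumes "\<And>j. j \<in> {1..K} \<union> L \<Longrightarrow> (\<lambda>\<omega>. u \<omega> j) \<in> borel_measurable N"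
  shows "Measurable.pred N (\<lambda>\<omega>. counts_eq L (u \<omega>) c)"
proof -
  have "Measurable.pred N (\<lambda>\<omega>. \<forall>i\<in>{..K}. segment_count K L (u \<omega>) i = c ! i)"
  proof (rule pred_intros_finite(3))
    fix i assume "i \<in> {..K}"
    hence [measurable]: "(\<lambda>\<omega>. segment_count K L (u \<omega>) i) \<in> measurable N (count_space UNIV)"
      using assms by (intro measurable_segment_count) auto
    show "Measurable.pred N (\<lambda>\<omega>. segment_count K L (u \<omega>) i = c ! i)" by measurable
  qed simp
  thus ?thesis by (simp only: counts_eq_def Ball_def atMost_iff)
qed

lemma segment_count_cong:
  assumes "\<And>j. j \<in> {1..K} \<union> L \<Longrightarrow> u j = v j"
  shows "segment_count K L u i = segment_count K L v i"
proof -
  have "segment K u = segment K v" using assms by (intro segment_cong) auto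
  moreover have "{l \<in> L. u l \<in> S} = {l \<in> L. v l \<in> S}" for S using assms by auto
  ultimately show ?thesis by (simp only: segment_count_def)
qed

lemma counts_eq_cong: "(\<And>j. j \<in> {1..K} \<union> L \<Longrightarrow> u j = v j) \<Longrightarrow> counts_eq L u c \<longleftrightarrow> counts_eq L v c"
  using segment_count_cong[of L u v] by (simp add: counts_eq_def)

text \<open>Every choice \<open>J\<close> of \<open>K\<close> of the \<open>N\<close> inputs as pivots yields the counts \<open>c\<close> with the same probability,
  and for almost every outcome exactly one choice does.\<close>

lemma prob_counts_eq:
  assumes "K \<le> N" "c \<in> compositions K (N - K)"
  shows "prob {\<omega> \<in> space M. counts_eq {K + 1..N} (input \<omega>) c} = 1 / real (N choose K)"
proof -
  have "N \<ge> 1" using assms K_pos by linarith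
  define \<sigma> where "\<sigma> J = (SOME \<tau>. \<tau> permutes {1..N} \<and> \<tau> ` {1..K} = J)" for J
  have \<sigma>: "\<sigma> J permutes {1..N}" "\<sigma> J ` {1..K} = J" if "J \<in> subsets_of_card {1..N} K" for J
    using someI_ex[OF ex_permutation_image[OF that]] unfolding \<sigma>_def by blast+
  define E where "E J = {\<omega> \<in> space M. counts_eq {K + 1..N} (\<lambda>l. input \<omega> (\<sigma> J l)) c}" for J
  let ?p = "prob {\<omega> \<in> space M. counts_eq {K + 1..N} (input \<omega>) c}"
  have prob_E: "prob (E J) = ?p" if J: "J \<in> subsets_of_card {1..N} K" for J
    unfolding E_def
  proof (rule prob_input_permuted[OF \<sigma>(1)[OF J] \<open>N \<ge> 1\<close>])
    show "Measurable.pred (PiM {1..N} (\<lambda>_. borel)) (\<lambda>u. counts_eq {K + 1..N} u c)"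
      using \<open>K \<le> N\<close> by (intro pred_counts_eq measurable_component_singleton) auto
    show "counts_eq {K + 1..N} u c = counts_eq {K + 1..N} v c"
      if "\<And>l. l \<in> {1..N} \<Longrightarrow> u l = v l" for u v
      using that \<open>K \<le> N\<close> by (intro counts_eq_cong) auto
  qed
  have sets_E: "E J \<in> events" if J: "J \<in> subsets_of_card {1..N} K" for J
  proof -
    have "\<sigma> J j \<ge> 1" if "j \<in> {1..K} \<union> {K + 1..N}" for j
      using that \<open>K \<le> N\<close> permutes_in_image[OF \<sigma>(1)[OF J], of j] by auto
    hence "Measurable.pred M (\<lambda>\<omega>. counts_eq {K + 1..N} (\<lambda>l. input \<omega> (\<sigma> J l)) c)"
      by (intro pred_counts_eq measurable_input)
    thus ?thesis by (simp add: E_def pred_def)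
  qed
  have "real (N choose K) * ?p = (\<Sum>J\<in>subsets_of_card {1..N} K. prob (E J))"
    by (simp add: prob_E card_subsets_of_card)
  also have "\<dots> = (\<integral>\<omega>. (\<Sum>J\<in>subsets_of_card {1..N} K. indicat_real (E J) \<omega>) \<partial>M)"
    using sets_E by (subst Bochner_Integration.integral_sum)
      (auto simp: emeasure_eq_measure intro!: sum.cong)
  also have "\<dots> = (\<integral>\<omega>. 1 \<partial>M)"
  proof (rule integral_cong_AE)
    show "(\<lambda>\<omega>. \<Sum>J\<in>subsets_of_card {1..N} K. indicat_real (E J) \<omega>) \<in> borel_measurable M"
      using sets_E by (intro borel_measurable_sum borel_measurable_indicator)
    show "AE \<omega> in M. (\<Sum>J\<in>subsets_of_card {1..N} K. indicat_real (E J) \<omega>) = 1"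
      using AE_generic[of N] AE_space
    proof eventually_elim
      case (elim \<omega>)
      define T where "T = input \<omega> ` {1..N}"
      have inj: "inj_on (input \<omega>) {1..N}" using elim(1) by (simp add: generic_def)
      have T: "finite T" "T \<subseteq> {0<..<1}" "card T = N"
        using elim(1) inj by (simp_all add: T_def generic_def card_image)
      have bij: "bij_betw ((`) (input \<omega>)) (subsets_of_card {1..N} K) (subsets_of_card T K)"
        unfolding T_def
      proof (rule bij_betw_imageI)
        show "inj_on ((`) (input \<omega>)) (subsets_of_card {1..N} K)"
          by (rule inj_on_subset[OF inj_on_image_Pow[OF inj]]) (auto simp: subsets_of_card_def)
        show "(`) (input \<omega>) ` subsets_of_card {1..N} K = subsets_of_card (input \<omega> ` {1..N}) K"
        proof (intro equalityI subsetI)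
          fix Q assume "Q \<in> (`) (input \<omega>) ` subsets_of_card {1..N} K"
          thus "Q \<in> subsets_of_card (input \<omega> ` {1..N}) K" using generic_pivots[OF elim(1)] by blast
        next
          fix Q assume Q: "Q \<in> subsets_of_card (input \<omega> ` {1..N}) K"
          then obtain J where J: "J \<subseteq> {1..N}" "Q = input \<omega> ` J"
            by (auto simp: subsets_of_card_def subset_image_iff)
          moreover have "card J = K"
            using Q J card_image[OF inj_on_subset[OF inj J(1)]] by (simp add: subsets_of_card_def)
          ultimately show "Q \<in> (`) (input \<omega>) ` subsets_of_card {1..N} K" by (auto simp: subsets_of_card_def)
        qed
      qed
      have "K \<le> card T" using T(3) assms(1) by simp
      \<comment> \<open>Composing both bijections matches the choices of pivots with the
        compositions of \<open>N - K\<close>; the composition \<open>c\<close> is therefore hit by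
        exactly one choice.\<close>
      note bij' = bij_betw_trans[OF bij bij_betw_gap_list[OF T(1,2) this], unfolded T(3) o_def]
      have "(\<Sum>J\<in>subsets_of_card {1..N} K. indicat_real (E J) \<omega>) =
          (\<Sum>J\<in>subsets_of_card {1..N} K. of_bool (map (gap T (input \<omega> ` J)) [0..<Suc K] = c))"
      proof (rule sum.cong[OF refl])
        fix J assume J: "J \<in> subsets_of_card {1..N} K"
        have "length c = Suc K" using assms(2) by (simp add: compositions_def)
        hence "counts_eq {K + 1..N} (\<lambda>l. input \<omega> (\<sigma> J l)) c \<longleftrightarrow> map (gap T (input \<omega> ` J)) [0..<Suc K] = c"
          unfolding counts_eq_def segment_count_permuted[OF elim(1) \<sigma>(1)[OF J] assms(1)] \<sigma>(2)[OF J] T_def[symmetric]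
          by (auto simp: list_eq_iff_nth_eq less_Suc_eq_le simp del: upt_Suc)
        thus "indicat_real (E J) \<omega> = of_bool (map (gap T (input \<omega> ` J)) [0..<Suc K] = c)"
          using elim(2) by (simp add: E_def indicator_def)
      qed
      also have "\<dots> = (\<Sum>c'\<in>compositions K (N - K). of_bool (c' = c))"
        using bij' by (rule sum.reindex_bij_betw)
      also have "\<dots> = 1"
        using assms(2) finite_compositions by (simp add: of_bool_def sum.delta')
      finally show ?case .
    qed
  qed simp
  also have "\<dots> = 1" by (simp add: prob_space)
  finally show ?thesis using assms(1) by (simp add: field_simps)
qed

text \<open>Exchanging the last input with the \<open>l\<close>-th one for every \<open>l > K\<close> and summing expresses
  \<open>k\<close> times this probability through the final counts, where \<open>c ! i + 1\<close> inputs lie in segment \<open>i\<close>.\<close>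

lemma prob_last_in_segment:
  assumes "k \<ge> 1" "c \<in> compositions K (k - 1)" "i \<le> K"
  shows "prob {\<omega> \<in> space M. input \<omega> (K + k) \<in> segment K (input \<omega>) i \<and>
      counts_eq {K + 1..<K + k} (input \<omega>) c} = real (c ! i + 1) / (real k * real ((K + k) choose K))"
proof -
  define N where "N = K + k"
  have N: "K + 1 \<le> N" "N \<ge> 1" using assms(1) by (auto simp: N_def)
  define \<Phi> where "\<Phi> u \<longleftrightarrow> u N \<in> segment K u i \<and> counts_eq {K + 1..<N} u c" for u
  \<comment> \<open>The counts after the last input has joined segment \<open>i\<close>; they form a
    composition of \<open>N - K = k\<close>.\<close>
  define c' where "c' = c[i := Suc (c ! i)]"
  have len: "length c = Suc K" using assms(2) by (simp add: compositions_def)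
  have "sum_list c' = Suc (sum_list c)"
    using len assms(3) elem_le_sum_list[of i c] by (simp add: c'_def sum_list_update)
  hence c': "c' \<in> compositions K (N - K)"
    using assms by (simp add: compositions_def c'_def N_def)
  define E where "E l = {\<omega> \<in> space M. \<Phi> (\<lambda>j. input \<omega> (Transposition.transpose l N j))}" for l
  define F where "F = {\<omega> \<in> space M. counts_eq {K + 1..N} (input \<omega>) c'}"
  let ?p = "prob {\<omega> \<in> space M. \<Phi> (input \<omega>)}"
  have perm: "Transposition.transpose l N permutes {1..N}" if "l \<in> {K + 1..N}" for l
    using that by (intro permutes_swap_id) auto
  have pred: "Measurable.pred L (\<lambda>\<omega>. \<Phi> (u \<omega>))"
    if "\<And>j. j \<in> {1..N} \<Longrightarrow> (\<lambda>\<omega>. u \<omega> j) \<in> borel_measurable L" for u and L :: "'x measure"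
    unfolding \<Phi>_def using that N assms(3)
    by (intro pred_intros_logic pred_counts_eq pred_in_segment) auto
  have prob_E: "prob (E l) = ?p" if l: "l \<in> {K + 1..N}" for l
    unfolding E_def
  proof (rule prob_input_permuted[OF perm[OF l] N(2)])
    show "Measurable.pred (PiM {1..N} (\<lambda>_. borel)) \<Phi>"
      by (rule pred) (rule measurable_component_singleton)
    show "\<Phi> u = \<Phi> v" if *: "\<And>l. l \<in> {1..N} \<Longrightarrow> u l = v l" for u v
    proof -
      have "segment K u = segment K v" using * N by (intro segment_cong) auto
      moreover have "counts_eq {K + 1..<N} u c = counts_eq {K + 1..<N} v c"
        using * N by (intro counts_eq_cong) auto
      ultimately show ?thesis using *[of N] N by (simp add: \<Phi>_def)
    qed
  qed
  have sets_E: "E l \<in> events" if l: "l \<in> {K + 1..N}" for l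
  proof -
    have "Transposition.transpose l N j \<ge> 1" if "j \<in> {1..N}" for j
      using that permutes_in_image[OF perm[OF l], of j] by auto
    hence "Measurable.pred M (\<lambda>\<omega>. \<Phi> (\<lambda>j. input \<omega> (Transposition.transpose l N j)))"
      by (intro pred measurable_input)
    thus ?thesis by (simp add: E_def pred_def)
  qed
  have sets_F: "F \<in> events"
  proof -
    have "Measurable.pred M (\<lambda>\<omega>. counts_eq {K + 1..N} (input \<omega>) c')"
      by (intro pred_counts_eq measurable_input) auto
    thus ?thesis by (simp add: F_def pred_def)
  qed
  have "real k * ?p = (\<Sum>l\<in>{K + 1..N}. prob (E l))"
    by (simp add: prob_E N_def)
  also have "\<dots> = (\<integral>\<omega>. (\<Sum>l\<in>{K + 1..N}. indicat_real (E l) \<omega>) \<partial>M)"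
    using sets_E by (subst Bochner_Integration.integral_sum)
      (auto simp: emeasure_eq_measure intro!: sum.cong)
  also have "\<dots> = (\<integral>\<omega>. real (c ! i + 1) * indicat_real F \<omega> \<partial>M)"
  proof (rule integral_cong_AE)
    show "(\<lambda>\<omega>. \<Sum>l\<in>{K + 1..N}. indicat_real (E l) \<omega>) \<in> borel_measurable M"
      using sets_E by (intro borel_measurable_sum borel_measurable_indicator)
    show "(\<lambda>\<omega>. real (c ! i + 1) * indicat_real F \<omega>) \<in> borel_measurable M"
      using sets_F by (intro borel_measurable_times borel_measurable_indicator) auto
    show "AE \<omega> in M. (\<Sum>l\<in>{K + 1..N}. indicat_real (E l) \<omega>) = real (c ! i + 1) * indicat_real F \<omega>"
      using AE_generic[of N] AE_space
    proof eventually_elim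
      case (elim \<omega>)
      have "indicat_real (E l) \<omega> = of_bool (input \<omega> l \<in> segment K (input \<omega>) i) * indicat_real F \<omega>"
        if l: "l \<in> {K + 1..N}" for l
      proof -
        have "\<Phi> (\<lambda>j. input \<omega> (Transposition.transpose l N j)) \<longleftrightarrow>
            input \<omega> l \<in> segment K (input \<omega>) i \<and> counts_eq {K + 1..N} (input \<omega>) c'"
          using last_in_segment_transpose_iff[OF elim(1) l assms(3) len] segment_transpose[of K l N "input \<omega>"] l
          by (simp add: \<Phi>_def counts_eq_def c'_def)
        thus ?thesis using elim(2) by (simp add: E_def F_def indicator_def)
      qed
      hence "(\<Sum>l\<in>{K + 1..N}. indicat_real (E l) \<omega>) =
          (\<Sum>l\<in>{K + 1..N}. of_bool (input \<omega> l \<in> segment K (input \<omega>) i)) * indicat_real F \<omega>"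
        by (simp add: sum_distrib_right)
      also have "(\<Sum>l\<in>{K + 1..N}. of_bool (input \<omega> l \<in> segment K (input \<omega>) i)) =
          real (segment_count K {K + 1..N} (input \<omega>) i)"
        by (simp add: segment_count_def of_bool_def sum.If_cases Int_def)
      also have "\<dots> * indicat_real F \<omega> = real (c ! i + 1) * indicat_real F \<omega>"
        using assms(3) len by (auto simp: F_def indicator_def counts_eq_def c'_def)
      finally show ?case .
    qed
  qed
  also have "\<dots> = real (c ! i + 1) * prob F" using sets_F by simp
  also have "prob F = 1 / real (N choose K)"
    unfolding F_def using N c' by (intro prob_counts_eq) auto
  finally show ?thesis using assms(1) by (simp add: N_def \<Phi>_def field_simps)
qed

end

section \<open>Expected partitioning cost\<close>

text \<open>Deleting the \<open>i\<close>-th entry leaves a composition of \<open>m - j\<close> into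
  \<open>K\<close> parts. For \<open>j > m\<close> both sides vanish; the bound
  \<open>j < K + m\<close> keeps truncated subtraction from yielding \<open>0 choose 0\<close> when
  \<open>K = 1\<close>.\<close>

lemma card_compositions_nth_eq:
  assumes "i \<le> K" "K \<ge> 1" "j < K + m"
  shows "card {c \<in> compositions K m. c ! i = j} = (K + m - 1 - j) choose (K - 1)"
proof (cases "j \<le> m")
  case True
  define L where "L = {l :: nat list. length l = K \<and> sum_list l = m - j}"
  have "bij_betw (\<lambda>l. take i l @ j # drop i l) L {c \<in> compositions K m. c ! i = j}"
  proof (rule bij_betwI[of _ _ _ "\<lambda>c. take i c @ drop (Suc i) c"])
    show "(\<lambda>l. take i l @ j # drop i l) \<in> L \<rightarrow> {c \<in> compositions K m. c ! i = j}"
    proof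
      fix l assume l: "l \<in> L"
      have "sum_list (take i l) + sum_list (drop i l) = sum_list l"
        by (metis append_take_drop_id sum_list_append)
      thus "take i l @ j # drop i l \<in> {c \<in> compositions K m. c ! i = j}"
        using l assms(1) True by (auto simp: L_def compositions_def nth_append)
    qed
    show "(\<lambda>c. take i c @ drop (Suc i) c) \<in> {c \<in> compositions K m. c ! i = j} \<rightarrow> L"
    proof
      fix c assume c: "c \<in> {c \<in> compositions K m. c ! i = j}"
      hence "i < length c" using assms(1) by (simp add: compositions_def)
      hence "sum_list (take i c) + (c ! i + sum_list (drop (Suc i) c)) = sum_list c"
        by (metis id_take_nth_drop sum_list_append sum_list.Cons)
      thus "take i c @ drop (Suc i) c \<in> L"
        using c assms(1) by (auto simp: L_def compositions_def)
    qed
  next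
    fix l assume "l \<in> L"
    thus "take i (take i l @ j # drop i l) @ drop (Suc i) (take i l @ j # drop i l) = l"
      using assms(1) by (simp add: L_def)
  next
    fix c assume "c \<in> {c \<in> compositions K m. c ! i = j}"
    hence "i < length c" "c ! i = j" using assms(1) by (auto simp: compositions_def)
    thus "take i (take i c @ drop (Suc i) c) @ j # drop i (take i c @ drop (Suc i) c) = c"
      using Cons_nth_drop_Suc[of i c] append_take_drop_id[of i c] by (simp add: min_def)
  qed
  hence "card {c \<in> compositions K m. c ! i = j} = (m - j + K - 1) choose (m - j)"
    using card_length_sum_list[of K "m - j"] by (simp add: L_def bij_betw_same_card[symmetric])
  also have "\<dots> = (m - j + K - 1) choose (K - 1)"
    using assms(2) binomial_symmetric[of "m - j" "m - j + K - 1"] by simp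
  also have "m - j + K - 1 = K + m - 1 - j" using True assms(2) by simp
  finally show ?thesis .
next
  case False
  have "c ! i \<le> m" if "c \<in> compositions K m" for c
    using that assms(1) elem_le_sum_list[of i c] by (simp add: compositions_def)
  hence "{c \<in> compositions K m. c ! i = j} = {}" using False by blast
  moreover have "(K + m - 1 - j) choose (K - 1) = 0" using False assms by (intro binomial_eq_0) auto
  ultimately show ?thesis by (simp only: card.empty)
qed

context optimal_quicksort
begin

lemma counts_eq_iff:
  "length c = Suc K \<Longrightarrow> counts_eq L u c \<longleftrightarrow> map (segment_count K L u) [0..<Suc K] = c"
  by (auto simp: counts_eq_def list_eq_iff_nth_eq less_Suc_eq_le simp del: upt_Suc)

lemma generic_counts_in_compositions:
  assumes "generic N u" "K \<le> N"
  shows "map (segment_count K {K + 1..N} u) [0..<Suc K] \<in> compositions K (N - K)"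
proof -
  have T: "finite (u ` {1..N})" "u ` {1..N} \<subseteq> {0<..<1}" "card (u ` {1..N}) = N"
    using assms(1) by (simp_all add: generic_def card_image)
  have "{1..K} \<in> subsets_of_card {1..N} K" using assms(2) by (simp add: subsets_of_card_def)
  hence "u ` {1..K} \<in> subsets_of_card (u ` {1..N}) K" by (rule generic_pivots[OF assms(1)])
  note gap_list_in_compositions[OF T(1,2) this]
  moreover have "segment_count K {K + 1..N} u = gap (u ` {1..N}) (u ` {1..K})"
    using segment_count_permuted[OF assms(1) permutes_id assms(2)] by (intro ext) simp
  ultimately show ?thesis by (simp only: T(3))
qed

lemma sublist_size_input:
  "K \<le> n \<Longrightarrow> sublist_size K (\<lambda>j. V j \<omega>) (\<lambda>k. a k \<omega>) n i = segment_count K {K + 1..n} (input \<omega>) i"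
  by (rule sublist_size_eq_segment_count) (auto simp: input_def)

lemma events_counts_eq:
  assumes "L \<subseteq> {1..}"
  shows "{\<omega> \<in> space M. counts_eq L (input \<omega>) c} \<in> events"
proof -
  have "Measurable.pred M (\<lambda>\<omega>. counts_eq L (input \<omega>) c)"
    using assms by (intro pred_counts_eq measurable_input) auto
  thus ?thesis by (simp add: pred_def)
qed

text \<open>All count vectors are equally likely, so this is the proportion of compositions whose
  \<open>i\<close>-th entry is \<open>j\<close>. The value does not depend on \<open>i\<close>,
  whence the factor \<open>K + 1\<close> in the recurrence.\<close>

lemma prob_sublist_size:
  assumes "i \<le> K" "K \<le> n" "j < n"
  shows "prob {\<omega> \<in> space M. sublist_size K (\<lambda>j. V j \<omega>) (\<lambda>k. a k \<omega>) n i = j} =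
    real ((n - 1 - j) choose (K - 1)) / real (n choose K)"
proof -
  define E where "E c = {\<omega> \<in> space M. counts_eq {K + 1..n} (input \<omega>) c}" for c
  define F where "F = {\<omega> \<in> space M. segment_count K {K + 1..n} (input \<omega>) i = j}"
  have E: "E c \<in> events" for c unfolding E_def by (rule events_counts_eq) auto
  have "(\<lambda>\<omega>. segment_count K {K + 1..n} (input \<omega>) i) \<in> measurable M (count_space UNIV)"
    using assms(1) by (intro measurable_segment_count measurable_input) auto
  hence F: "F \<in> events" unfolding F_def by measurable
  have "prob F = (\<integral>\<omega>. indicat_real F \<omega> \<partial>M)" using F by simp
  also have "\<dots> = (\<integral>\<omega>. (\<Sum>c\<in>compositions K (n - K). of_bool (c ! i = j) * indicat_real (E c) \<omega>) \<partial>M)"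
  proof (rule integral_cong_AE)
    show "(\<lambda>\<omega>. \<Sum>c\<in>compositions K (n - K). of_bool (c ! i = j) * indicat_real (E c) \<omega>) \<in> borel_measurable M"
      using E by (intro borel_measurable_sum borel_measurable_times borel_measurable_indicator) auto
    show "AE \<omega> in M. indicat_real F \<omega> = (\<Sum>c\<in>compositions K (n - K). of_bool (c ! i = j) * indicat_real (E c) \<omega>)"
      using AE_generic[of n] AE_space
    proof eventually_elim
      case (elim \<omega>)
      define c0 where "c0 = map (segment_count K {K + 1..n} (input \<omega>)) [0..<Suc K]"
      have c0: "c0 \<in> compositions K (n - K)"
        unfolding c0_def by (rule generic_counts_in_compositions[OF elim(1) assms(2)])
      have "(\<Sum>c\<in>compositions K (n - K). of_bool (c ! i = j) * indicat_real (E c) \<omega>) =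
          (\<Sum>c\<in>compositions K (n - K). if c0 = c then of_bool (c ! i = j) else 0)"
      proof (rule sum.cong[OF refl])
        fix c assume "c \<in> compositions K (n - K)"
        hence "length c = Suc K" by (simp add: compositions_def)
        thus "of_bool (c ! i = j) * indicat_real (E c) \<omega> = (if c0 = c then of_bool (c ! i = j) else 0)"
          using elim(2) by (simp add: E_def c0_def counts_eq_iff indicator_def del: upt_Suc)
      qed
      also have "\<dots> = of_bool (c0 ! i = j)" using c0 finite_compositions by (simp add: sum.delta')
      also have "\<dots> = indicat_real F \<omega>"
        using elim(2) assms(1) by (simp add: F_def c0_def indicator_def del: upt_Suc)
      finally show ?case ..
    qed
  qed (use F in auto)
  also have "\<dots> = (\<Sum>c\<in>compositions K (n - K). of_bool (c ! i = j) * prob (E c))"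
    using E by (subst Bochner_Integration.integral_sum) (auto simp: emeasure_eq_measure)
  also have "\<dots> = (\<Sum>c\<in>compositions K (n - K). of_bool (c ! i = j)) / real (n choose K)"
    using prob_counts_eq[OF assms(2)] by (simp add: E_def sum_divide_distrib)
  also have "(\<Sum>c\<in>compositions K (n - K). of_bool (c ! i = j)) = real (card {c \<in> compositions K (n - K). c ! i = j})"
    using finite_compositions by (simp add: of_bool_def sum.If_cases Int_def)
  also have "\<dots> = real ((n - 1 - j) choose (K - 1))"
    using card_compositions_nth_eq[OF assms(1) K_pos, of j "n - K"] assms by simp
  finally show ?thesis by (simp add: F_def sublist_size_input[OF assms(2)])
qed

text \<open>Plays two roles: for \<open>N = K + k\<close> it is the expected cost of classifying the
  \<open>k\<close>-th element, and for large \<open>N\<close> it is a discretisation of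
  \<open>\<gamma>\<close>.\<close>

definition grid_avg :: "nat \<Rightarrow> real" where
  "grid_avg N = (\<Sum>Q\<in>subsets_of_card (grid N) K. pivots_cost K Q) /
     real ((N - 1) choose K)"

definition next_in_segment :: "nat \<Rightarrow> nat list \<Rightarrow> nat \<Rightarrow> 'a set" where
  "next_in_segment k c i = {\<omega> \<in> space M. input \<omega> (K + k) \<in> segment K (input \<omega>) i \<and>
      counts_eq {K + 1..<K + k} (input \<omega>) c}"

definition element_cost :: "nat \<Rightarrow> 'a \<Rightarrow> nat" where
  "element_cost k \<omega> = (\<Sum>t \<in> classification_trees K. \<Sum>i\<le>K.
        of_bool (classified_using K r (\<lambda>j. V j \<omega>) (\<lambda>k. a k \<omega>) t k) *
        of_bool (a k \<omega> \<in> segment K (\<lambda>j. V j \<omega>) i) * leaf_depth t i)"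

text \<open>For given counts the chosen tree is deterministic. Rewriting the cost as a finite
  combination of indicators allows termwise integration.\<close>

definition last_cost :: "nat \<Rightarrow> 'a \<Rightarrow> real" where
  "last_cost k \<omega> = (\<Sum>i\<le>K. \<Sum>c\<in>compositions K (k - 1).
     real (leaf_depth (chosen_tree K r (\<lambda>i. real (c ! i) + 1)) i) *
     indicator (next_in_segment k c i) \<omega>)"

text \<open>Without ties the counts form exactly one composition \<open>c0\<close>, so only the
  terms with \<open>c = c0\<close> survive, and these use the tree actually chosen.\<close>

lemma AE_last_cost:
  assumes "k \<ge> 1"
  shows "AE \<omega> in M. real (element_cost k \<omega>) = last_cost k \<omega>"
  using AE_generic[of "K + (k - 1)"] AE_space
proof eventually_elim
  case (elim \<omega>)
  define c0 where "c0 = map (segment_count K {K + 1..<K + k} (input \<omega>)) [0..<Suc K]"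
  have "{K + 1..<K + k} = {K + 1..K + (k - 1)}" using assms by auto
  hence c0: "c0 \<in> compositions K (k - 1)"
    using generic_counts_in_compositions[OF elim(1)] by (simp add: c0_def del: upt_Suc)
  define t0 where "t0 = chosen_tree K r (\<lambda>i. real (c0 ! i) + 1)"
  have t0: "t0 \<in> classification_trees K"
    unfolding t0_def by (rule chosen_tree_optimal(1)[OF tie_order])
  have before: "classified_before K (\<lambda>j. V j \<omega>) (\<lambda>k. a k \<omega>) k i = c0 ! i" if "i \<le> K" for i
    using that assms
    by (subst classified_before_eq_segment_count[of K "input \<omega>"])
       (auto simp: input_def c0_def simp del: upt_Suc)
  have using_iff: "classified_using K r (\<lambda>j. V j \<omega>) (\<lambda>k. a k \<omega>) t k \<longleftrightarrow> t = t0" for t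
    unfolding classified_using_def t0_def
    using chosen_tree_cong[of K "\<lambda>i. real (classified_before K (\<lambda>j. V j \<omega>) (\<lambda>k. a k \<omega>) k i) + 1" "\<lambda>i. real (c0 ! i) + 1" r] before
    by simp
  have seg: "segment K (\<lambda>j. V j \<omega>) = segment K (input \<omega>)" by (rule segment_cong) (simp add: input_def)
  have last: "a k \<omega> = input \<omega> (K + k)" using assms by (simp add: input_def)
  have "element_cost k \<omega> =
      (\<Sum>t \<in> classification_trees K. if t = t0 then
         (\<Sum>i\<le>K. of_bool (input \<omega> (K + k) \<in> segment K (input \<omega>) i) * leaf_depth t i) else 0)"
    unfolding element_cost_def using_iff seg last by (intro sum.cong refl) auto
  also have "\<dots> = (\<Sum>i\<le>K. of_bool (input \<omega> (K + k) \<in> segment K (input \<omega>) i) * leaf_depth t0 i)"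
    using t0 finite_classification_trees by (subst sum.delta) auto
  finally have "real (element_cost k \<omega>) =
      real (\<Sum>i\<le>K. of_bool (input \<omega> (K + k) \<in> segment K (input \<omega>) i) * leaf_depth t0 i)"
    by (rule arg_cong)
  also have "\<dots> = (\<Sum>i\<le>K. of_bool (input \<omega> (K + k) \<in> segment K (input \<omega>) i) * real (leaf_depth t0 i))"
    by simp
  also have "\<dots> = last_cost k \<omega>"
    unfolding last_cost_def
  proof (rule sum.cong[OF refl])
    fix i
    let ?s = "input \<omega> (K + k) \<in> segment K (input \<omega>) i"
    let ?S = "(\<Sum>c\<in>compositions K (k - 1). real (leaf_depth (chosen_tree K r (\<lambda>i. real (c ! i) + 1)) i) *
        indicator (next_in_segment k c i) \<omega>)"
    have "?S =
      (\<Sum>c\<in>compositions K (k - 1). if c0 = c then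
        of_bool ?s * real (leaf_depth (chosen_tree K r (\<lambda>i. real (c ! i) + 1)) i) else 0)"
    proof (rule sum.cong[OF refl])
      fix c assume "c \<in> compositions K (k - 1)"
      hence "length c = Suc K" by (simp add: compositions_def)
      thus "real (leaf_depth (chosen_tree K r (\<lambda>i. real (c ! i) + 1)) i) *
        indicator (next_in_segment k c i) \<omega> = (if c0 = c then
        of_bool ?s * real (leaf_depth (chosen_tree K r (\<lambda>i. real (c ! i) + 1)) i) else 0)"
        using elim(2) by (simp add: next_in_segment_def c0_def counts_eq_iff indicator_def del: upt_Suc)
    qed
    also have "\<dots> = of_bool ?s * real (leaf_depth t0 i)"
      using c0 finite_compositions by (simp add: sum.delta' t0_def)
    finally show "of_bool ?s * real (leaf_depth t0 i) = ?S" ..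
  qed
  finally show ?case .
qed

lemma last_cost_events:
  assumes "k \<ge> 1" "i \<le> K"
  shows "next_in_segment k c i \<in> events"
proof -
  have "Measurable.pred M (\<lambda>\<omega>. input \<omega> (K + k) \<in> segment K (input \<omega>) i \<and> counts_eq {K + 1..<K + k} (input \<omega>) c)"
    using assms by (intro pred_intros_logic pred_counts_eq pred_in_segment measurable_input) auto
  thus ?thesis by (simp add: next_in_segment_def pred_def)
qed

lemma integrable_last_cost:
  assumes "k \<ge> 1"
  shows "integrable M (last_cost k)"
  unfolding last_cost_def [abs_def]
  using last_cost_events[OF assms]
  by (intro Bochner_Integration.integrable_sum integrable_mult_right integrable_real_indicator)
     (auto simp: emeasure_eq_measure)

text \<open>Given the counts \<open>c\<close>, the next element falls into segment \<open>i\<close> with probability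
  proportional to \<open>c ! i + 1\<close>, which is exactly the weight that the chosen tree minimises.\<close>

lemma expectation_last_cost:
  assumes "k \<ge> 1"
  shows "expectation (last_cost k) = grid_avg (K + k)"
proof -
  define C where "C = real k * real ((K + k) choose K)"
  \<comment> \<open>Binomial absorption turns the denominator of \<open>prob_last_in_segment\<close>
    into the factor of \<open>sum_opt_cost_compositions\<close> times the number of
    \<open>K\<close>-subsets of the grid.\<close>
  have C: "C = real (K + k) * real ((K + k - 1) choose K)"
  proof -
    have "k * ((K + k) choose K) = (K + k) * ((K + k - 1) choose K)"
      using binomial_absorb_comp[of "K + k" K] by simp
    hence "real (k * ((K + k) choose K)) = real ((K + k) * ((K + k - 1) choose K))" by (rule arg_cong)
    thus ?thesis by (simp only: C_def of_nat_mult)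
  qed
  have "expectation (last_cost k) = (\<Sum>i\<le>K. \<Sum>c\<in>compositions K (k - 1).
     real (leaf_depth (chosen_tree K r (\<lambda>i. real (c ! i) + 1)) i) *
     prob (next_in_segment k c i))"
    unfolding last_cost_def [abs_def] using last_cost_events[OF assms]
    by (subst Bochner_Integration.integral_sum;
        (intro Bochner_Integration.integrable_sum integrable_mult_right integrable_real_indicator sum.cong refl)?;
        (subst Bochner_Integration.integral_sum)?) (auto simp: emeasure_eq_measure)
  also have "\<dots> = (\<Sum>i\<le>K. \<Sum>c\<in>compositions K (k - 1).
     real (leaf_depth (chosen_tree K r (\<lambda>i. real (c ! i) + 1)) i) * (real (c ! i + 1) / C))"
    using prob_last_in_segment[OF assms] by (intro sum.cong refl) (simp add: C_def next_in_segment_def)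
  also have "\<dots> = (\<Sum>c\<in>compositions K (k - 1). \<Sum>i\<le>K.
     real (leaf_depth (chosen_tree K r (\<lambda>i. real (c ! i) + 1)) i) * (real (c ! i + 1) / C))"
    by (rule sum.swap)
  also have "\<dots> = (\<Sum>c\<in>compositions K (k - 1).
      tree_cost K (chosen_tree K r (\<lambda>i. real (c ! i) + 1)) (\<lambda>i. real (c ! i) + 1) / C)"
    by (simp add: tree_cost_def sum_divide_distrib mult_ac add_ac)
  also have "\<dots> = (\<Sum>c\<in>compositions K (k - 1). opt_cost K (\<lambda>i. real (c ! i) + 1)) / C"
    by (simp add: chosen_tree_optimal(2)[OF tie_order] sum_divide_distrib)
  also have "\<dots> = grid_avg (K + k)"
    unfolding sum_opt_cost_compositions[OF assms] C grid_avg_def using assms by simp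
  finally show ?thesis .
qed

end

section \<open>Rounding the pivots to a grid\<close>

lemma sort_map_mono:
  assumes "mono f"
  shows "sort (map f xs) = map f (sort xs)"
proof (rule properties_for_sort)
  show "mset (map f (sort xs)) = mset (map f xs)" by simp
  show "sorted (map f (sort xs))"
    using sorted_sort[of xs] assms by (simp only: sorted_iff_nth_mono length_map nth_map) (auto dest: monoD)
qed

text \<open>A monotone map commutes with sorting. The indices 0 and \<open>K + 1\<close> are
  excluded because the boundary values 0 and 1 are not mapped.\<close>

lemma sorted_pivot_map:
  assumes "mono f" "i \<in> {1..K}"
  shows "sorted_pivot K (\<lambda>j. f (v j)) i = f (sorted_pivot K v i)"
proof -
  obtain i' where i': "i = Suc i'" "i' < K" using assms(2) by (cases i) auto
  have "map (\<lambda>j. f (v j)) [1..<Suc K] = map f (map v [1..<Suc K])" by (simp del: upt_Suc)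
  hence "sort (map (\<lambda>j. f (v j)) [1..<Suc K]) = map f (sort (map v [1..<Suc K]))"
    by (simp only: sort_map_mono[OF assms(1)])
  thus ?thesis using i' by (simp add: sorted_pivot_def nth_append del: upt_Suc)
qed

lemma sorted_pivot_in_image:
  assumes "i \<in> {1..K}"
  shows "sorted_pivot K v i \<in> v ` {1..K}"
proof -
  obtain i' where i': "i = Suc i'" "i' < K" using assms by (cases i) auto
  have "sort (map v [1..<Suc K]) ! i' \<in> set (sort (map v [1..<Suc K]))"
    using i' by (intro nth_mem) simp
  also have "\<dots> = v ` {1..K}" by (auto simp del: upt_Suc)
  finally show ?thesis using i' by (simp add: sorted_pivot_def nth_append del: upt_Suc)
qed

lemma spacing_nonneg:
  assumes "v ` {1..K} \<subseteq> {0..1}" "i \<le> K"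
  shows "0 \<le> spacing K v i"
proof -
  have "sorted (0 # sort (map v [1..<Suc K]) @ [1])"
    using assms(1) by (auto simp: sorted_append image_subset_iff simp del: upt_Suc)
  hence "(0 # sort (map v [1..<Suc K]) @ [1]) ! i \<le> (0 # sort (map v [1..<Suc K]) @ [1]) ! Suc i"
    using assms(2) by (intro sorted_nth_mono) auto
  thus ?thesis by (simp add: spacing_def sorted_pivot_def del: upt_Suc)
qed

lemma sum_spacing: "(\<Sum>i\<le>K. spacing K v i) = 1"
  unfolding spacing_def lessThan_Suc_atMost[symmetric]
  by (simp only: sum_lessThan_telescope sorted_pivot_0 sorted_pivot_last diff_0_right)

lemma opt_cost_spacing_bounds:
  assumes "v ` {1..K} \<subseteq> {0..1}"
  shows "0 \<le> opt_cost K (spacing K v)" "opt_cost K (spacing K v) \<le> real K"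
  using opt_cost_nonneg_le[of K "spacing K v" 1] spacing_nonneg[OF assms] sum_spacing[of K v] by simp_all

text \<open>By monotonicity each sorted pivot moves by at most \<open>\<epsilon>\<close> and each
  spacing by at most \<open>2 * \<epsilon>\<close>, even if rounding makes pivots coincide.\<close>

lemma opt_cost_spacing_round:
  assumes "mono f" "\<And>j. j \<in> {1..K} \<Longrightarrow> \<bar>f (v j) - v j\<bar> \<le> \<epsilon>" "\<epsilon> \<ge> 0"
  shows "\<bar>opt_cost K (spacing K (\<lambda>j. f (v j))) - opt_cost K (spacing K v)\<bar> \<le> real (K + 1) * real K * (2 * \<epsilon>)"
proof (rule opt_cost_diff_le)
  have *: "\<bar>sorted_pivot K (\<lambda>j. f (v j)) i - sorted_pivot K v i\<bar> \<le> \<epsilon>" if i: "i \<le> Suc K" for i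
  proof -
    consider "i = 0" | "i = Suc K" | "i \<in> {1..K}" using i by force
    thus ?thesis
    proof cases
      case 3
      obtain j where "j \<in> {1..K}" "sorted_pivot K v i = v j" using sorted_pivot_in_image[OF 3] by blast
      thus ?thesis using assms(2) by (simp add: sorted_pivot_map[OF assms(1) 3])
    qed (use assms(3) in \<open>simp_all add: sorted_pivot_0 sorted_pivot_last\<close>)
  qed
  fix i assume "i \<le> K"
  thus "\<bar>spacing K (\<lambda>j. f (v j)) i - spacing K v i\<bar> \<le> 2 * \<epsilon>"
    using *[of i] *[of "Suc i"] unfolding spacing_def by linarith
qed

text \<open>Defined on tuples, with repetitions allowed, because several pivots may be rounded to
  the same grid point.\<close>

definition grid_cost :: "nat \<Rightarrow> nat \<Rightarrow> (nat \<Rightarrow> nat) \<Rightarrow> real" where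
  "grid_cost K N w = opt_cost K (spacing K (\<lambda>j. real (w j) / real N))"

text \<open>Grouping by image, every \<open>K\<close>-subset of the grid arises from
  \<open>K!\<close> injective tuples of equal cost.\<close>

lemma sum_grid_cost_inj:
  assumes "N \<ge> 1"
  shows "(\<Sum>w | w \<in> {1..K} \<rightarrow>\<^sub>E {1..<N} \<and> inj_on w {1..K}. grid_cost K N w) =
    fact K * (\<Sum>Q\<in>subsets_of_card (grid N) K. pivots_cost K Q)"
proof -
  define W where "W = pivots_cost K"
  define A where "A = {w. w \<in> {1..K} \<rightarrow>\<^sub>E {1..<N} \<and> inj_on w {1..K}}"
  define h where "h l = real l / real N" for l
  have inj: "inj h" using assms by (auto simp: inj_def h_def)
  have "finite A" unfolding A_def by (rule finite_subset[of _ "{1..K} \<rightarrow>\<^sub>E {1..<N}"]) (auto intro: finite_PiE)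
  have img: "(\<lambda>w. w ` {1..K}) ` A \<subseteq> subsets_of_card {1..<N} K"
    by (auto simp: A_def subsets_of_card_def card_image)
  have "(\<Sum>w\<in>A. grid_cost K N w) =
      (\<Sum>S\<in>subsets_of_card {1..<N} K. \<Sum>w | w \<in> A \<and> w ` {1..K} = S. grid_cost K N w)"
    by (rule sum.group[OF \<open>finite A\<close> finite_subsets_of_card img, symmetric]) simp
  also have "\<dots> = (\<Sum>S\<in>subsets_of_card {1..<N} K. fact K * W (h ` S))"
  proof (rule sum.cong[OF refl])
    fix S assume "S \<in> subsets_of_card {1..<N} K"
    hence S: "S \<subseteq> {1..<N}" "card S = K" "finite S"
      by (auto simp: subsets_of_card_def intro: finite_subset)
    have eq: "{w. w \<in> A \<and> w ` {1..K} = S} = {w \<in> {1..K} \<rightarrow>\<^sub>E S. inj_on w {1..K}}"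
    proof (intro equalityI subsetI)
      fix w assume "w \<in> {w \<in> {1..K} \<rightarrow>\<^sub>E S. inj_on w {1..K}}"
      hence w: "w \<in> {1..K} \<rightarrow>\<^sub>E S" "inj_on w {1..K}" by auto
      have "w ` {1..K} = S"
        using w S by (intro card_subset_eq) (auto simp: card_image)
      moreover have "w \<in> {1..K} \<rightarrow>\<^sub>E {1..<N}" using w S(1) by (auto simp: PiE_iff)
      ultimately show "w \<in> {w. w \<in> A \<and> w ` {1..K} = S}" using w by (simp add: A_def)
    qed (auto simp: A_def PiE_iff)
    have "(\<Sum>w | w \<in> A \<and> w ` {1..K} = S. grid_cost K N w) = (\<Sum>w | w \<in> A \<and> w ` {1..K} = S. W (h ` S))"
    proof (rule sum.cong[OF refl])
      fix w assume w: "w \<in> {w. w \<in> A \<and> w ` {1..K} = S}"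
      have "inj_on (\<lambda>j. h (w j)) {1..K}"
      proof (rule inj_onI)
        fix j j' assume j: "j \<in> {1..K}" "j' \<in> {1..K}" "h (w j) = h (w j')"
        from inj j(3) have "w j = w j'" by (rule injD)
        moreover have "inj_on w {1..K}" using w by (simp add: A_def)
        ultimately show "j = j'" using j by (auto dest: inj_onD)
      qed
      moreover have "(\<lambda>j. h (w j)) ` {1..K} = h ` S" using w by (auto simp: image_image)
      ultimately have "spacing K (\<lambda>j. h (w j)) i = cut_point (h ` S) (Suc i) - cut_point (h ` S) i" for i
        by (simp only: spacing_def sorted_pivot_eq_cut)
      thus "grid_cost K N w = W (h ` S)" unfolding grid_cost_def W_def h_def [symmetric] by (intro opt_cost_cong)
    qed
    also have "\<dots> = real (card {w \<in> {1..K} \<rightarrow>\<^sub>E S. inj_on w {1..K}}) * W (h ` S)"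
      unfolding eq by simp
    also have "card {w \<in> {1..K} \<rightarrow>\<^sub>E S. inj_on w {1..K}} = fact K"
    proof -
      have "card {w \<in> {1..K} \<rightarrow>\<^sub>E S. inj_on w {1..K}} =
          card S ^ (card {1..K} - card {1..K}) * prod ((-) (card S)) {0..<card {1..K}}"
        using S(3) by (intro card_inj_on_subset_funcset) auto
      also have "\<dots> = prod ((-) K) {0..<K}" using S(2) by simp
      also have "\<dots> = fact K" unfolding fact_prod_rev by simp
      finally show ?thesis .
    qed
    finally show "(\<Sum>w | w \<in> A \<and> w ` {1..K} = S. grid_cost K N w) = fact K * W (h ` S)" by simp
  qed
  also have "\<dots> = fact K * (\<Sum>S\<in>subsets_of_card {1..<N} K. W (h ` S))" by (simp add: sum_distrib_left)
  also have "(\<Sum>S\<in>subsets_of_card {1..<N} K. W (h ` S)) = (\<Sum>Q\<in>subsets_of_card (grid N) K. W Q)"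
  proof (rule sum.reindex_bij_betw, rule bij_betw_imageI)
    show "inj_on ((`) h) (subsets_of_card {1..<N} K)"
      by (rule inj_onI) (use inj in \<open>simp add: inj_image_eq_iff\<close>)
    have *: "grid N = h ` {1..<N}" by (simp add: grid_def h_def)
    show "(`) h ` subsets_of_card {1..<N} K = subsets_of_card (grid N) K"
    proof (intro equalityI subsetI)
      fix Q assume "Q \<in> (`) h ` subsets_of_card {1..<N} K"
      thus "Q \<in> subsets_of_card (grid N) K"
        unfolding * subsets_of_card_def using card_image[OF inj_on_subset[OF inj subset_UNIV]] by auto
    next
      fix Q assume "Q \<in> subsets_of_card (grid N) K"
      then obtain S where "S \<subseteq> {1..<N}" "Q = h ` S" "card Q = K"
        unfolding * subsets_of_card_def by (auto simp: subset_image_iff)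
      thus "Q \<in> (`) h ` subsets_of_card {1..<N} K"
        using card_image[OF inj_on_subset[OF inj subset_UNIV], of S] by (auto simp: subsets_of_card_def)
    qed
  qed
  finally show ?thesis by (simp add: A_def W_def)
qed

text \<open>A birthday estimate: the injective tuples form the fraction
  \<open>\<Prod>i<K. 1 - i / n\<close> of all tuples, which the Weierstrass product inequality
  bounds from below.\<close>

lemma inj_tuples_fraction:
  assumes "K \<le> n" "n \<ge> 1"
  shows "1 - real K * real K / real n \<le> fact K * real (n choose K) / real n ^ K"
    and "fact K * real (n choose K) / real n ^ K \<le> 1"
    and "real (card {w. w \<in> {1..K} \<rightarrow>\<^sub>E {1..<Suc n} \<and> inj_on w {1..K}}) = fact K * real (n choose K)"
proof -
  have prod: "fact K * real (n choose K) = (\<Prod>i=0..<K. real n - real i)"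
    by (simp add: binomial_gbinomial gbinomial_prod_rev)
  have "fact K * real (n choose K) / real n ^ K = (\<Prod>i=0..<K. real n - real i) / (\<Prod>i=0..<K. real n)"
    by (simp add: prod)
  also have "\<dots> = (\<Prod>i=0..<K. 1 - real i / real n)"
    unfolding prod_dividef [symmetric] using assms(2) by (intro prod.cong refl) (simp add: diff_divide_distrib)
  finally have eq: "fact K * real (n choose K) / real n ^ K = (\<Prod>i=0..<K. 1 - real i / real n)" .
  have frac: "real i / real n \<in> {0..1}" if "i \<in> {0..<K}" for i using that assms by auto
  have "1 - real K * real K / real n \<le> 1 - (\<Sum>i=0..<K. real i / real n)"
  proof -
    have "(\<Sum>i=0..<K. real i / real n) \<le> (\<Sum>i=0..<K. real K / real n)"
      by (intro sum_mono divide_right_mono) auto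
    thus ?thesis by simp
  qed
  also have "\<dots> \<le> (\<Prod>i=0..<K. 1 - real i / real n)"
    by (rule Weierstrass_prod_ineq[OF frac])
  finally show "1 - real K * real K / real n \<le> fact K * real (n choose K) / real n ^ K" by (simp add: eq)
  show "fact K * real (n choose K) / real n ^ K \<le> 1"
    unfolding eq using frac by (intro prod_le_1) auto
  have "card {w. w \<in> {1..K} \<rightarrow>\<^sub>E {1..<Suc n} \<and> inj_on w {1..K}} = (\<Prod>i=0..<K. n - i)"
    using card_inj_on_subset_funcset[of "{1..K}" "{1..<Suc n}" "{1..K}"] by simp
  also have "real \<dots> = (\<Prod>i=0..<K. real n - real i)"
    unfolding of_nat_prod using assms by (intro prod.cong refl) (auto simp: of_nat_diff)
  finally show "real (card {w. w \<in> {1..K} \<rightarrow>\<^sub>E {1..<Suc n} \<and> inj_on w {1..K}}) = fact K * real (n choose K)"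
    by (simp add: prod)
qed

lemma nat_ceiling_eq_iff:
  assumes "w \<ge> 1"
  shows "nat \<lceil>x\<rceil> = w \<longleftrightarrow> x \<in> {real w - 1<..real w}"
proof -
  have "nat \<lceil>x\<rceil> = w \<longleftrightarrow> \<lceil>x\<rceil> = int w" using assms by auto
  also have "\<dots> \<longleftrightarrow> x \<in> {real w - 1<..real w}" by (auto simp: ceiling_eq_iff)
  finally show ?thesis .
qed

lemma measurable_opt_cost:
  assumes "\<And>i. i \<le> K \<Longrightarrow> (\<lambda>\<omega>. x \<omega> i) \<in> borel_measurable M"
  shows "(\<lambda>\<omega>. opt_cost K (x \<omega>)) \<in> borel_measurable M"
  unfolding opt_cost_def tree_cost_def using assms finite_classification_trees
  by (intro borel_measurable_Min borel_measurable_sum borel_measurable_times) auto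

context optimal_quicksort
begin

text \<open>The ceiling cuts the unit interval into \<open>n\<close> cells of length
  \<open>1 / n\<close>, so by independence the tuple of cell numbers is uniform.\<close>

lemma prob_rounded_pivots:
  assumes "n \<ge> 1" "w \<in> {1..K} \<rightarrow>\<^sub>E {1..<Suc n}"
  shows "{\<omega> \<in> space M. \<forall>j\<in>{1..K}. nat \<lceil>real n * V j \<omega>\<rceil> = w j} \<in> events"
    and "prob {\<omega> \<in> space M. \<forall>j\<in>{1..K}. nat \<lceil>real n * V j \<omega>\<rceil> = w j} = 1 / real n ^ K"
proof -
  define I where "I j = {(real (w j) - 1) / real n<..real (w j) / real n}" for j
  have mem: "nat \<lceil>real n * x\<rceil> = w j \<longleftrightarrow> x \<in> I j" if "j \<in> {1..K}" for j x
  proof -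
    have "w j \<ge> 1" using assms(2) that by auto
    thus ?thesis using assms(1) by (auto simp: nat_ceiling_eq_iff I_def field_simps)
  qed
  have V_meas: "V j \<in> borel_measurable M" if "j \<in> {1..K}" for j
    using measurable_input[of j] that by (simp add: input_def)
  have eq: "{\<omega> \<in> space M. \<forall>j\<in>{1..K}. nat \<lceil>real n * V j \<omega>\<rceil> = w j} =
      (\<Inter>i\<in>Inl ` {1..K}. case_sum V a i -` (case_sum I (\<lambda>_. {})) i \<inter> space M)"
    using mem K_pos by (auto simp: Bex_def)
  have "(\<Inter>i\<in>Inl ` {1..K}. case_sum V a i -` (case_sum I (\<lambda>_. {})) i \<inter> space M) \<in> events"
  proof (rule sets.finite_INT)
    fix i :: "nat + nat" assume "i \<in> Inl ` {1..K}"
    then obtain j where j: "j \<in> {1..K}" "i = Inl j" by blast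
    have "I j \<in> sets borel" by (simp add: I_def)
    thus "case_sum V a i -` (case_sum I (\<lambda>_. {})) i \<inter> space M \<in> events"
      using measurable_sets[OF V_meas[OF j(1)]] j by simp
  qed (use K_pos in auto)
  thus "{\<omega> \<in> space M. \<forall>j\<in>{1..K}. nat \<lceil>real n * V j \<omega>\<rceil> = w j} \<in> events"
    by (simp only: eq)
  have "prob (\<Inter>i\<in>Inl ` {1..K}. case_sum V a i -` (case_sum I (\<lambda>_. {})) i \<inter> space M) =
      (\<Prod>i\<in>Inl ` {1..K}. prob (case_sum V a i -` (case_sum I (\<lambda>_. {})) i \<inter> space M))"
    using K_pos by (intro indep_varsD[OF indep_input]) (auto simp: I_def)
  also have "\<dots> = (\<Prod>j\<in>{1..K}. prob (V j -` I j \<inter> space M))"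
    by (subst prod.reindex) auto
  also have "\<dots> = (\<Prod>j\<in>{1..K}. 1 / real n)"
  proof (rule prod.cong[OF refl])
    fix j assume j: "j \<in> {1..K}"
    have w: "1 \<le> w j" "w j \<le> n" using assms(2) j by (force simp: PiE_iff)+
    have "prob (V j -` I j \<inter> space M) = measure (distr M borel (V j)) (I j)"
      using V_meas[OF j] by (subst measure_distr) (auto simp: I_def)
    also have "\<dots> = measure lborel ({0..1} \<inter> I j)"
      using uniform_V[OF j] by (simp add: measure_uniform_measure I_def)
    also have "{0..1} \<inter> I j = I j"
    proof -
      have "0 \<le> (real (w j) - 1) / real n" "real (w j) / real n \<le> 1"
        using w assms(1) by auto
      thus ?thesis unfolding I_def by force
    qed
    also have "measure lborel (I j) = 1 / real n"
      unfolding I_def using assms(1) by (subst measure_lborel_Ioc) (auto simp: divide_right_mono diff_divide_distrib)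
    finally show "prob (V j -` I j \<inter> space M) = 1 / real n" .
  qed
  also have "\<dots> = 1 / real n ^ K" by (simp add: power_one_over)
  finally show "prob {\<omega> \<in> space M. \<forall>j\<in>{1..K}. nat \<lceil>real n * V j \<omega>\<rceil> = w j} = 1 / real n ^ K"
    by (simp only: eq)
qed

text \<open>A coupling: the pivots and their rounded versions live on the same space, and the
  optimal costs of the two differ by a deterministic O(1/n).\<close>

lemma mean_opt_cost_near_grid_mean:
  assumes "n \<ge> 1"
  shows "\<bar>mean_opt_cost M K V - (\<Sum>w\<in>{1..K} \<rightarrow>\<^sub>E {1..<Suc n}. grid_cost K (Suc n) w) / real n ^ K\<bar>
    \<le> real (K + 1) * real K * (2 / real n)"
proof -
  define A where "A = {1..K} \<rightarrow>\<^sub>E {1..<Suc n}"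
  define E where "E w = {\<omega> \<in> space M. \<forall>j\<in>{1..K}. nat \<lceil>real n * V j \<omega>\<rceil> = w j}" for w
  define f where "f \<omega> = opt_cost K (spacing K (\<lambda>j. V j \<omega>))" for \<omega>
  define g where "g \<omega> = (\<Sum>w\<in>A. grid_cost K (Suc n) w * indicat_real (E w) \<omega>)" for \<omega>
  define \<epsilon> where "\<epsilon> = real (K + 1) * real K * (2 / real n)"
  have "finite A" unfolding A_def by (intro finite_PiE) auto
  have E: "E w \<in> events" "prob (E w) = 1 / real n ^ K" if "w \<in> A" for w
    using prob_rounded_pivots[OF assms] that by (simp_all add: E_def A_def)
  have g: "integrable M g" "expectation g = (\<Sum>w\<in>A. grid_cost K (Suc n) w) / real n ^ K"
  proof -
    have int: "integrable M (\<lambda>\<omega>. grid_cost K (Suc n) w * indicat_real (E w) \<omega>)" if "w \<in> A" for w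
      using E[OF that] by (intro integrable_mult_right integrable_real_indicator) (auto simp: emeasure_eq_measure)
    show "integrable M g" unfolding g_def [abs_def] by (intro Bochner_Integration.integrable_sum int)
    show "expectation g = (\<Sum>w\<in>A. grid_cost K (Suc n) w) / real n ^ K"
      unfolding g_def [abs_def] using int E
      by (subst Bochner_Integration.integral_sum) (auto simp: sum_divide_distrib)
  qed
  have interior: "AE \<omega> in M. (\<lambda>j. V j \<omega>) ` {1..K} \<subseteq> {0<..<1}"
    using AE_generic[of K]
  proof eventually_elim
    case (elim \<omega>)
    have "(\<lambda>j. V j \<omega>) ` {1..K} = input \<omega> ` {1..K}" by (rule image_cong) (auto simp: input_def)
    with elim show ?case by (simp add: generic_def)
  qed
  have f: "integrable M f"
  proof (rule integrable_const_bound[where B = "real K"])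
    have "V j \<in> borel_measurable M" if "j \<in> {1..K}" for j
      using measurable_input[of j] that by (simp add: input_def)
    thus "f \<in> borel_measurable M"
      unfolding f_def [abs_def] spacing_def
      by (intro measurable_opt_cost borel_measurable_diff measurable_sorted_pivot) auto
    show "AE \<omega> in M. norm (f \<omega>) \<le> real K"
      using interior
    proof eventually_elim
      case (elim \<omega>)
      hence "(\<lambda>j. V j \<omega>) ` {1..K} \<subseteq> {0..1}" by force
      from opt_cost_spacing_bounds[OF this] show ?case by (simp add: f_def)
    qed
  qed
  have close: "AE \<omega> in M. \<bar>f \<omega> - g \<omega>\<bar> \<le> \<epsilon>"
    using interior AE_space
  proof eventually_elim
    case (elim \<omega>)
    define w where "w = (\<lambda>j\<in>{1..K}. nat \<lceil>real n * V j \<omega>\<rceil>)"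
    \<comment> \<open>Scaling by \<open>n\<close> but dividing by \<open>n + 1\<close> sends the
      \<open>n\<close> cells to the \<open>n\<close> interior grid points; this moves a pivot by at
      most \<open>1 / (n + 1)\<close>.\<close>
    define h where "h x = of_int \<lceil>real n * x\<rceil> / real (Suc n)" for x
    have pos: "0 < V j \<omega>" "V j \<omega> < 1" if "j \<in> {1..K}" for j
      using elim(1) that by (simp_all add: image_subset_iff)
    have w: "w \<in> A"
      unfolding A_def
    proof (rule PiE_I)
      fix j assume j: "j \<in> {1..K}"
      have "\<lceil>real n * V j \<omega>\<rceil> \<ge> 1" using pos[OF j] assms by simp
      moreover have "\<lceil>real n * V j \<omega>\<rceil> \<le> int n"
        using pos[OF j] assms by (simp add: ceiling_le_iff mult_le_cancel_left1)
      ultimately have "nat \<lceil>real n * V j \<omega>\<rceil> \<in> {1..<Suc n}"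
        unfolding atLeastLessThan_iff by linarith
      thus "w j \<in> {1..<Suc n}" using j by (simp add: w_def)
    qed (auto simp: w_def)
    have "g \<omega> = (\<Sum>w'\<in>A. if w = w' then grid_cost K (Suc n) w' else 0)"
      unfolding g_def
    proof (rule sum.cong[OF refl])
      fix w' assume w': "w' \<in> A"
      have "(\<forall>j\<in>{1..K}. nat \<lceil>real n * V j \<omega>\<rceil> = w' j) \<longleftrightarrow> (\<forall>j\<in>{1..K}. w j = w' j)"
        by (simp add: w_def)
      also have "\<dots> \<longleftrightarrow> w = w'"
        using PiE_ext[OF w[unfolded A_def] w'[unfolded A_def]] by blast
      finally show "grid_cost K (Suc n) w' * indicat_real (E w') \<omega> = (if w = w' then grid_cost K (Suc n) w' else 0)"
        using elim(2) by (simp add: E_def indicator_def)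
    qed
    also have "\<dots> = grid_cost K (Suc n) w" using w \<open>finite A\<close> by (simp add: sum.delta')
    also have "\<dots> = opt_cost K (spacing K (\<lambda>j. h (V j \<omega>)))"
    proof -
      have "real (w j) / real (Suc n) = h (V j \<omega>)" if j: "j \<in> {1..K}" for j
        using pos[OF j] j by (simp add: w_def h_def)
      hence "sorted_pivot K (\<lambda>j. real (w j) / real (Suc n)) = sorted_pivot K (\<lambda>j. h (V j \<omega>))"
        by (rule sorted_pivot_cong)
      thus ?thesis by (simp add: grid_cost_def spacing_def [abs_def])
    qed
    finally have g_eq: "g \<omega> = opt_cost K (spacing K (\<lambda>j. h (V j \<omega>)))" .
    have "mono h" unfolding h_def
      by (intro monoI divide_right_mono) (auto intro!: ceiling_mono mult_left_mono)
    moreover have "\<bar>h (V j \<omega>) - V j \<omega>\<bar> \<le> 1 / real n" if j: "j \<in> {1..K}" for j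
    proof -
      define c where "c = real_of_int \<lceil>real n * V j \<omega>\<rceil>"
      have c: "real n * V j \<omega> \<le> c" "c \<le> real n * V j \<omega> + 1"
        unfolding c_def by linarith+
      have "\<bar>c - real (Suc n) * V j \<omega>\<bar> \<le> 1"
        using c pos[OF j] by (simp add: algebra_simps abs_le_iff)
      hence "\<bar>c - real (Suc n) * V j \<omega>\<bar> / real (Suc n) \<le> 1 / real (Suc n)"
        by (intro divide_right_mono) auto
      also have "\<bar>c - real (Suc n) * V j \<omega>\<bar> / real (Suc n) = \<bar>c / real (Suc n) - V j \<omega>\<bar>"
        by (subst abs_div_pos) (auto simp: diff_divide_distrib)
      finally have "\<bar>c / real (Suc n) - V j \<omega>\<bar> \<le> 1 / real (Suc n)" .
      also have "\<dots> \<le> 1 / real n" using assms by (intro divide_left_mono) auto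
      finally show ?thesis by (simp add: h_def c_def)
    qed
    ultimately have "\<bar>opt_cost K (spacing K (\<lambda>j. h (V j \<omega>))) - opt_cost K (spacing K (\<lambda>j. V j \<omega>))\<bar>
        \<le> real (K + 1) * real K * (2 * (1 / real n))"
      by (rule opt_cost_spacing_round) auto
    thus ?case unfolding g_eq f_def \<epsilon>_def by (simp add: abs_minus_commute)
  qed
  have "expectation (\<lambda>\<omega>. f \<omega> - g \<omega>) \<le> \<epsilon>" "expectation (\<lambda>\<omega>. g \<omega> - f \<omega>) \<le> \<epsilon>"
    by (rule integral_le_const;
        (rule Bochner_Integration.integrable_diff[OF f g(1)] Bochner_Integration.integrable_diff[OF g(1) f]
          | rule eventually_mono[OF close], linarith))+
  hence "\<bar>expectation f - expectation g\<bar> \<le> \<epsilon>" using f g(1) by (simp add: abs_le_iff)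
  thus ?thesis by (simp add: g(2) f_def [abs_def] mean_opt_cost_def \<epsilon>_def A_def)
qed

text \<open>Rounding contributes \<open>2 * (K + 1) * K / n\<close>. Passing from all tuples to
  injective ones contributes \<open>K ^ 3 / n\<close>: at most a fraction
  \<open>K\<^sup>2 / n\<close> of the tuples is lost, and each costs at most
  \<open>K\<close>.\<close>

lemma mean_opt_cost_near_grid_avg:
  assumes "n \<ge> K"
  shows "\<bar>mean_opt_cost M K V - grid_avg (Suc n)\<bar> \<le> real (2 * (K + 1) * K + K ^ 3) / real n"
proof -
  have n: "n \<ge> 1" using assms K_pos by linarith
  define A where "A = {1..K} \<rightarrow>\<^sub>E {1..<Suc n}"
  define B where "B = {w. w \<in> A \<and> inj_on w {1..K}}"
  define G where "G = (\<Sum>w\<in>A. grid_cost K (Suc n) w) / real n ^ K"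
  define q where "q = fact K * real (n choose K) / real n ^ K"
  have "finite A" "B \<subseteq> A" unfolding A_def B_def by (auto intro: finite_PiE)
  have cardA: "real (card A) = real n ^ K" unfolding A_def by (subst card_PiE) auto
  have cost: "0 \<le> grid_cost K (Suc n) w" "grid_cost K (Suc n) w \<le> real K" if "w \<in> A" for w
  proof -
    have "(\<lambda>j. real (w j) / real (Suc n)) ` {1..K} \<subseteq> {0..1}"
    proof
      fix x assume "x \<in> (\<lambda>j. real (w j) / real (Suc n)) ` {1..K}"
      then obtain j where j: "j \<in> {1..K}" "x = real (w j) / real (Suc n)" by blast
      hence "w j < Suc n" using that by (auto simp: A_def PiE_iff)
      thus "x \<in> {0..1}" using j by (simp add: divide_le_eq)
    qed
    from opt_cost_spacing_bounds[OF this]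
    show "0 \<le> grid_cost K (Suc n) w" "grid_cost K (Suc n) w \<le> real K" by (simp_all add: grid_cost_def)
  qed
  have nK: "real n ^ K > 0" using n by simp
  have "n choose K > 0" using assms by simp
  have sumB: "(\<Sum>w\<in>B. grid_cost K (Suc n) w) / real n ^ K = q * grid_avg (Suc n)"
    using sum_grid_cost_inj[of "Suc n" K] \<open>n choose K > 0\<close> by (simp add: B_def A_def q_def grid_avg_def)
  have cardB: "real (card B) = q * real n ^ K"
    using inj_tuples_fraction(3)[OF assms n] nK by (simp add: B_def A_def q_def)
  have avg: "0 \<le> grid_avg (Suc n)" "grid_avg (Suc n) \<le> real K"
  proof -
    have "q > 0" unfolding q_def using \<open>n choose K > 0\<close> n by simp
    have "0 \<le> (\<Sum>w\<in>B. grid_cost K (Suc n) w)" using cost \<open>B \<subseteq> A\<close> by (intro sum_nonneg) auto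
    hence "0 \<le> q * grid_avg (Suc n)" unfolding sumB[symmetric] using nK by simp
    thus "0 \<le> grid_avg (Suc n)" using \<open>q > 0\<close> by (simp add: zero_le_mult_iff)
    have "(\<Sum>w\<in>B. grid_cost K (Suc n) w) \<le> (\<Sum>w\<in>B. real K)" using cost \<open>B \<subseteq> A\<close> by (intro sum_mono) auto
    hence "q * grid_avg (Suc n) \<le> q * real K"
      unfolding sumB[symmetric] using nK cardB by (simp add: pos_divide_le_eq mult_ac)
    thus "grid_avg (Suc n) \<le> real K" using \<open>q > 0\<close> by simp
  qed
  have q: "1 - q \<le> real K * real K / real n" "0 \<le> 1 - q"
    using inj_tuples_fraction(1,2)[OF assms n] by (simp_all add: q_def)
  have split: "G = q * grid_avg (Suc n) + (\<Sum>w\<in>A - B. grid_cost K (Suc n) w) / real n ^ K"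
    unfolding G_def sumB[symmetric] using sum.subset_diff[OF \<open>B \<subseteq> A\<close> \<open>finite A\<close>, of "grid_cost K (Suc n)"]
    by (simp add: add_divide_distrib)
  have rest: "0 \<le> (\<Sum>w\<in>A - B. grid_cost K (Suc n) w) / real n ^ K"
    "(\<Sum>w\<in>A - B. grid_cost K (Suc n) w) / real n ^ K \<le> (1 - q) * real K"
  proof -
    show "0 \<le> (\<Sum>w\<in>A - B. grid_cost K (Suc n) w) / real n ^ K"
      using cost nK by (intro divide_nonneg_pos sum_nonneg) auto
    have "(\<Sum>w\<in>A - B. grid_cost K (Suc n) w) \<le> (\<Sum>w\<in>A - B. real K)" using cost by (intro sum_mono) auto
    also have "\<dots> = (real (card A) - real (card B)) * real K"
      using \<open>finite A\<close> \<open>B \<subseteq> A\<close> card_mono[OF \<open>finite A\<close> \<open>B \<subseteq> A\<close>]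
      by (simp add: card_Diff_subset finite_subset of_nat_diff)
    also have "\<dots> = (1 - q) * real K * real n ^ K" by (simp add: cardA cardB algebra_simps)
    finally show "(\<Sum>w\<in>A - B. grid_cost K (Suc n) w) / real n ^ K \<le> (1 - q) * real K"
      using nK by (simp add: pos_divide_le_eq)
  qed
  \<comment> \<open>Both terms on the right lie between 0 and \<open>(1 - q) * real K\<close>, hence
    so does the modulus of their difference.\<close>
  have "G - grid_avg (Suc n) = (\<Sum>w\<in>A - B. grid_cost K (Suc n) w) / real n ^ K - (1 - q) * grid_avg (Suc n)"
    by (simp add: split algebra_simps)
  moreover have "0 \<le> (1 - q) * grid_avg (Suc n)" "(1 - q) * grid_avg (Suc n) \<le> (1 - q) * real K"
    using q avg by (auto intro: mult_left_mono)
  ultimately have "\<bar>G - grid_avg (Suc n)\<bar> \<le> (1 - q) * real K" using rest by linarith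
  also have "\<dots> \<le> real K * real K / real n * real K" using q by (intro mult_right_mono) auto
  finally have "\<bar>G - grid_avg (Suc n)\<bar> \<le> real K * real K / real n * real K" .
  moreover have "\<bar>mean_opt_cost M K V - G\<bar> \<le> real (K + 1) * real K * (2 / real n)"
    using mean_opt_cost_near_grid_mean[OF n] by (simp add: G_def A_def)
  ultimately have "\<bar>mean_opt_cost M K V - grid_avg (Suc n)\<bar> \<le>
      real (K + 1) * real K * (2 / real n) + real K * real K / real n * real K" by linarith
  also have "\<dots> = real (2 * (K + 1) * K + K ^ 3) / real n"
    by (simp add: power3_eq_cube add_divide_distrib algebra_simps)
  finally show ?thesis .
qed

end

section \<open>The recurrence for the expectations\<close>

context optimal_quicksort
begin

abbreviation (input) partition_cost :: "nat \<Rightarrow> 'a \<Rightarrow> nat" where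
  "partition_cost n \<omega> \<equiv> partition_comparisons K r R (\<lambda>j. V j \<omega>) (\<lambda>k. a k \<omega>) n"

abbreviation (input) mean_cost :: "nat \<Rightarrow> real" where
  "mean_cost n \<equiv> expectation (\<lambda>\<omega>. real (partition_cost n \<omega>))"

abbreviation (input) mean_X :: "nat \<Rightarrow> real" where
  "mean_X n \<equiv> expectation (\<lambda>\<omega>. real (X n \<omega>))"

abbreviation (input) list_size :: "nat \<Rightarrow> nat \<Rightarrow> 'a \<Rightarrow> nat" where
  "list_size n i \<omega> \<equiv> sublist_size K (\<lambda>j. V j \<omega>) (\<lambda>k. a k \<omega>) n i"

text \<open>Sorting the pivots costs between 0 and \<open>K\<^sup>2\<close>. The upper bound is
  guaranteed for distinct keys, hence almost everywhere.\<close>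

lemma AE_partition_cost:
  "AE \<omega> in M. (\<Sum>k=1..n - K. last_cost k \<omega>) \<le> real (partition_cost n \<omega>) \<and>
     real (partition_cost n \<omega>) \<le> (\<Sum>k=1..n - K. last_cost k \<omega>) + real (K\<^sup>2)"
proof -
  have "AE \<omega> in M. \<forall>k\<in>{1..n - K}. real (element_cost k \<omega>) = last_cost k \<omega>"
    by (rule AE_finite_allI) (use AE_last_cost in auto)
  with AE_generic[of K] show ?thesis
  proof eventually_elim
    case (elim \<omega>)
    define c where "c = comparisons (\<lambda>i. V (Suc i) \<omega>) R"
    have "inj_on (\<lambda>i. V (Suc i) \<omega>) {..<K}"
    proof (rule inj_onI)
      fix i j assume ij: "i \<in> {..<K}" "j \<in> {..<K}" "V (Suc i) \<omega> = V (Suc j) \<omega>"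
      hence "input \<omega> (Suc i) = input \<omega> (Suc j)" by (simp add: input_def)
      moreover have "inj_on (input \<omega>) {1..K}" using elim(1) by (simp add: generic_def)
      ultimately show "i = j" using ij by (auto dest: inj_onD)
    qed
    hence c: "c \<le> K\<^sup>2" using pivot_sort(2) by (simp add: c_def cost_at_most_def)
    have "real (partition_cost n \<omega>) = (\<Sum>k=1..n - K. real (element_cost k \<omega>)) + real c"
      unfolding partition_comparisons_def element_cost_def c_def by (simp only: of_nat_add of_nat_sum)
    also have "\<dots> = (\<Sum>k=1..n - K. last_cost k \<omega>) + real c"
      using elim(2) by (intro arg_cong2[where f = "(+)"] sum.cong refl) blast
    finally show ?case using c by simp
  qed
qed

text \<open>Read off from the independence hypothesis, which places the sigma-algebra generated by
  the sublist sizes and the partitioning cost inside the events.\<close>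

lemma measurable_partition_cost:
  assumes "K < n"
  shows "partition_cost n \<in> measurable M (count_space UNIV)"
proof (rule measurableI)
  let ?W = "\<lambda>\<omega>. (\<lambda>i\<in>{..K}. list_size n i \<omega>, partition_cost n \<omega>)"
  let ?N = "(\<Pi>\<^sub>M i\<in>{..K}. count_space UNIV) \<Otimes>\<^sub>M count_space UNIV :: ((nat \<Rightarrow> nat) \<times> nat) measure"
  fix A :: "nat set"
  have "?W \<in> vimage_algebra (space M) ?W ?N \<rightarrow>\<^sub>M ?N"
    by (rule measurable_vimage_algebra1) (auto simp: space_pair_measure space_PiM)
  hence "(\<lambda>\<omega>. snd (?W \<omega>)) \<in> vimage_algebra (space M) ?W ?N \<rightarrow>\<^sub>M count_space UNIV"
    by (rule measurable_compose) (rule measurable_snd)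
  from measurable_sets[OF this, of A]
  have "partition_cost n -` A \<inter> space M \<in> sets (vimage_algebra (space M) ?W ?N)" by simp
  thus "partition_cost n -` A \<inter> space M \<in> events"
    using indep_setD_ev2[OF Y_indep_partition[OF assms]] by blast
qed simp

lemma expectation_partition_cost:
  assumes "K < n"
  shows "integrable M (\<lambda>\<omega>. real (partition_cost n \<omega>))"
    and "\<bar>mean_cost n - (\<Sum>k=1..n - K. grid_avg (K + k))\<bar> \<le> real (K\<^sup>2)"
proof -
  define s where "s \<omega> = (\<Sum>k=1..n - K. last_cost k \<omega>)" for \<omega>
  have s: "integrable M s" "expectation s = (\<Sum>k=1..n - K. grid_avg (K + k))"
  proof -
    have int: "integrable M (last_cost k)" if "k \<in> {1..n - K}" for k
      using that by (intro integrable_last_cost) simp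
    show "integrable M s" unfolding s_def [abs_def] using int by (intro Bochner_Integration.integrable_sum)
    have "expectation s = (\<Sum>k=1..n - K. expectation (last_cost k))"
      unfolding s_def [abs_def] using int by (intro Bochner_Integration.integral_sum)
    thus "expectation s = (\<Sum>k=1..n - K. grid_avg (K + k))" by (simp add: expectation_last_cost)
  qed
  have bounds: "AE \<omega> in M. s \<omega> \<le> real (partition_cost n \<omega>) \<and> real (partition_cost n \<omega>) \<le> s \<omega> + real (K\<^sup>2)"
    unfolding s_def by (rule AE_partition_cost)
  show int: "integrable M (\<lambda>\<omega>. real (partition_cost n \<omega>))"
  proof (rule Bochner_Integration.integrable_bound)
    show "integrable M (\<lambda>\<omega>. s \<omega> + real (K\<^sup>2))" using s(1) by (intro Bochner_Integration.integrable_add) auto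
    show "(\<lambda>\<omega>. real (partition_cost n \<omega>)) \<in> borel_measurable M"
      by (rule measurable_compose[OF measurable_partition_cost[OF assms]]) simp
    show "AE \<omega> in M. norm (real (partition_cost n \<omega>)) \<le> norm (s \<omega> + real (K\<^sup>2))"
      using bounds by eventually_elim auto
  qed
  have "0 \<le> expectation (\<lambda>\<omega>. real (partition_cost n \<omega>) - s \<omega>)"
    by (rule integral_nonneg_AE) (use bounds in eventually_elim, simp)
  moreover have "expectation (\<lambda>\<omega>. real (partition_cost n \<omega>) - s \<omega>) \<le> real (K\<^sup>2)"
  proof (rule integral_le_const)
    show "AE \<omega> in M. real (partition_cost n \<omega>) - s \<omega> \<le> real (K\<^sup>2)"
      using bounds by eventually_elim linarith
  qed (rule Bochner_Integration.integrable_diff[OF int s(1)])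
  ultimately show "\<bar>mean_cost n - (\<Sum>k=1..n - K. grid_avg (K + k))\<bar> \<le> real (K\<^sup>2)"
    using int s by simp
qed

lemma harm_le_ln: "n \<ge> 1 \<Longrightarrow> harm n \<le> ln (real n) + 1"
  using euler_mascheroni_sequence_decreasing[of 1 n] by (simp add: harm_expand)

lemma expectation_partition_cost_asymp:
  "(\<lambda>n. mean_cost n - mean_opt_cost M K V * real n) \<in> O(\<lambda>n. ln (real n))"
proof -
  define \<gamma> where "\<gamma> = mean_opt_cost M K V"
  define C where "C = real (2 * (K + 1) * K + K ^ 3)"
  \<comment> \<open>The three parts account for sorting the pivots, for replacing
    \<open>n - K\<close> by \<open>n\<close>, and for the summed errors \<open>C / k\<close>, where
    \<open>ln n + 1\<close> is at most \<open>2 * ln n\<close>.\<close>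
  define c where "c = real (K\<^sup>2) + real K * \<bar>\<gamma>\<bar> + 2 * C"
  have "C \<ge> 0" by (simp add: C_def)
  have "eventually (\<lambda>n. ln (real n) \<ge> 1) at_top" by real_asymp
  hence "eventually (\<lambda>n. norm (mean_cost n - \<gamma> * real n) \<le> c * norm (ln (real n))) at_top"
    using eventually_gt_at_top[of K]
  proof eventually_elim
    case (elim n)
    have "\<bar>(\<Sum>k=1..n - K. grid_avg (K + k)) - \<gamma> * real (n - K)\<bar> = \<bar>\<Sum>k=1..n - K. (grid_avg (K + k) - \<gamma>)\<bar>"
      by (simp add: sum_subtractf mult.commute)
    also have "\<dots> \<le> (\<Sum>k=1..n - K. \<bar>grid_avg (K + k) - \<gamma>\<bar>)" by (rule sum_abs)
    also have "\<dots> \<le> (\<Sum>k=1..n - K. C * inverse (real k))"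
    proof (rule sum_mono)
      fix k assume k: "k \<in> {1..n - K}"
      have "\<bar>\<gamma> - grid_avg (Suc (K + k - 1))\<bar> \<le> C / real (K + k - 1)"
        unfolding \<gamma>_def C_def using k by (intro mean_opt_cost_near_grid_avg) auto
      also have "\<dots> \<le> C / real k"
        using k K_pos \<open>C \<ge> 0\<close> by (intro divide_left_mono) auto
      finally show "\<bar>grid_avg (K + k) - \<gamma>\<bar> \<le> C * inverse (real k)"
        using k by (simp add: abs_minus_commute divide_inverse)
    qed
    also have "\<dots> = C * harm (n - K)" by (simp add: harm_def sum_distrib_left)
    also have "\<dots> \<le> C * harm n" using \<open>C \<ge> 0\<close> by (intro mult_left_mono harm_mono) auto
    also have "\<dots> \<le> C * (ln (real n) + 1)" using \<open>C \<ge> 0\<close> elim by (intro mult_left_mono harm_le_ln) auto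
    also have "\<dots> \<le> 2 * C * ln (real n)"
      using mult_left_mono[OF elim(1) \<open>C \<ge> 0\<close>] by (simp add: algebra_simps)
    finally have 1: "\<bar>(\<Sum>k=1..n - K. grid_avg (K + k)) - \<gamma> * real (n - K)\<bar> \<le> 2 * C * ln (real n)" .
    have 2: "\<gamma> * real (n - K) = \<gamma> * real n - \<gamma> * real K"
      using elim(2) by (simp add: of_nat_diff right_diff_distrib)
    have 3: "\<bar>\<gamma> * real K\<bar> = real K * \<bar>\<gamma>\<bar>" by (simp add: abs_mult)
    have "real (K\<^sup>2) + real K * \<bar>\<gamma>\<bar> \<le> (real (K\<^sup>2) + real K * \<bar>\<gamma>\<bar>) * ln (real n)"
      using mult_left_mono[OF elim(1), of "real (K\<^sup>2) + real K * \<bar>\<gamma>\<bar>"] by simp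
    moreover have "\<bar>mean_cost n - \<gamma> * real n\<bar> \<le>
        real (K\<^sup>2) + real K * \<bar>\<gamma>\<bar> + 2 * C * ln (real n)"
      using expectation_partition_cost(2)[OF elim(2)] 1 2 3 by linarith
    ultimately have "\<bar>mean_cost n - \<gamma> * real n\<bar> \<le> c * ln (real n)"
      by (simp add: c_def distrib_right)
    thus ?case using elim(1) by simp
  qed
  thus ?thesis unfolding \<gamma>_def by (rule bigoI)
qed

section \<open>From the distributional recursion to a recurrence for the means\<close>

lemma measurable_Y: "i \<le> K \<Longrightarrow> Y i m \<in> measurable M (count_space UNIV)"
proof -
  assume "i \<le> K"
  hence "(\<lambda>\<omega> m. Y i m \<omega>) \<in> M \<rightarrow>\<^sub>M (\<Pi>\<^sub>M m\<in>UNIV. count_space UNIV)"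
    using Y_indep by (auto simp: indep_vars_def)
  from measurable_compose[OF this measurable_component_singleton[of m]] show ?thesis by simp
qed

text \<open>Each of the two variables is a coordinate of one of the independent vectors, and
  sub-sigma-algebras of independent sigma-algebras are independent.\<close>

lemma indep_var_Y_list_size:
  assumes "K < n" "i \<le> K"
  shows "indep_var (count_space UNIV) (Y i m) (count_space UNIV) (list_size n i)"
proof -
  let ?W1 = "\<lambda>\<omega>. \<lambda>i\<in>{..K}. \<lambda>m. Y i m \<omega>"
  let ?N1 = "(\<Pi>\<^sub>M i\<in>{..K}. \<Pi>\<^sub>M m\<in>UNIV. count_space UNIV) :: (nat \<Rightarrow> nat \<Rightarrow> nat) measure"
  let ?W2 = "\<lambda>\<omega>. (\<lambda>i\<in>{..K}. list_size n i \<omega>, partition_cost n \<omega>)"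
  let ?N2 = "(\<Pi>\<^sub>M i\<in>{..K}. count_space UNIV) \<Otimes>\<^sub>M count_space UNIV :: ((nat \<Rightarrow> nat) \<times> nat) measure"
  let ?S1 = "sets (vimage_algebra (space M) ?W1 ?N1)" and ?S2 = "sets (vimage_algebra (space M) ?W2 ?N2)"
  have W1: "?W1 \<in> vimage_algebra (space M) ?W1 ?N1 \<rightarrow>\<^sub>M ?N1"
    by (rule measurable_vimage_algebra1) (auto simp: space_PiM)
  have W2: "?W2 \<in> vimage_algebra (space M) ?W2 ?N2 \<rightarrow>\<^sub>M ?N2"
    by (rule measurable_vimage_algebra1) (auto simp: space_pair_measure space_PiM)
  have "(\<lambda>f. f i) \<in> ?N1 \<rightarrow>\<^sub>M (\<Pi>\<^sub>M m\<in>UNIV. count_space UNIV)"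
    using assms(2) by (intro measurable_component_singleton) simp
  hence "(\<lambda>f. f i m) \<in> ?N1 \<rightarrow>\<^sub>M count_space UNIV"
    by (rule measurable_compose) (rule measurable_component_singleton, simp)
  from measurable_compose[OF W1 this] assms(2)
  have Y: "Y i m \<in> vimage_algebra (space M) ?W1 ?N1 \<rightarrow>\<^sub>M count_space UNIV" by simp
  have "(\<lambda>p. fst p i) \<in> ?N2 \<rightarrow>\<^sub>M count_space UNIV"
    using assms(2) by (intro measurable_compose[OF measurable_fst measurable_component_singleton]) auto
  from measurable_compose[OF W2 this] assms(2)
  have I: "list_size n i \<in> vimage_algebra (space M) ?W2 ?N2 \<rightarrow>\<^sub>M count_space UNIV" by simp
  have ind: "indep_set ?S1 ?S2" by (rule Y_indep_partition[OF assms(1)])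
  have sub1: "sigma_sets (space M) {Y i m -` A \<inter> space M |A. A \<in> sets (count_space UNIV)} \<subseteq> ?S1"
  proof -
    note measurable_sets[OF Y]
    hence "{Y i m -` A \<inter> space M |A. A \<in> sets (count_space UNIV)} \<subseteq> ?S1"
      unfolding space_vimage_algebra by blast
    from sets.sigma_sets_subset[OF this] show ?thesis unfolding space_vimage_algebra .
  qed
  have sub2: "sigma_sets (space M) {list_size n i -` A \<inter> space M |A. A \<in> sets (count_space UNIV)} \<subseteq> ?S2"
  proof -
    note measurable_sets[OF I]
    hence "{list_size n i -` A \<inter> space M |A. A \<in> sets (count_space UNIV)} \<subseteq> ?S2"
      unfolding space_vimage_algebra by blast
    from sets.sigma_sets_subset[OF this] show ?thesis unfolding space_vimage_algebra .
  qed
  have "indep_set (sigma_sets (space M) {Y i m -` A \<inter> space M |A. A \<in> sets (count_space UNIV)})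
      (sigma_sets (space M) {list_size n i -` A \<inter> space M |A. A \<in> sets (count_space UNIV)})"
    using ind unfolding indep_set_def
    by (rule indep_sets_mono_sets) (use sub1 sub2 in \<open>auto split: bool.split\<close>)
  moreover have "list_size n i \<in> M \<rightarrow>\<^sub>M count_space UNIV"
  proof (rule measurableI)
    fix A :: "nat set"
    show "list_size n i -` A \<inter> space M \<in> events"
      using measurable_sets[OF I, of A] indep_setD_ev2[OF ind] by auto
  qed simp
  ultimately show ?thesis using measurable_Y[OF assms(2)] by (simp add: indep_var_eq)
qed

lemma integrable_X_small:
  assumes "n \<le> K"
  shows "integrable M (\<lambda>\<omega>. real (X n \<omega>))"
proof (rule integrable_const_bound[where B = "real (K\<^sup>2)"])
  have fin: "finite {\<pi>. \<pi> permutes {..<n}}" "{\<pi>. \<pi> permutes {..<n}} \<noteq> {}"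
    using finite_permutations[of "{..<n}"] permutes_id[of "{..<n}"] by (simp, blast)
  have "AE y in distr M (count_space UNIV) (X n). y \<le> K\<^sup>2"
    unfolding X_small[OF assms] AE_measure_pmf_iff
  proof
    fix y assume "y \<in> set_pmf (map_pmf (\<lambda>\<pi>. comparisons (\<lambda>i. real (\<pi> i)) (A n)) (pmf_of_set {\<pi>. \<pi> permutes {..<n}}))"
    then obtain \<pi> where \<pi>: "\<pi> permutes {..<n}" "y = comparisons (\<lambda>i. real (\<pi> i)) (A n)"
      using fin by (auto simp: set_pmf_of_set)
    have "inj_on (\<lambda>i. real (\<pi> i)) {..<n}" using permutes_inj_on[OF \<pi>(1)] by (auto simp: inj_on_def)
    thus "y \<le> K\<^sup>2" using small_sort(2)[OF assms] \<pi>(2) by (simp add: cost_at_most_def)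
  qed
  hence "AE \<omega> in M. X n \<omega> \<le> K\<^sup>2" by (rule AE_distrD[OF X_measurable])
  thus "AE \<omega> in M. norm (real (X n \<omega>)) \<le> real (K\<^sup>2)" by eventually_elim (simp flip: of_nat_power)
  show "(\<lambda>\<omega>. real (X n \<omega>)) \<in> borel_measurable M"
    by (rule measurable_compose[OF X_measurable]) simp
qed

lemma sublist_size_less: "K < n \<Longrightarrow> list_size n i \<omega> < n"
proof -
  assume "K < n"
  have "list_size n i \<omega> \<le> card {1..n - K}" unfolding sublist_size_def by (rule card_mono) auto
  thus ?thesis using K_pos \<open>K < n\<close> by simp
qed

text \<open>The random index in \<open>Y i (list_size n i \<omega>)\<close> is resolved by splitting
  over its values \<open>j < n\<close>; each term is a product of independent variables. Equality in
  law carries both integrability and the mean over to \<open>X n\<close>.\<close>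

lemma expectation_X_rec:
  assumes n: "K < n" and IH: "\<And>m. m < n \<Longrightarrow> integrable M (\<lambda>\<omega>. real (X m \<omega>))"
  shows "integrable M (\<lambda>\<omega>. real (X n \<omega>))"
    and "mean_X n =
      real (K + 1) * (\<Sum>j<n. real ((n - 1 - j) choose (K - 1)) / real (n choose K) * mean_X j)
      + mean_cost n"
proof -
  define S where "S i \<omega> = (\<Sum>j<n. real (Y i j \<omega>) * of_bool (list_size n i \<omega> = j))" for i \<omega>
  define T where "T \<omega> = (\<Sum>i\<le>K. Y i (list_size n i \<omega>) \<omega>) + partition_cost n \<omega>" for \<omega>
  have T: "real (T \<omega>) = (\<Sum>i\<le>K. S i \<omega>) + real (partition_cost n \<omega>)" for \<omega>
  proof -
    have "S i \<omega> = real (Y i (list_size n i \<omega>) \<omega>)" for i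
    proof -
      have "S i \<omega> = (\<Sum>j<n. if list_size n i \<omega> = j then real (Y i j \<omega>) else 0)"
        unfolding S_def by (intro sum.cong) auto
      thus ?thesis using sublist_size_less[OF n] by (simp add: sum.delta')
    qed
    thus ?thesis by (simp add: T_def)
  qed
  have Y: "integrable M (\<lambda>\<omega>. real (Y i j \<omega>))" "expectation (\<lambda>\<omega>. real (Y i j \<omega>)) = mean_X j"
    if "i \<le> K" "j < n" for i j
  proof -
    have "integrable (distr M (count_space UNIV) (Y i j)) real"
      unfolding Y_copies[OF that(1)] using IH[OF that(2)] X_measurable[of j] by (subst integrable_distr_eq) auto
    thus "integrable M (\<lambda>\<omega>. real (Y i j \<omega>))"
      using measurable_Y[OF that(1), of j] by (subst (asm) integrable_distr_eq) auto
    have "expectation (\<lambda>\<omega>. real (Y i j \<omega>)) = integral\<^sup>L (distr M (count_space UNIV) (Y i j)) real"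
      using measurable_Y[OF that(1), of j] by (subst integral_distr) auto
    also have "\<dots> = mean_X j"
      unfolding Y_copies[OF that(1)] using X_measurable[of j] by (subst integral_distr) auto
    finally show "expectation (\<lambda>\<omega>. real (Y i j \<omega>)) = mean_X j" .
  qed
  have prod: "integrable M (\<lambda>\<omega>. real (Y i j \<omega>) * of_bool (list_size n i \<omega> = j))"
    "expectation (\<lambda>\<omega>. real (Y i j \<omega>) * of_bool (list_size n i \<omega> = j)) =
       real ((n - 1 - j) choose (K - 1)) / real (n choose K) * mean_X j"
    if ij: "i \<le> K" "j < n" for i j
  proof -
    have "indep_var borel (real \<circ> Y i j) borel ((\<lambda>l. of_bool (l = j) :: real) \<circ> list_size n i)"
      by (rule indep_var_compose[OF indep_var_Y_list_size[OF n ij(1)]]) auto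
    hence ind: "indep_var borel (\<lambda>\<omega>. real (Y i j \<omega>)) borel (\<lambda>\<omega>. of_bool (list_size n i \<omega> = j) :: real)"
      by (simp add: o_def)
    have I_meas: "list_size n i \<in> M \<rightarrow>\<^sub>M count_space UNIV"
      using indep_var_rv2[OF indep_var_Y_list_size[OF n ij(1)]] .
    have ev: "{\<omega> \<in> space M. list_size n i \<omega> = j} \<in> events"
      using measurable_sets[OF I_meas, of "{j}"] by (simp add: vimage_def Int_def conj_commute)
    have I: "integrable M (\<lambda>\<omega>. of_bool (list_size n i \<omega> = j) :: real)"
      "expectation (\<lambda>\<omega>. of_bool (list_size n i \<omega> = j)) = real ((n - 1 - j) choose (K - 1)) / real (n choose K)"
    proof -
      have *: "of_bool (list_size n i \<omega> = j) = indicat_real {\<omega> \<in> space M. list_size n i \<omega> = j} \<omega>"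
        if "\<omega> \<in> space M" for \<omega> using that by (simp add: indicator_def)
      have "integrable M (indicat_real {\<omega> \<in> space M. list_size n i \<omega> = j})"
        using ev by (simp add: emeasure_eq_measure)
      thus "integrable M (\<lambda>\<omega>. of_bool (list_size n i \<omega> = j) :: real)"
        by (subst Bochner_Integration.integrable_cong[OF refl *]) auto
      have "expectation (\<lambda>\<omega>. of_bool (list_size n i \<omega> = j)) = expectation (indicat_real {\<omega> \<in> space M. list_size n i \<omega> = j})"
        by (rule Bochner_Integration.integral_cong[OF refl *])
      also have "\<dots> = prob {\<omega> \<in> space M. list_size n i \<omega> = j}" using ev by simp
      also have "\<dots> = real ((n - 1 - j) choose (K - 1)) / real (n choose K)"
        using n ij by (intro prob_sublist_size) auto
      finally show "expectation (\<lambda>\<omega>. of_bool (list_size n i \<omega> = j)) = real ((n - 1 - j) choose (K - 1)) / real (n choose K)" .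
    qed
    show "integrable M (\<lambda>\<omega>. real (Y i j \<omega>) * of_bool (list_size n i \<omega> = j))"
      by (rule indep_var_integrable[OF ind Y(1)[OF ij] I(1)])
    show "expectation (\<lambda>\<omega>. real (Y i j \<omega>) * of_bool (list_size n i \<omega> = j)) =
       real ((n - 1 - j) choose (K - 1)) / real (n choose K) * mean_X j"
      unfolding indep_var_lebesgue_integral[OF ind Y(1)[OF ij] I(1)] I(2) Y(2)[OF ij] by (rule mult.commute)
  qed
  have S: "integrable M (S i)" "expectation (S i) =
      (\<Sum>j<n. real ((n - 1 - j) choose (K - 1)) / real (n choose K) * mean_X j)"
    if "i \<le> K" for i
  proof -
    show "integrable M (S i)"
      unfolding S_def [abs_def] by (rule Bochner_Integration.integrable_sum) (use prod(1)[OF that] in simp)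
    have "expectation (S i) = (\<Sum>j<n. expectation (\<lambda>\<omega>. real (Y i j \<omega>) * of_bool (list_size n i \<omega> = j)))"
      unfolding S_def [abs_def] by (rule Bochner_Integration.integral_sum) (use prod(1)[OF that] in simp)
    thus "expectation (S i) =
        (\<Sum>j<n. real ((n - 1 - j) choose (K - 1)) / real (n choose K) * mean_X j)"
      using prod(2)[OF that] by simp
  qed
  have intT: "integrable M (\<lambda>\<omega>. real (T \<omega>))"
    unfolding T using S(1) expectation_partition_cost(1)[OF n]
    by (intro Bochner_Integration.integrable_add Bochner_Integration.integrable_sum) auto
  \<comment> \<open>The change of variables through \<open>distr\<close> requires a measurable
    \<open>T\<close>; this follows from its integrable real version, as rounding down recovers
    \<open>T\<close>.\<close>
  have T_meas: "T \<in> M \<rightarrow>\<^sub>M count_space UNIV"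
  proof -
    have [measurable]: "(\<lambda>\<omega>. real (T \<omega>)) \<in> borel_measurable M" using intT by (rule borel_measurable_integrable)
    have "(\<lambda>\<omega>. nat \<lfloor>real (T \<omega>)\<rfloor>) \<in> M \<rightarrow>\<^sub>M count_space UNIV" by measurable
    thus ?thesis by simp
  qed
  have law: "distr M (count_space UNIV) (X n) = distr M (count_space UNIV) T"
    unfolding T_def [abs_def] by (rule X_recursion[OF n])
  have "integrable (distr M (count_space UNIV) (X n)) real"
    unfolding law using intT T_meas by (subst integrable_distr_eq) auto
  thus "integrable M (\<lambda>\<omega>. real (X n \<omega>))"
    using X_measurable[of n] by (subst (asm) integrable_distr_eq) auto
  have "mean_X n = integral\<^sup>L (distr M (count_space UNIV) (X n)) real"
    using X_measurable[of n] by (subst integral_distr) auto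
  also have "\<dots> = expectation (\<lambda>\<omega>. real (T \<omega>))"
    unfolding law using T_meas by (subst integral_distr) auto
  also have "\<dots> = (\<Sum>i\<le>K. expectation (S i)) + mean_cost n"
    unfolding T using S(1) expectation_partition_cost(1)[OF n]
    by (subst Bochner_Integration.integral_add)
       (auto intro!: Bochner_Integration.integrable_sum simp: Bochner_Integration.integral_sum)
  also have "(\<Sum>i\<le>K. expectation (S i)) = real (K + 1) * (\<Sum>j<n. real ((n - 1 - j) choose (K - 1)) / real (n choose K) * mean_X j)"
    by (simp add: S(2))
  finally show "mean_X n =
      real (K + 1) * (\<Sum>j<n. real ((n - 1 - j) choose (K - 1)) / real (n choose K) * mean_X j)
      + mean_cost n" .
qed

lemma integrable_X: "integrable M (\<lambda>\<omega>. real (X n \<omega>))"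
proof (induction n rule: less_induct)
  case (less n)
  thus ?case using integrable_X_small[of n] expectation_X_rec(1)[of n] by (cases "n \<le> K") auto
qed

lemma expectation_X_asymp:
  defines "\<alpha> \<equiv> mean_opt_cost M K V / (harm (Suc K) - 1)"
  obtains \<beta> where
    "(\<lambda>n. mean_X n - (\<alpha> * real n * ln (real n) + \<beta> * real n)) \<in> o(\<lambda>n. real n)"
    "K \<le> 4 \<Longrightarrow> (\<lambda>n. mean_X n - (\<alpha> * real n * ln (real n) + \<beta> * real n)) \<in> O(\<lambda>n. ln (real n))"
proof (rule quicksort_recurrence_asymptotics[OF K_pos _ expectation_partition_cost_asymp])
  fix n assume n: "K < n"
  define s where "s = (\<Sum>j<n. real ((n - 1 - j) choose (K - 1)) * mean_X j)"
  have "real (n choose K) \<noteq> 0" using n by simp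
  have "(\<Sum>j<n. real ((n - 1 - j) choose (K - 1)) / real (n choose K) * mean_X j) = s / real (n choose K)"
    by (simp add: s_def sum_divide_distrib)
  hence "mean_X n = real (K + 1) * (s / real (n choose K)) + mean_cost n"
    using expectation_X_rec(2)[OF n integrable_X] by simp
  thus "real (n choose K) * mean_X n = real (K + 1) * s +
      real (n choose K) * mean_cost n"
    using \<open>real (n choose K) \<noteq> 0\<close> by (simp add: field_simps)
qed (use that in \<open>simp_all add: \<alpha>_def\<close>)

end

theorem theorem1:
  fixes M :: "'a measure" and K :: nat
    and V a :: "nat \<Rightarrow> 'a \<Rightarrow> real"
    and r :: "(nat tree \<times> nat tree) set"
    and R :: comparison_sort and A :: "nat \<Rightarrow> comparison_sort"
    and X :: "nat \<Rightarrow> 'a \<Rightarrow> nat" and Y :: "nat \<Rightarrow> nat \<Rightarrow> 'a \<Rightarrow> nat"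
  assumes "optimal_quicksort M K V a r R A X Y"
  shows "\<exists>\<beta>::real.
    let \<alpha> = mean_opt_cost M K V / (harm (Suc K) - 1);
        error = (\<lambda>n. (\<integral>\<omega>. real (X n \<omega>) \<partial>M) - (\<alpha> * real n * ln (real n) + \<beta> * real n))
    in error \<in> o(\<lambda>n. real n) \<and> (K \<le> 4 \<longrightarrow> error \<in> O(\<lambda>n. ln (real n)))"
proof -
  interpret optimal_quicksort M K V a r R A X Y by (rule assms)
  show ?thesis
    unfolding Let_def by (rule expectation_X_asymp) blast
qed

end
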